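(* Let $\varepsilon,\delta$ be real numbers, $\delta>0$, and suppose that $$\mathrm{cov}_{\delta n}\Big(\Big\{\nabla f(\boldsymbol{x},\cdot):\ \boldsymbol{x} \in \prod_{i=1}^n K_i\Big\},\|\cdot\|\Big) \leq e^{\varepsilon n}.$$ Then there are (i) a partition $\mathcal{P}$ of $\prod_{i=1}^n K_i$ into at most $e^{\varepsilon n}$ Borel parts and (ii) a selection of additively separable functions $g_P$ for $P \in \mathcal{P}$ such that $$\sum_{P \in \mathcal{P}}\mu(P)\cdot \mathrm{D}(\mu_{|P}\,\|\,\xi_{g_P}) < (\varepsilon + \delta)n$$ and $$\sum_{P \in \mathcal{P}}\mu(P)\cdot \overline{d_n}(\mu_{|P},\xi_{g_P}) < \sqrt{(\varepsilon + \delta)/2}.$$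
   Context: Setting. Let $n\ge 1$ and $[n]=\{1,\dots,n\}$. Let $(K_1,d_{K_1}),\dots,(K_n,d_{K_n})$ be nonempty, complete, separable metric spaces, all of diameter at most one. For each $i$ let $\lambda_i$ be a fixed Borel probability measure on $K_i$ and $\ast_i\in K_i$ a fixed reference point. Let $f:\prod_{i=1}^n K_i\to\mathbb{R}$ be bounded and continuous, and let $\mu$ be the Gibbs measure $\mu(d\boldsymbol{x}) = \frac1Z e^{f(\boldsymbol{x})}\prod_{i=1}^n\lambda_i(dx_i)$, where $Z$ is the normalizing constant. $\|\cdot\|$ denotes the uniform (sup) norm. Discrete gradient. For $\boldsymbol{x}\in\prod_iK_i$, $i\in[n]$, $y\in K_i$, put $\partial_i f(\boldsymbol{x},y) := f(x_1,\dots,x_{i-1},y,x_{i+1},\dots,x_n) - f(x_1,\dots,x_{i-1},\ast_i,x_{i+1},\dots,x_n)$, and for $\boldsymbol{x},\boldsymbol{y}\in\prod_iK_i$ put $\nabla f(\boldsymbol{x},\boldsymbol{y}) := \sum_{i=1}^n\partial_if(\boldsymbol{x},y_i)$. Covering numbers. For a set $F$ of bounded functions on $\prod_i K_i$, $\mathrm{cov}_{\delta n}(F,\|\cdot\|)$ is the smallest cardinality of a covering of $F$ by sets of $\|\cdot\|$-diameter less than $\delta n$. Product Gibbs measures. A function $g$ on $\prod_iK_i$ is additively separable if $g(\boldsymbol{x})=g_1(x_1)+\dots+g_n(x_n)$ with each $g_i:K_i\to\mathbb{R}$ bounded and continuous. For such $g$, $\xi_g$ denotes the probability measure proportional to $e^{g(\boldsymbol{x})}\prod_i\lambda_i(dx_i)$;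 it is a product measure. Transportation metric. $d_n(\boldsymbol{x},\boldsymbol{y}):=\frac1n\sum_{i=1}^nd_{K_i}(x_i,y_i)$, and for Borel probability measures $\nu,\nu'$ on $\prod_iK_i$, $\overline{d_n}(\nu,\nu'):=\inf_\lambda\int d_n(\boldsymbol{x},\boldsymbol{y})\,\lambda(d\boldsymbol{x},d\boldsymbol{y})$, the infimum being over all couplings $\lambda$ of $\nu$ and $\nu'$. Further notation. $\mu_{|P}=\mu(\cdot\mid P)$ for $\mu(P)>0$; terms with $\mu(P)=0$ are omitted from the sums. $\mathrm{D}(\nu\|\gamma)=\int\log\frac{d\nu}{d\gamma}\,d\nu$ (natural logarithm) if $\nu\ll\gamma$ and $+\infty$ otherwise (Kullback--Leibler divergence). *)

theory Defs
  imports "HOL-Probability.Probability"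
begin

(* The spaces K_1, ..., K_n are given as K :: nat => 'a metric, i.e. as metric spaces with
   carriers mspace (K i) inside one ambient type 'a (no restriction: take a disjoint union).
   Points of the product are extensional functions on {1..n}. *)

definition prod_top :: "nat \<Rightarrow> (nat \<Rightarrow> 'a metric) \<Rightarrow> (nat \<Rightarrow> 'a) topology" where
  "prod_top n K = product_topology (\<lambda>i. mtopology_of (K i)) {1..n}"

abbreviation prod_pts :: "nat \<Rightarrow> (nat \<Rightarrow> 'a metric) \<Rightarrow> (nat \<Rightarrow> 'a) set" where
  "prod_pts n K \<equiv> (\<Pi>\<^sub>E i\<in>{1..n}. mspace (K i))"

definition borel_of :: "'b topology \<Rightarrow> 'b measure" where
  "borel_of X = sigma (topspace X) {U. openin X U}"

definition partial_diff :: "(nat \<Rightarrow> 'a) \<Rightarrow> ((nat \<Rightarrow> 'a) \<Rightarrow> real) \<Rightarrow> nat \<Rightarrow> (nat \<Rightarrow> 'a) \<Rightarrow> 'a \<Rightarrow> real" where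
  "partial_diff star f i x y = f (x(i := y)) - f (x(i := star i))"

definition discrete_grad :: "nat \<Rightarrow> (nat \<Rightarrow> 'a) \<Rightarrow> ((nat \<Rightarrow> 'a) \<Rightarrow> real) \<Rightarrow> (nat \<Rightarrow> 'a) \<Rightarrow> (nat \<Rightarrow> 'a) \<Rightarrow> real" where
  "discrete_grad n star f x y = (\<Sum>i=1..n. partial_diff star f i x (y i))"

(* Valued in ennreal, so that unbounded sets have diameter infinity and the empty set has
   diameter 0. *)
definition diam :: "'b metric \<Rightarrow> 'b set \<Rightarrow> ennreal" where
  "diam m S = (SUP x\<in>S. SUP y\<in>S. ennreal (mdist m x y))"

(* The value is infinity if there is no finite covering. *)
definition cov :: "real \<Rightarrow> 'b metric \<Rightarrow> 'b set \<Rightarrow> enat" where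
  "cov r m F = (INF C \<in> {C. finite C \<and> C \<subseteq> Pow (mspace m) \<and> F \<subseteq> \<Union>C \<and>
                            (\<forall>S\<in>C. diam m S < ennreal r)}. enat (card C))"

(* The bounded real functions on the product, with the uniform metric. *)
abbreviation bounded_funs :: "nat \<Rightarrow> (nat \<Rightarrow> 'a metric) \<Rightarrow> ((nat \<Rightarrow> 'a) \<Rightarrow> real) metric" where
  "bounded_funs n K \<equiv> funspace (prod_pts n K) euclidean_metric"

definition gibbs :: "'b measure \<Rightarrow> ('b \<Rightarrow> real) \<Rightarrow> 'b measure" where
  "gibbs M f = density M (\<lambda>x. ennreal (exp (f x) / (\<integral>y. exp (f y) \<partial>M)))"

definition additively_separable :: "nat \<Rightarrow> (nat \<Rightarrow> 'a metric) \<Rightarrow> ((nat \<Rightarrow> 'a) \<Rightarrow> real) \<Rightarrow> bool" where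
  "additively_separable n K g \<longleftrightarrow>
     (\<exists>h. (\<forall>i\<in>{1..n}. continuous_map (mtopology_of (K i)) euclideanreal (h i) \<and>
                      bounded (h i ` mspace (K i))) \<and>
          (\<forall>x\<in>prod_pts n K. g x = (\<Sum>i=1..n. h i (x i))))"

definition avg_dist :: "nat \<Rightarrow> (nat \<Rightarrow> 'a metric) \<Rightarrow> (nat \<Rightarrow> 'a) \<Rightarrow> (nat \<Rightarrow> 'a) \<Rightarrow> real" where
  "avg_dist n K x y = (\<Sum>i=1..n. mdist (K i) (x i) (y i)) / real n"

definition couplings :: "'b measure \<Rightarrow> 'b measure \<Rightarrow> ('b \<times> 'b) measure set" where
  "couplings \<nu> \<nu>' = {\<gamma>. sets \<gamma> = sets (\<nu> \<Otimes>\<^sub>M \<nu>') \<and> distr \<gamma> \<nu> fst = \<nu> \<and> distr \<gamma> \<nu>' snd = \<nu>'}"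

definition transport_dist :: "('b \<Rightarrow> 'b \<Rightarrow> real) \<Rightarrow> 'b measure \<Rightarrow> 'b measure \<Rightarrow> ennreal" where
  "transport_dist d \<nu> \<nu>' = (INF \<gamma>\<in>couplings \<nu> \<nu>'. \<integral>\<^sup>+ p. ennreal (d (fst p) (snd p)) \<partial>\<gamma>)"

(* For probability measures the negative part of the log density is always integrable with
   respect to \<nu>, so under absolute continuity non-integrability means that the divergence is
   infinite, whereas KL_divergence, being a Bochner integral, would return 0. *)
definition KL :: "'b measure \<Rightarrow> 'b measure \<Rightarrow> ereal" where
  "KL \<nu> \<gamma> = (if absolutely_continuous \<gamma> \<nu> \<and> integrable \<nu> (entropy_density (exp 1) \<gamma> \<nu>)
             then ereal (KL_divergence (exp 1) \<gamma> \<nu>) else \<infinity>)"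

end

theory Submission
  imports Defs
begin

text \<open>
  Write \<open>G x = \<nabla> f (x, \<cdot>)\<close> and \<open>\<Lambda>\<close> for the product measure. Split the space into parts on which
  \<open>G\<close> varies by less than \<open>\<delta> n\<close>, and on each part \<open>P\<close> choose \<open>g\<^sub>P = G z\<close> where \<open>z \<in> P\<close> almost
  minimises \<open>ln \<integral> exp (G x) d\<Lambda>\<close> over \<open>x \<in> P\<close>; this one-sided choice loses \<open>\<delta> n\<close> only once. The divergences
  then average to at most the entropy of the partition, plus \<open>\<delta> n\<close>, plus the average over \<open>\<mu>\<close> of
  \<open>f x - ln Z - (G x x - ln \<integral> exp (G x) d\<Lambda>)\<close>. The last term is the relative entropy of \<open>\<mu>\<close> minus
  the sum of the mean relative entropies of its one-coordinate conditional laws, which is nonpositive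
  by tensorization of entropy. The transport bound is Marton's inequality for product measures.
\<close>

section \<open>Relative entropy on probability spaces\<close>

text \<open>Why \<open>G x\<close> is the right product approximation: in
  \<open>G x x - ln (normaliser of G x)\<close> the reference-point terms cancel, and what remains
  is the sum over \<open>i\<close> of \<open>f x - ln\<close> of the integral of
  \<open>exp f\<close> over coordinate \<open>i\<close>. These are the log densities of the
  one-coordinate conditional laws of \<mu>, which is what tensorization compares with
  \<open>f x - ln Z\<close>. One base point \<open>z\<close> has to serve all \<open>x\<close> in a
  part. Replacing \<open>G x\<close> by \<open>G z\<close> at the point \<open>x\<close> costs the
  oscillation; the change of normaliser has a favourable sign up to a small slack, whereas for an
  arbitrary \<open>z\<close> it could cost the oscillation again. The slack and the strict
  inequalities come from finiteness of the cover: finitely many diameters below \<delta> n have a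
  common bound below \<delta> n. The constant 1/2 under the root is that of Pinsker: the minimum of
  \<open>a + D / (8 * a)\<close> over \<open>a > 0\<close> is \<open>sqrt (D / 2)\<close>.
  Conditional laws appear only as quotients of bounded densities, so no disintegration is used.
  Couplings are likewise explicit: densities on a larger product space, pushed forward.\<close>

lemma (in prob_space) integrable_bounded:
  assumes "f \<in> borel_measurable M" "\<And>x. x \<in> space M \<Longrightarrow> \<bar>f x\<bar> \<le> (C :: real)"
  shows "integrable M f"
  using assms by (intro integrable_const_bound[where B = C]) auto

lemma (in prob_space) abs_integral_le:
  assumes "f \<in> borel_measurable M" "\<And>x. x \<in> space M \<Longrightarrow> \<bar>f x\<bar> \<le> (C :: real)"
  shows "\<bar>integral\<^sup>L M f\<bar> \<le> C"
proof -
  have "\<bar>integral\<^sup>L M f\<bar> \<le> (\<integral>x. \<bar>f x\<bar> \<partial>M)" by (rule integral_abs_bound)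
  also have "\<dots> \<le> C"
    using assms by (intro integral_le_const integrable_bounded[where C = C]) auto
  finally show ?thesis .
qed

text \<open>The function \<open>a * (ln a - ln b)\<close> is jointly convex and homogeneous of
  degree one. The left side is its tangent plane at \<open>(A, B)\<close>, without a constant term
  because of homogeneity.\<close>

lemma mult_ln_diff_ge:
  fixes a b A B :: real
  assumes "a > 0" "b > 0" "A > 0" "B > 0"
  shows "a * (ln A - ln B) + a - b * (A / B) \<le> a * (ln a - ln b)"
proof -
  have "ln (b * A / (a * B)) \<le> b * A / (a * B) - 1"
    using assms by (intro ln_le_minus_one) auto
  then have "a * ln (b * A / (a * B)) \<le> a * (b * A / (a * B) - 1)"
    using assms by (intro mult_left_mono) auto
  also have "\<dots> = b * (A / B) - a"
    using assms by (simp add: field_simps)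
  finally show ?thesis
    using assms by (simp add: ln_mult ln_div algebra_simps)
qed

text \<open>Young's inequality for the conjugate pair \<open>u * ln u - u\<close> and
  \<open>exp w\<close>. The slope \<open>w\<close> is chosen at each use: 0 gives
  \<open>u - 1 \<le> u * ln u\<close>, a constant \<open>- ln N\<close> bounds a discrete entropy,
  and a log density gives the variational bound for relative entropy.\<close>

lemma mult_ln_ge:
  fixes u w :: real
  assumes "u \<ge> 0"
  shows "u * w + u - exp w \<le> u * ln u"
proof (cases "u = 0")
  case False
  then show ?thesis
    using assms mult_left_mono[OF ln_le_minus_one[of "exp w / u"], of u]
    by (simp add: ln_div algebra_simps)
qed simp

lemma abs_mult_ln_le:
  fixes u B :: real
  assumes "0 \<le> u" "u \<le> B"
  shows "\<bar>u * ln u\<bar> \<le> 1 + B * B"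
proof -
  have "u * ln u \<le> u * u"
    using assms ln_le_minus_one[of u] by (cases "u = 0") (auto intro!: mult_left_mono)
  also have "u * u \<le> B * B" using assms by (intro mult_mono) auto
  finally have 1: "u * ln u \<le> B * B" .
  have "- 1 \<le> u * ln u" using mult_ln_ge[of u 0] assms by simp
  moreover have "0 \<le> B * B" by simp
  ultimately show ?thesis using 1 by linarith
qed

text \<open>Joint convexity of relative entropy: averaging both arguments cannot increase it. The
  bound \<open>c\<close> away from zero keeps the logarithms bounded, hence everything
  integrable.\<close>

lemma (in prob_space) log_sum_inequality:
  fixes a b :: "'a \<Rightarrow> real"
  assumes [measurable]: "a \<in> borel_measurable M" "b \<in> borel_measurable M"
    and "0 < c" and a: "\<And>x. x \<in> space M \<Longrightarrow> a x \<in> {c..B}"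
    and b: "\<And>x. x \<in> space M \<Longrightarrow> b x \<in> {c..B}"
  shows "expectation a * (ln (expectation a) - ln (expectation b))
       \<le> expectation (\<lambda>x. a x * (ln (a x) - ln (b x)))"
proof -
  let ?A = "expectation a" and ?B = "expectation b"
  have inta: "integrable M a" and intb: "integrable M b"
    using a b \<open>0 < c\<close> by (force intro!: integrable_bounded[where C = B])+
  have "c \<le> ?A" "c \<le> ?B"
    using a b inta intb by (auto intro!: integral_ge_const)
  then have pos: "?A > 0" "?B > 0" using \<open>0 < c\<close> by auto
  have bound: "\<bar>a x * (ln (a x) - ln (b x))\<bar> \<le> B * (ln B - ln c)" if "x \<in> space M" for x
  proof -
    have *: "c \<le> a x" "a x \<le> B" "c \<le> b x" "b x \<le> B" using a[OF that] b[OF that] by auto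
    then have "ln c \<le> ln (a x)" "ln (a x) \<le> ln B" "ln c \<le> ln (b x)" "ln (b x) \<le> ln B"
      using \<open>0 < c\<close> by (auto simp: ln_le_cancel_iff)
    then have "\<bar>ln (a x) - ln (b x)\<bar> \<le> ln B - ln c" by linarith
    then show ?thesis unfolding abs_mult using * \<open>0 < c\<close> by (intro mult_mono) auto
  qed
  \<comment> \<open>The tangent plane is taken at the two means, so its part
    \<open>a x - b x * (?A / ?B)\<close> has expectation zero.\<close>
  have "?A * (ln ?A - ln ?B) = expectation (\<lambda>x. a x * (ln ?A - ln ?B) + a x - b x * (?A / ?B))"
    using inta intb pos by simp
  also have "\<dots> \<le> expectation (\<lambda>x. a x * (ln (a x) - ln (b x)))"
  proof (rule integral_mono)
    show "integrable M (\<lambda>x. a x * (ln (a x) - ln (b x)))"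
      using bound by (intro integrable_bounded) auto
    show "integrable M (\<lambda>x. a x * (ln ?A - ln ?B) + a x - b x * (?A / ?B))"
      using inta intb by auto
    fix x assume "x \<in> space M"
    then have "0 < a x" "0 < b x" using a[of x] b[of x] \<open>0 < c\<close> by auto
    then show "a x * (ln ?A - ln ?B) + a x - b x * (?A / ?B) \<le> a x * (ln (a x) - ln (b x))"
      by (intro mult_ln_diff_ge pos)
  qed
  finally show ?thesis .
qed

text \<open>Pinsker's inequality, linearised: optimising over \<open>a\<close> gives the usual square root.
  The linear form adds up along coordinates and averages without a further convexity argument.\<close>

lemma (in prob_space) linear_Pinsker:
  fixes u :: "'a \<Rightarrow> real"
  assumes [measurable]: "u \<in> borel_measurable M"
    and u: "\<And>x. x \<in> space M \<Longrightarrow> u x \<in> {0..B}" and u1: "expectation u = 1" and "a > 0"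
  shows "expectation (\<lambda>x. max 0 (u x - 1)) \<le> a + expectation (\<lambda>x. u x * ln (u x)) / (8 * a)"
proof -
  \<comment> \<open>The event that attains the total variation distance: the positive part of
    \<open>u - 1\<close> integrates to the mass of \<open>A\<close> under the density
    \<open>u\<close> minus \<open>p\<close>.\<close>
  define A where "A = {x \<in> space M. u x > 1}"
  have [measurable]: "A \<in> sets M" unfolding A_def by measurable
  define p where "p = prob A"
  \<comment> \<open>The argument gives the bound \<open>entropy / \<theta> + \<theta> / 8\<close>,
    and this choice brings it to the stated form. The constant \<open>c\<close> below is the
    expectation of \<open>exp (\<theta> * indicator A x)\<close>, which Hoeffding's lemma for a
    Bernoulli variable controls.\<close>
  define \<theta> where "\<theta> = 8 * a"
  define c where "c = 1 + p * (exp \<theta> - 1)"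
  have "\<theta> > 0" using \<open>a > 0\<close> by (simp add: \<theta>_def)
  then have "c > 0" unfolding c_def p_def by (intro add_pos_nonneg mult_nonneg_nonneg) auto
  have intu: "integrable M u" using u by (force intro!: integrable_bounded[where C = B])
  have intA: "integrable M (\<lambda>x. u x * indicator A x)"
    using u by (intro integrable_bounded[where C = B]) (force simp: indicator_def)+
  have int1: "integrable M (indicator A :: 'a \<Rightarrow> real)"
    by (intro integrable_bounded[where C = 1]) (auto simp: indicator_def)
  have hoeff: "ln c \<le> \<theta> * p + \<theta>\<^sup>2 / 8"
    using Hoeffdings_lemma_aux[of \<theta> p] \<open>\<theta> > 0\<close> by (simp add: c_def p_def)
  let ?Q = "expectation (\<lambda>x. u x * indicator A x)"
  \<comment> \<open>The log density of the measure tilted by \<open>\<theta> * indicator A\<close>.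
    Since \<open>exp (?w x)\<close> has expectation 1, integrating \<open>mult_ln_ge\<close> with
    slope \<open>?w x\<close> leaves exactly \<open>\<theta> * ?Q - ln c\<close> as a lower bound
    for the entropy of \<open>u\<close>.\<close>
  let ?w = "\<lambda>x. \<theta> * indicator A x - ln c"
  have exp_w: "exp (?w x) = (1 + (exp \<theta> - 1) * indicator A x) / c" for x
    using \<open>c > 0\<close> by (auto simp: indicator_def exp_diff)
  have "\<theta> * ?Q - ln c = expectation (\<lambda>x. u x * ?w x + u x - exp (?w x))"
  proof -
    have "expectation (\<lambda>x. exp (?w x)) = 1"
      unfolding exp_w using int1 \<open>c > 0\<close> by (simp add: prob_space c_def p_def)
    moreover have "integrable M (\<lambda>x. exp (?w x))"
      unfolding exp_w using int1 by simp
    moreover have "expectation (\<lambda>x. u x * ?w x) = \<theta> * ?Q - ln c"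
    proof -
      have "u x * ?w x = \<theta> * (u x * indicator A x) - ln c * u x" for x
        by (simp add: algebra_simps)
      then show ?thesis using intu intA u1 by simp
    qed
    moreover have "integrable M (\<lambda>x. u x * ?w x)"
    proof -
      have "u x * ?w x = \<theta> * (u x * indicator A x) - ln c * u x" for x
        by (simp add: algebra_simps)
      then show ?thesis using intu intA by simp
    qed
    ultimately show ?thesis using intu u1 by simp
  qed
  also have "\<dots> \<le> expectation (\<lambda>x. u x * ln (u x))"
  proof (rule integral_mono)
    show "integrable M (\<lambda>x. u x * ln (u x))"
      using u abs_mult_ln_le[of "u _" B] by (intro integrable_bounded[where C = "1 + B * B"]) auto
    have "u x * ?w x = \<theta> * (u x * indicator A x) - ln c * u x" for x
      by (simp add: algebra_simps)
    then show "integrable M (\<lambda>x. u x * ?w x + u x - exp (?w x))"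
      unfolding exp_w using intu intA int1 by simp
  qed (use u mult_ln_ge in auto)
  finally have "\<theta> * ?Q - (\<theta> * p + \<theta>\<^sup>2 / 8) \<le> expectation (\<lambda>x. u x * ln (u x))"
    using hoeff by simp
  then have "?Q - p \<le> expectation (\<lambda>x. u x * ln (u x)) / \<theta> + \<theta> / 8"
    using \<open>\<theta> > 0\<close> by (simp add: field_simps power2_eq_square)
  moreover have "expectation (\<lambda>x. max 0 (u x - 1)) = ?Q - p"
  proof -
    have "expectation (\<lambda>x. max 0 (u x - 1)) = expectation (\<lambda>x. u x * indicator A x - indicator A x)"
      by (intro Bochner_Integration.integral_cong) (auto simp: A_def indicator_def)
    then show ?thesis using intA int1 by (simp add: p_def)
  qed
  ultimately show ?thesis by (simp add: \<theta>_def)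
qed

section \<open>Tensorization of entropy\<close>

lemma measurable_fun_upd_PiM [measurable (raw)]:
  assumes "i \<in> I" "f \<in> measurable N (PiM I M)" "g \<in> measurable N (M i)"
  shows "(\<lambda>x. (f x)(i := g x)) \<in> measurable N (PiM I M)"
  using measurable_compose[OF measurable_Pair[OF assms(2,3)] measurable_add_dim] assms(1)
  by (simp add: insert_absorb)

lemma fun_upd_in_space_PiM:
  assumes "x \<in> space (PiM I M)" "t \<in> space (M i)"
  shows "x(i := t) \<in> space (PiM (insert i I) M)"
  using assms by (auto simp: space_PiM PiE_iff extensional_def)

lemma (in product_prob_space) product_Fubini:
  fixes f :: "'a \<Rightarrow> 'a \<Rightarrow> real"
  assumes "(\<lambda>(s, t). f s t) \<in> borel_measurable (M i \<Otimes>\<^sub>M M j)"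
    and "\<And>s t. s \<in> space (M i) \<Longrightarrow> t \<in> space (M j) \<Longrightarrow> \<bar>f s t\<bar> \<le> C"
  shows "(\<integral>t. \<integral>s. f s t \<partial>M i \<partial>M j) = (\<integral>s. \<integral>t. f s t \<partial>M j \<partial>M i)"
proof -
  interpret ij: pair_prob_space "M i" "M j" ..
  show ?thesis
    using assms by (intro ij.Fubini_integral ij.integrable_bounded[where C = C]) (auto simp: space_pair_measure)
qed

text \<open>Induction by the chain rule. Splitting off coordinate \<open>i\<close> writes the
  entropy of \<open>F\<close> as the mean entropy in coordinate \<open>i\<close> plus the entropy of
  the marginal \<open>m\<close>. The induction hypothesis bounds the latter by one-coordinate terms
  of \<open>m\<close>, and each of these is at most the corresponding term of \<open>F\<close>
  because averaging over coordinate \<open>i\<close> only lowers relative entropy.\<close>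

theorem (in product_prob_space) entropy_tensorization:
  fixes F :: "('i \<Rightarrow> 'a) \<Rightarrow> real"
  assumes "finite L" "F \<in> borel_measurable (PiM L M)" "0 < c"
    and "\<And>x. x \<in> space (PiM L M) \<Longrightarrow> F x \<in> {c..B}"
  shows "(\<integral>x. F x * ln (F x) \<partial>PiM L M) - (\<integral>x. F x \<partial>PiM L M) * ln (\<integral>x. F x \<partial>PiM L M)
       \<le> (\<Sum>i\<in>L. \<integral>x. F x * (ln (F x) - ln (\<integral>t. F (x(i := t)) \<partial>M i)) \<partial>PiM L M)"
  using assms
proof (induction L arbitrary: F rule: finite_induct)
  case empty
  then show ?case by (simp add: PiM_empty lebesgue_integral_count_space_finite)
next
  case (insert i J)
  note [measurable] = insert.prems(1)
  interpret J: prob_space "PiM J M" by (rule prob_space_PiM) (rule M.prob_space_axioms)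
  interpret iJ: prob_space "PiM (insert i J) M" by (rule prob_space_PiM) (rule M.prob_space_axioms)
  have i_notin: "j \<noteq> i" if "j \<in> J" for j using that insert.hyps by auto
  have Fin: "F x \<in> {c..B}" if "x \<in> space (PiM (insert i J) M)" for x using insert.prems(3) that .
  have F: "c \<le> F (x(i := s))" "F (x(i := s)) \<le> B"
    if "x \<in> space (PiM J M)" "s \<in> space (M i)" for x s
    using Fin[OF fun_upd_in_space_PiM[OF that]] by auto
  have upd: "x(j := t) \<in> space (PiM J M)"
    if "x \<in> space (PiM J M)" "t \<in> space (M j)" "j \<in> J" for x j t
    using fun_upd_in_space_PiM[OF that(1,2)] that(3) by (simp add: insert_absorb)
  have meas_upd [measurable (raw)]: "(\<lambda>w. F ((f w)(i := g w))) \<in> borel_measurable N"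
    if "f \<in> measurable N (PiM J M)" "g \<in> measurable N (M i)" for f g and N :: "'c measure"
    using that by measurable
  define m where "m x = (\<integral>s. F (x(i := s)) \<partial>M i)" for x
  have [measurable]: "m \<in> borel_measurable (PiM J M)" unfolding m_def by measurable
  have int_s: "integrable (M i) (\<lambda>s. F (x(i := s)))" if [measurable]: "x \<in> space (PiM J M)" for x
    using F[OF that] \<open>0 < c\<close> by (intro M.integrable_bounded[where C = B]) (force intro: order_trans)+
  have m: "m x \<in> {c..B}" if "x \<in> space (PiM J M)" for x
    unfolding m_def using F[OF that] int_s[OF that]
    by (auto intro!: M.integral_ge_const M.integral_le_const)
  define Fj where "Fj j x = (\<integral>t. F (x(j := t)) \<partial>M j)" for j x
  have Fj_meas: "Fj j \<in> borel_measurable (PiM (insert i J) M)" if "j \<in> insert i J" for j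
    unfolding Fj_def using that by measurable
  have [measurable]: "Fj i \<in> borel_measurable (PiM (insert i J) M)" by (rule Fj_meas) simp
  have Fj_section: "(\<lambda>s. Fj j (x(i := s))) \<in> borel_measurable (M i)"
    if "x \<in> space (PiM J M)" "j \<in> J" for x j
    using measurable_compose[OF measurable_component_update[OF that(1) insert.hyps(2)] Fj_meas] that(2) by simp
  have Fj: "Fj j x \<in> {c..B}" if x: "x \<in> space (PiM (insert i J) M)" and j: "j \<in> insert i J" for j x
  proof -
    have "F (x(j := t)) \<in> {c..B}" if "t \<in> space (M j)" for t
      using Fin[of "x(j := t)"] fun_upd_in_space_PiM[OF x that] j by (simp add: insert_absorb)
    moreover have "integrable (M j) (\<lambda>t. F (x(j := t)))"
    proof (rule M.integrable_bounded)
      show "(\<lambda>t. F (x(j := t))) \<in> borel_measurable (M j)" using x j by measurable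
    qed (use calculation \<open>0 < c\<close> in force)
    ultimately show ?thesis
      unfolding Fj_def by (auto intro!: M.integral_ge_const M.integral_le_const)
  qed
  define R where "R = B * (\<bar>ln c\<bar> + \<bar>ln B\<bar>)"
  have bound: "\<bar>a * ln b\<bar> \<le> R" if "a \<in> {c..B}" "b \<in> {c..B}" for a b
  proof -
    have "ln c \<le> ln b" "ln b \<le> ln B"
      using that \<open>0 < c\<close> by (auto simp: ln_le_cancel_iff)
    then have "\<bar>ln b\<bar> \<le> \<bar>ln c\<bar> + \<bar>ln B\<bar>" by linarith
    then show ?thesis unfolding abs_mult R_def using that \<open>0 < c\<close> by (intro mult_mono) auto
  qed
  have bound2: "\<bar>a * (ln b - ln b')\<bar> \<le> R + R" if "a \<in> {c..B}" "b \<in> {c..B}" "b' \<in> {c..B}" for a b b'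
    using bound[OF that(1,2)] bound[OF that(1,3)] by (simp add: right_diff_distrib)
  have integral_insert: "integral\<^sup>L (PiM (insert i J) M) f = (\<integral>x. \<integral>s. f (x(i := s)) \<partial>M i \<partial>PiM J M)"
    if [measurable]: "f \<in> borel_measurable (PiM (insert i J) M)"
      and "\<And>x. x \<in> space (PiM (insert i J) M) \<Longrightarrow> \<bar>f x\<bar> \<le> C" for f :: "_ \<Rightarrow> real" and C
    using that by (intro product_integral_insert[OF insert.hyps(1,2)] iJ.integrable_bounded)
  have mass: "(\<integral>x. F x \<partial>PiM (insert i J) M) = (\<integral>x. m x \<partial>PiM J M)"
    unfolding m_def using Fin \<open>0 < c\<close> by (intro integral_insert[of _ B]) force+
  have ent: "(\<integral>x. F x * ln (F x) \<partial>PiM (insert i J) M)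
      = (\<integral>x. F x * (ln (F x) - ln (Fj i x)) \<partial>PiM (insert i J) M) + (\<integral>x. m x * ln (m x) \<partial>PiM J M)"
  proof -
    have "(\<integral>x. F x * ln (Fj i x) \<partial>PiM (insert i J) M)
        = (\<integral>x. \<integral>s. F (x(i := s)) * ln (Fj i (x(i := s))) \<partial>M i \<partial>PiM J M)"
      using Fin Fj bound by (intro integral_insert[of _ R]) auto
    \<comment> \<open>After the update at \<open>i\<close>, \<open>Fj i\<close> no longer depends on
      \<open>s\<close>: it equals \<open>m x\<close>, so its logarithm leaves the inner
      integral.\<close>
    also have "\<dots> = (\<integral>x. m x * ln (m x) \<partial>PiM J M)"
      by (simp add: Fj_def m_def[symmetric])
    finally have "(\<integral>x. F x * ln (Fj i x) \<partial>PiM (insert i J) M) = (\<integral>x. m x * ln (m x) \<partial>PiM J M)" .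
    moreover have "integrable (PiM (insert i J) M) (\<lambda>x. F x * ln (F x))"
      "integrable (PiM (insert i J) M) (\<lambda>x. F x * ln (Fj i x))"
      using Fin Fj bound by (auto intro!: iJ.integrable_bounded[where C = R])
    ultimately show ?thesis by (simp add: right_diff_distrib)
  qed
  \<comment> \<open>For fixed \<open>x\<close>, \<open>log_sum_inequality\<close> in the variable
    \<open>s\<close> is applied to \<open>F (x(i := s))\<close> and \<open>Fj j (x(i := s))\<close>.
    Their means are \<open>m x\<close> and, by Fubini (\<open>mj\<close>), the average of
    \<open>m\<close> over coordinate \<open>j\<close>.\<close>
  have step: "(\<integral>x. m x * (ln (m x) - ln (\<integral>t. m (x(j := t)) \<partial>M j)) \<partial>PiM J M)
      \<le> (\<integral>x. F x * (ln (F x) - ln (Fj j x)) \<partial>PiM (insert i J) M)" if j: "j \<in> J" for j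
  proof -
    have [measurable]: "Fj j \<in> borel_measurable (PiM (insert i J) M)" using Fj_meas j by blast
    have mj: "(\<integral>t. m (x(j := t)) \<partial>M j) = (\<integral>s. Fj j (x(i := s)) \<partial>M i)"
      if x: "x \<in> space (PiM J M)" for x
    proof -
      have "(\<integral>t. \<integral>s. F (x(j := t, i := s)) \<partial>M i \<partial>M j) = (\<integral>s. \<integral>t. F (x(j := t, i := s)) \<partial>M j \<partial>M i)"
      proof (rule product_Fubini[where C = B])
        show "(\<lambda>(s, t). F (x(j := t, i := s))) \<in> borel_measurable (M i \<Otimes>\<^sub>M M j)"
          using x j by measurable
        show "\<bar>F (x(j := t, i := s))\<bar> \<le> B" if "s \<in> space (M i)" "t \<in> space (M j)" for s t
          using F[OF upd[OF x that(2) j] that(1)] \<open>0 < c\<close> by auto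
      qed
      then show ?thesis
        unfolding m_def Fj_def using i_notin[OF j] by (simp add: fun_upd_twist)
    qed
    have "(\<integral>x. m x * (ln (m x) - ln (\<integral>t. m (x(j := t)) \<partial>M j)) \<partial>PiM J M)
       = (\<integral>x. m x * (ln (m x) - ln (\<integral>s. Fj j (x(i := s)) \<partial>M i)) \<partial>PiM J M)"
      by (intro Bochner_Integration.integral_cong) (auto simp: mj)
    also have "\<dots> \<le> (\<integral>x. \<integral>s. F (x(i := s)) * (ln (F (x(i := s))) - ln (Fj j (x(i := s)))) \<partial>M i \<partial>PiM J M)"
    proof (rule integral_mono)
      have Fj': "Fj j (x(i := s)) \<in> {c..B}" if "x \<in> space (PiM J M)" "s \<in> space (M i)" for x s
        using Fj[OF fun_upd_in_space_PiM[OF that]] j by auto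
      have int_Fj: "(\<integral>s. Fj j (x(i := s)) \<partial>M i) \<in> {c..B}" if "x \<in> space (PiM J M)" for x
      proof -
        have "integrable (M i) (\<lambda>s. Fj j (x(i := s)))"
        proof (rule M.integrable_bounded[where C = B])
          show "(\<lambda>s. Fj j (x(i := s))) \<in> borel_measurable (M i)"
            using that j by (rule Fj_section)
        qed (use Fj'[OF that] \<open>0 < c\<close> in force)
        then show ?thesis
          using Fj'[OF that] by (auto intro!: M.integral_ge_const M.integral_le_const)
      qed
      show "integrable (PiM J M) (\<lambda>x. m x * (ln (m x) - ln (\<integral>s. Fj j (x(i := s)) \<partial>M i)))"
      proof (rule J.integrable_bounded[where C = "R + R"])
        show "(\<lambda>x. m x * (ln (m x) - ln (\<integral>s. Fj j (x(i := s)) \<partial>M i))) \<in> borel_measurable (PiM J M)"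
          using j by measurable
      qed (use bound2 m int_Fj in blast)
      show "integrable (PiM J M) (\<lambda>x. \<integral>s. F (x(i := s)) * (ln (F (x(i := s))) - ln (Fj j (x(i := s)))) \<partial>M i)"
      proof (rule J.integrable_bounded[where C = "R + R"])
        show "(\<lambda>x. \<integral>s. F (x(i := s)) * (ln (F (x(i := s))) - ln (Fj j (x(i := s)))) \<partial>M i) \<in> borel_measurable (PiM J M)"
          using j by measurable
        show "\<bar>\<integral>s. F (x(i := s)) * (ln (F (x(i := s))) - ln (Fj j (x(i := s)))) \<partial>M i\<bar> \<le> R + R"
          if x: "x \<in> space (PiM J M)" for x
        proof -
          note [measurable] = Fj_section[OF x j]
          show ?thesis
            using F[OF x] Fj'[OF x] x by (intro M.abs_integral_le bound2) auto
        qed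
      qed
      fix x assume x: "x \<in> space (PiM J M)"
      show "m x * (ln (m x) - ln (\<integral>s. Fj j (x(i := s)) \<partial>M i))
          \<le> (\<integral>s. F (x(i := s)) * (ln (F (x(i := s))) - ln (Fj j (x(i := s)))) \<partial>M i)"
        unfolding m_def
      proof (rule M.log_sum_inequality[OF _ _ \<open>0 < c\<close>])
        show "(\<lambda>s. Fj j (x(i := s))) \<in> borel_measurable (M i)"
          using x j by (rule Fj_section)
        show "(\<lambda>s. F (x(i := s))) \<in> borel_measurable (M i)"
          using x by measurable
      qed (use F[OF x] Fj'[OF x] in auto)
    qed
    also have "\<dots> = (\<integral>x. F x * (ln (F x) - ln (Fj j x)) \<partial>PiM (insert i J) M)"
      using j Fin Fj bound2 by (intro integral_insert[of _ "R + R", symmetric]) auto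
    finally show ?thesis .
  qed
  have "(\<integral>x. m x * ln (m x) \<partial>PiM J M) - (\<integral>x. m x \<partial>PiM J M) * ln (\<integral>x. m x \<partial>PiM J M)
      \<le> (\<Sum>j\<in>J. \<integral>x. m x * (ln (m x) - ln (\<integral>t. m (x(j := t)) \<partial>M j)) \<partial>PiM J M)"
    by (rule insert.IH) (use m \<open>0 < c\<close> in auto)
  also have "\<dots> \<le> (\<Sum>j\<in>J. \<integral>x. F x * (ln (F x) - ln (Fj j x)) \<partial>PiM (insert i J) M)"
    by (rule sum_mono) (rule step)
  finally have "(\<integral>x. m x * ln (m x) \<partial>PiM J M) - (\<integral>x. m x \<partial>PiM J M) * ln (\<integral>x. m x \<partial>PiM J M)
      \<le> (\<Sum>j\<in>J. \<integral>x. F x * (ln (F x) - ln (Fj j x)) \<partial>PiM (insert i J) M)" .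
  then show ?case
    unfolding Fj_def[symmetric] using insert.hyps by (simp add: ent mass)
qed

section \<open>Couplings and Marton's inequality\<close>

text \<open>The maximal coupling of \<open>density M q\<close> and \<open>M\<close>: with \<open>b = True\<close> both coordinates equal \<open>s\<close>,
  with \<open>b = False\<close> they are drawn independently from the normalised excess and deficit of \<open>q\<close>.
  Division by an excess of zero is harmless, because then \<open>q = 1\<close> almost everywhere.\<close>

definition excess :: "'a measure \<Rightarrow> ('a \<Rightarrow> ennreal) \<Rightarrow> ennreal" where
  "excess M q = (\<integral>\<^sup>+ s. (q s - 1) \<partial>M)"

definition coupling_weight :: "'a measure \<Rightarrow> ('a \<Rightarrow> ennreal) \<Rightarrow> 'a \<Rightarrow> 'a \<Rightarrow> bool \<Rightarrow> ennreal" where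
  "coupling_weight M q s t b = (if b then min (q s) 1 else (q s - 1) * (1 - q t) / excess M q)"

lemma min_add_minus_ennreal: "min x y + (x - y) = (x :: ennreal)"
proof (cases "x \<le> y")
  case True
  then show ?thesis by (cases "x = \<top>") (auto simp: min_absorb1 diff_eq_0_iff_ennreal top_unique less_top)
next
  case False
  then show ?thesis by (simp add: min_absorb2 add.commute diff_add_cancel_ennreal)
qed

lemma nn_integral_bool: "(\<integral>\<^sup>+ b. f b \<partial>count_space (UNIV :: bool set)) = f True + f False"
  by (simp add: nn_integral_count_space_finite UNIV_bool add.commute)

context prob_space
begin

context
  fixes q :: "'a \<Rightarrow> ennreal"
  assumes q [measurable]: "q \<in> borel_measurable M" and q1: "(\<integral>\<^sup>+ s. q s \<partial>M) = 1"
begin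

lemma excess_le_1: "excess M q \<le> 1"
  unfolding excess_def q1[symmetric] by (intro nn_integral_mono) (simp add: diff_le_self_ennreal)

text \<open>Both quantities complete the same overlap, the integral of \<open>min (q s) 1\<close>,
  to total mass one, and that overlap is finite and can be cancelled.\<close>

lemma excess_eq_deficit: "excess M q = (\<integral>\<^sup>+ s. (1 - q s) \<partial>M)"
proof -
  let ?m = "\<integral>\<^sup>+ s. min (q s) 1 \<partial>M"
  have "?m + excess M q = 1"
    unfolding excess_def q1[symmetric]
    by (subst nn_integral_add[symmetric]) (auto simp: min_add_minus_ennreal)
  moreover have "?m + (\<integral>\<^sup>+ s. (1 - q s) \<partial>M) = 1"
    by (subst nn_integral_add[symmetric])
      (auto simp: min_add_minus_ennreal min.commute[of "q _"] emeasure_space_1)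
  moreover have "?m \<noteq> \<top>"
    using \<open>?m + excess M q = 1\<close> by (auto simp: top_unique)
  ultimately show ?thesis
    using ennreal_add_left_cancel[of ?m "excess M q" "\<integral>\<^sup>+ s. (1 - q s) \<partial>M"] by simp
qed

text \<open>In \<open>ennreal\<close>, \<open>0 / 0 = 0\<close>, so cancelling a zero excess is
  sound exactly for \<open>x = 0\<close>; the users supply this through
  \<open>excess_zero_AE\<close>.\<close>

lemma mult_excess_div_excess:
  assumes "(excess M q = 0 \<Longrightarrow> x = 0)"
  shows "x * excess M q / excess M q = x"
proof (cases "excess M q = 0")
  case False
  have "excess M q \<noteq> \<top>" using excess_le_1 by (auto simp: top_unique)
  with False show ?thesis by (intro mult_divide_eq_ennreal)
qed (use assms in simp)

lemma excess_zero_AE: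
  assumes "excess M q = 0"
  shows "AE s in M. q s - 1 = 0" "AE s in M. 1 - q s = 0"
proof -
  show "AE s in M. q s - 1 = 0" using assms by (simp add: excess_def nn_integral_0_iff_AE)
  have "(\<integral>\<^sup>+ s. (1 - q s) \<partial>M) = 0" using assms excess_eq_deficit by simp
  then show "AE s in M. 1 - q s = 0" by (simp add: nn_integral_0_iff_AE)
qed

text \<open>The deficit has total mass \<open>excess M q\<close>, so integrating out
  \<open>t\<close> cancels the denominator. The diagonal part \<open>min (q s) 1\<close> and the
  off-diagonal part \<open>q s - 1\<close> then add up to \<open>q s\<close>.\<close>

lemma coupling_weight_fst:
  assumes [measurable]: "h \<in> borel_measurable M"
  shows "(\<integral>\<^sup>+ s. \<integral>\<^sup>+ t. \<integral>\<^sup>+ b. coupling_weight M q s t b * h s \<partial>count_space UNIV \<partial>M \<partial>M)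
    = (\<integral>\<^sup>+ s. q s * h s \<partial>M)"
proof -
  have "(\<integral>\<^sup>+ s. \<integral>\<^sup>+ t. \<integral>\<^sup>+ b. coupling_weight M q s t b * h s \<partial>count_space UNIV \<partial>M \<partial>M)
    = (\<integral>\<^sup>+ s. min (q s) 1 * h s + (q s - 1) * excess M q / excess M q * h s \<partial>M)"
  proof (intro nn_integral_cong)
    fix s
    have "(\<integral>\<^sup>+ t. \<integral>\<^sup>+ b. coupling_weight M q s t b * h s \<partial>count_space UNIV \<partial>M)
       = (\<integral>\<^sup>+ t. min (q s) 1 * h s + (q s - 1) * h s / excess M q * (1 - q t) \<partial>M)"
      by (simp add: nn_integral_bool coupling_weight_def divide_ennreal_def mult_ac)
    also have "\<dots> = min (q s) 1 * h s + (q s - 1) * h s / excess M q * excess M q"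
      by (simp add: nn_integral_add nn_integral_cmult excess_eq_deficit emeasure_space_1)
    finally show "(\<integral>\<^sup>+ t. \<integral>\<^sup>+ b. coupling_weight M q s t b * h s \<partial>count_space UNIV \<partial>M)
       = min (q s) 1 * h s + (q s - 1) * excess M q / excess M q * h s"
      by (simp add: divide_ennreal_def mult_ac)
  qed
  also have "\<dots> = (\<integral>\<^sup>+ s. (min (q s) 1 + (q s - 1)) * h s \<partial>M)"
  proof (intro nn_integral_cong_AE)
    have "AE s in M. (q s - 1) * excess M q / excess M q = q s - 1"
    proof (cases "excess M q = 0")
      case True
      show ?thesis using excess_zero_AE(1)[OF True] by eventually_elim simp
    qed (simp add: mult_excess_div_excess)
    then show "AE s in M. min (q s) 1 * h s + (q s - 1) * excess M q / excess M q * h s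
        = (min (q s) 1 + (q s - 1)) * h s"
      by eventually_elim (simp add: distrib_right)
  qed
  finally show ?thesis by (simp add: min_add_minus_ennreal)
qed

text \<open>The second coordinate receives \<open>min (q s) 1\<close> from the diagonal branch and,
  after integrating out \<open>s\<close>, the deficit \<open>1 - q t\<close> from the other branch;
  together they give the constant density 1.\<close>

lemma coupling_weight_snd:
  assumes [measurable]: "h \<in> borel_measurable M"
  shows "(\<integral>\<^sup>+ s. \<integral>\<^sup>+ t. \<integral>\<^sup>+ b. coupling_weight M q s t b * h (if b then s else t) \<partial>count_space UNIV \<partial>M \<partial>M)
    = (\<integral>\<^sup>+ s. h s \<partial>M)"
proof -
  let ?d = "\<integral>\<^sup>+ t. (1 - q t) * h t \<partial>M"
  have "(\<integral>\<^sup>+ s. \<integral>\<^sup>+ t. \<integral>\<^sup>+ b. coupling_weight M q s t b * h (if b then s else t) \<partial>count_space UNIV \<partial>M \<partial>M)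
    = (\<integral>\<^sup>+ s. min (q s) 1 * h s + (q s - 1) * (?d / excess M q) \<partial>M)"
  proof (intro nn_integral_cong)
    fix s
    have "(\<integral>\<^sup>+ t. \<integral>\<^sup>+ b. coupling_weight M q s t b * h (if b then s else t) \<partial>count_space UNIV \<partial>M)
       = (\<integral>\<^sup>+ t. min (q s) 1 * h s + (q s - 1) / excess M q * ((1 - q t) * h t) \<partial>M)"
      by (simp add: nn_integral_bool coupling_weight_def divide_ennreal_def mult_ac)
    also have "\<dots> = min (q s) 1 * h s + (q s - 1) / excess M q * ?d"
      by (simp add: nn_integral_add nn_integral_cmult emeasure_space_1)
    finally show "(\<integral>\<^sup>+ t. \<integral>\<^sup>+ b. coupling_weight M q s t b * h (if b then s else t) \<partial>count_space UNIV \<partial>M)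
       = min (q s) 1 * h s + (q s - 1) * (?d / excess M q)"
      by (simp add: divide_ennreal_def mult_ac)
  qed
  also have "\<dots> = (\<integral>\<^sup>+ s. min (q s) 1 * h s \<partial>M) + excess M q * (?d / excess M q)"
    by (simp add: nn_integral_add nn_integral_multc excess_def)
  also have "excess M q * (?d / excess M q) = ?d * excess M q / excess M q"
    by (simp add: divide_ennreal_def mult_ac)
  also have "\<dots> = ?d"
  proof (rule mult_excess_div_excess)
    assume "excess M q = 0"
    from excess_zero_AE(2)[OF this] have "AE s in M. (1 - q s) * h s = 0" by eventually_elim simp
    then show "?d = 0" by (simp add: nn_integral_0_iff_AE)
  qed
  also have "(\<integral>\<^sup>+ s. min (q s) 1 * h s \<partial>M) + ?d = (\<integral>\<^sup>+ s. (min (q s) 1 + (1 - q s)) * h s \<partial>M)"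
    by (subst nn_integral_add[symmetric]) (auto simp: distrib_right)
  finally show ?thesis by (simp add: min_add_minus_ennreal min.commute[of "q _"])
qed

text \<open>The diagonal branch has cost zero, so only the off-diagonal mass
  \<open>excess M q\<close> is paid. The constant \<open>C\<close> carries the cost already
  accumulated on other coordinates.\<close>

lemma coupling_weight_cost:
  assumes c: "\<And>s t. s \<in> space M \<Longrightarrow> t \<in> space M \<Longrightarrow> c s t \<le> 1" "\<And>s. s \<in> space M \<Longrightarrow> c s s = 0"
  shows "(\<integral>\<^sup>+ s. \<integral>\<^sup>+ t. \<integral>\<^sup>+ b. coupling_weight M q s t b * (c s (if b then s else t) + C)
      \<partial>count_space UNIV \<partial>M \<partial>M) \<le> excess M q + C"
proof -
  let ?w = "\<lambda>s t. \<integral>\<^sup>+ b. coupling_weight M q s t b * C \<partial>count_space UNIV"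
  let ?r = "\<lambda>s t. (q s - 1) / excess M q * (1 - q t)"
  have w [measurable]: "(\<lambda>(s, t). ?w s t) \<in> borel_measurable (M \<Otimes>\<^sub>M M)"
    by (simp add: nn_integral_bool coupling_weight_def excess_def)
  have "(\<integral>\<^sup>+ s. \<integral>\<^sup>+ t. \<integral>\<^sup>+ b. coupling_weight M q s t b * (c s (if b then s else t) + C)
      \<partial>count_space UNIV \<partial>M \<partial>M) \<le> (\<integral>\<^sup>+ s. \<integral>\<^sup>+ t. ?r s t + ?w s t \<partial>M \<partial>M)"
  proof (intro nn_integral_mono)
    fix s t assume "s \<in> space M" "t \<in> space M"
    then have "?r s t * c s t \<le> ?r s t * 1"
      using c by (intro mult_left_mono) auto
    then have "min (q s) 1 * C + (?r s t * c s t + ?r s t * C)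
        \<le> min (q s) 1 * C + (?r s t + ?r s t * C)"
      by (intro add_left_mono add_right_mono) simp
    then show "(\<integral>\<^sup>+ b. coupling_weight M q s t b * (c s (if b then s else t) + C) \<partial>count_space UNIV)
        \<le> ?r s t + ?w s t"
      using c(2)[OF \<open>s \<in> space M\<close>]
      by (simp add: nn_integral_bool coupling_weight_def divide_ennreal_def distrib_left mult_ac add_ac)
  qed
  also have "\<dots> = (\<integral>\<^sup>+ s. (\<integral>\<^sup>+ t. ?r s t \<partial>M) + (\<integral>\<^sup>+ t. ?w s t \<partial>M) \<partial>M)"
    by (intro nn_integral_cong nn_integral_add) measurable
  also have "\<dots> = (\<integral>\<^sup>+ s. \<integral>\<^sup>+ t. ?r s t \<partial>M \<partial>M) + (\<integral>\<^sup>+ s. \<integral>\<^sup>+ t. ?w s t \<partial>M \<partial>M)"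
    by (intro nn_integral_add) measurable
  also have "(\<integral>\<^sup>+ s. \<integral>\<^sup>+ t. ?w s t \<partial>M \<partial>M) = C"
    using coupling_weight_fst[of "\<lambda>_. C"] by (simp add: nn_integral_multc q1)
  also have "(\<integral>\<^sup>+ s. \<integral>\<^sup>+ t. ?r s t \<partial>M \<partial>M) = excess M q * excess M q / excess M q"
    by (simp add: nn_integral_cmult nn_integral_multc nn_integral_divide
        flip: excess_eq_deficit) (simp add: excess_def divide_ennreal_def mult_ac)
  also have "\<dots> = excess M q" by (rule mult_excess_div_excess)
  finally show ?thesis .
qed

end

end

text \<open>Marginals are tested against functions rather than sets, which suits couplings known
  through iterated integrals.\<close>

lemma couplingsI:
  assumes "sets \<gamma> = sets (\<nu> \<Otimes>\<^sub>M \<nu>')"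
    and "\<And>h. h \<in> borel_measurable \<nu> \<Longrightarrow> (\<integral>\<^sup>+ z. h (fst z) \<partial>\<gamma>) = (\<integral>\<^sup>+ x. h x \<partial>\<nu>)"
    and "\<And>h. h \<in> borel_measurable \<nu>' \<Longrightarrow> (\<integral>\<^sup>+ z. h (snd z) \<partial>\<gamma>) = (\<integral>\<^sup>+ y. h y \<partial>\<nu>')"
  shows "\<gamma> \<in> couplings \<nu> \<nu>'"
proof -
  have [measurable]: "fst \<in> measurable \<gamma> \<nu>" "snd \<in> measurable \<gamma> \<nu>'"
    using measurable_cong_sets[OF assms(1) refl] by (auto simp: measurable_fst measurable_snd)
  have "distr \<gamma> \<nu> fst = \<nu>"
  proof (rule measure_eqI)
    fix A assume "A \<in> sets (distr \<gamma> \<nu> fst)"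
    then have [measurable]: "A \<in> sets \<nu>" by simp
    have "emeasure (distr \<gamma> \<nu> fst) A = (\<integral>\<^sup>+ x. indicator A x \<partial>distr \<gamma> \<nu> fst)" by simp
    also have "\<dots> = emeasure \<nu> A" by (subst nn_integral_distr) (auto simp: assms(2))
    finally show "emeasure (distr \<gamma> \<nu> fst) A = emeasure \<nu> A" .
  qed simp
  moreover have "distr \<gamma> \<nu>' snd = \<nu>'"
  proof (rule measure_eqI)
    fix A assume "A \<in> sets (distr \<gamma> \<nu>' snd)"
    then have [measurable]: "A \<in> sets \<nu>'" by simp
    have "emeasure (distr \<gamma> \<nu>' snd) A = (\<integral>\<^sup>+ x. indicator A x \<partial>distr \<gamma> \<nu>' snd)" by simp
    also have "\<dots> = emeasure \<nu>' A" by (subst nn_integral_distr) (auto simp: assms(3))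
    finally show "emeasure (distr \<gamma> \<nu>' snd) A = emeasure \<nu>' A" .
  qed simp
  ultimately show ?thesis using assms(1) by (simp add: couplings_def)
qed

lemma couplings_nn_integral:
  assumes \<gamma>: "\<gamma> \<in> couplings \<nu> \<nu>'"
  shows "h \<in> borel_measurable \<nu> \<Longrightarrow> (\<integral>\<^sup>+ z. h (fst z) \<partial>\<gamma>) = (\<integral>\<^sup>+ x. h x \<partial>\<nu>)"
    and "h' \<in> borel_measurable \<nu>' \<Longrightarrow> (\<integral>\<^sup>+ z. h' (snd z) \<partial>\<gamma>) = (\<integral>\<^sup>+ y. h' y \<partial>\<nu>')"
proof -
  have sets: "sets \<gamma> = sets (\<nu> \<Otimes>\<^sub>M \<nu>')" and fst: "distr \<gamma> \<nu> fst = \<nu>" and snd: "distr \<gamma> \<nu>' snd = \<nu>'"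
    using \<gamma> by (auto simp: couplings_def)
  have [measurable]: "fst \<in> measurable \<gamma> \<nu>" "snd \<in> measurable \<gamma> \<nu>'"
    using measurable_cong_sets[OF sets refl] by (auto simp: measurable_fst measurable_snd)
  show "(\<integral>\<^sup>+ z. h (fst z) \<partial>\<gamma>) = (\<integral>\<^sup>+ x. h x \<partial>\<nu>)" if "h \<in> borel_measurable \<nu>"
    using that nn_integral_distr[of fst \<gamma> \<nu> h] by (simp add: fst)
  show "(\<integral>\<^sup>+ z. h' (snd z) \<partial>\<gamma>) = (\<integral>\<^sup>+ y. h' y \<partial>\<nu>')" if "h' \<in> borel_measurable \<nu>'"
    using that nn_integral_distr[of snd \<gamma> \<nu>' h'] by (simp add: snd)
qed

lemma pair_measure_couplings:
  assumes "prob_space \<nu>" "prob_space \<nu>'"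
  shows "\<nu> \<Otimes>\<^sub>M \<nu>' \<in> couplings \<nu> \<nu>'"
proof (rule couplingsI)
  interpret \<nu>: prob_space \<nu> by fact
  interpret \<nu>': prob_space \<nu>' by fact
  show "(\<integral>\<^sup>+ z. h (fst z) \<partial>(\<nu> \<Otimes>\<^sub>M \<nu>')) = (\<integral>\<^sup>+ x. h x \<partial>\<nu>)" if [measurable]: "h \<in> borel_measurable \<nu>" for h
    by (subst \<nu>'.nn_integral_fst[symmetric]) (auto simp: \<nu>'.emeasure_space_1)
  show "(\<integral>\<^sup>+ z. h (snd z) \<partial>(\<nu> \<Otimes>\<^sub>M \<nu>')) = (\<integral>\<^sup>+ x. h x \<partial>\<nu>')" if [measurable]: "h \<in> borel_measurable \<nu>'" for h
    by (subst \<nu>'.nn_integral_fst[symmetric]) (auto simp: \<nu>.emeasure_space_1)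
qed simp

text \<open>\<open>N1\<close> is arbitrary, so that it can be a coupling obtained by induction and
  known only through its marginals.\<close>

lemma nn_integral_pair4:
  assumes "sigma_finite_measure N2" "sigma_finite_measure N3" "sigma_finite_measure N4"
    and [measurable]: "f \<in> borel_measurable (N1 \<Otimes>\<^sub>M (N2 \<Otimes>\<^sub>M (N3 \<Otimes>\<^sub>M N4)))"
  shows "integral\<^sup>N (N1 \<Otimes>\<^sub>M (N2 \<Otimes>\<^sub>M (N3 \<Otimes>\<^sub>M N4))) f
    = (\<integral>\<^sup>+ z. \<integral>\<^sup>+ s. \<integral>\<^sup>+ t. \<integral>\<^sup>+ b. f (z, s, t, b) \<partial>N4 \<partial>N3 \<partial>N2 \<partial>N1)"
proof -
  note P34 = sigma_finite_pair_measure[OF assms(2,3)]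
  note P234 = sigma_finite_pair_measure[OF assms(1) P34]
  show ?thesis
    by (simp add: sigma_finite_measure.nn_integral_fst[OF P234, symmetric]
        sigma_finite_measure.nn_integral_fst[OF P34, symmetric]
        sigma_finite_measure.nn_integral_fst[OF assms(3), symmetric]
       cong: nn_integral_cong)
qed

text \<open>Marton's argument: couple the marginals on \<open>J\<close> by induction, then extend by
  the maximal coupling between the conditional law of coordinate \<open>i\<close> and
  \<open>M i\<close>. The second measure is a product, so its conditional law is \<open>M i\<close>
  whatever the other coordinates are. Each coordinate costs at most \<open>a\<close> plus its
  conditional entropy over \<open>8 * a\<close>, and by the chain rule these entropies add up to the
  entropy of \<open>p\<close>.\<close>

theorem (in product_prob_space) Marton_coupling:
  fixes p :: "('i \<Rightarrow> 'a) \<Rightarrow> real" and c :: "'i \<Rightarrow> 'a \<Rightarrow> 'a \<Rightarrow> ennreal" and a :: real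
  assumes "finite L" "p \<in> borel_measurable (PiM L M)"
    and "\<And>x. x \<in> space (PiM L M) \<Longrightarrow> p x \<in> {0..B}" "(\<integral>x. p x \<partial>PiM L M) = 1"
    and c_meas: "\<And>i. i \<in> L \<Longrightarrow> (\<lambda>(s, t). c i s t) \<in> borel_measurable (M i \<Otimes>\<^sub>M M i)"
    and c_le: "\<And>i s t. i \<in> L \<Longrightarrow> s \<in> space (M i) \<Longrightarrow> t \<in> space (M i) \<Longrightarrow> c i s t \<le> 1"
    and c_refl: "\<And>i s. i \<in> L \<Longrightarrow> s \<in> space (M i) \<Longrightarrow> c i s s = 0"
    and "0 < a"
  shows "\<exists>\<gamma>\<in>couplings (density (PiM L M) p) (PiM L M).
    (\<integral>\<^sup>+ z. (\<Sum>i\<in>L. c i (fst z i) (snd z i)) \<partial>\<gamma>)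
      \<le> ennreal (card L * a + (\<integral>x. p x * ln (p x) \<partial>PiM L M) / (8 * a))"
  using assms
proof (induction L arbitrary: p rule: finite_induct)
  case empty
  interpret prob_space "PiM {} M" by (rule prob_space_PiM) (rule M.prob_space_axioms)
  have "prob_space (density (PiM {} M) p)"
  proof (rule prob_spaceI)
    have "(\<integral>\<^sup>+ x. ennreal (p x) \<partial>PiM {} M) = ennreal (\<integral>x. p x \<partial>PiM {} M)"
      using empty by (intro nn_integral_eq_integral integrable_bounded[where C = B]) auto
    then show "emeasure (density (PiM {} M) p) (space (density (PiM {} M) p)) = 1"
      using empty.prems(1,3) by (simp add: emeasure_density cong: nn_integral_cong)
  qed
  then show ?case
    by (intro bexI[OF _ pair_measure_couplings]) (auto intro: prob_space_axioms)
next
  case (insert i J)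
  note [measurable] = insert.prems(1) insert.prems(4)[OF insertI1]
  let ?L = "insert i J"
  interpret J: prob_space "PiM J M" by (rule prob_space_PiM) (rule M.prob_space_axioms)
  interpret L: prob_space "PiM ?L M" by (rule prob_space_PiM) (rule M.prob_space_axioms)
  have p: "p x \<in> {0..B}" if "x \<in> space (PiM ?L M)" for x using insert.prems(2) that .
  have p_upd: "0 \<le> p (x(i := s))" "p (x(i := s)) \<le> B"
    if "x \<in> space (PiM J M)" "s \<in> space (M i)" for x s
    using p[OF fun_upd_in_space_PiM[OF that]] by auto
  have [measurable (raw)]: "(\<lambda>w. p ((f w)(i := g w))) \<in> borel_measurable N"
    if "f \<in> measurable N (PiM J M)" "g \<in> measurable N (M i)" for f g and N :: "'c measure"
    using that by measurable
  define m where "m x = (\<integral>s. p (x(i := s)) \<partial>M i)" for x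
  have m_meas [measurable]: "m \<in> borel_measurable (PiM J M)" unfolding m_def by measurable
  have int_p: "integrable (M i) (\<lambda>s. p (x(i := s)))" if [measurable]: "x \<in> space (PiM J M)" for x
    using p_upd[OF that] by (intro M.integrable_bounded[where C = B]) auto
  have m: "m x \<in> {0..B}" if "x \<in> space (PiM J M)" for x
    unfolding m_def using p_upd[OF that] int_p[OF that]
    by (auto intro!: M.integral_ge_const M.integral_le_const)
  have m1: "(\<integral>x. m x \<partial>PiM J M) = 1"
    unfolding insert.prems(3)[symmetric] m_def
    by (intro product_integral_insert[symmetric] insert.hyps L.integrable_bounded[where C = B])
      (use p in auto)
  have int_m: "integrable (PiM J M) m"
    using m by (intro J.integrable_bounded[where C = B]) auto
  \<comment> \<open>This is \<open>m x\<close> times the relative entropy of the conditional density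
    \<open>p (x(i := s)) / m x\<close>. Its integral \<open>D - D'\<close> is the chain rule for
    entropy.\<close>
  let ?E = "\<lambda>x. (\<integral>s. p (x(i := s)) * ln (p (x(i := s))) \<partial>M i) - m x * ln (m x)"
  define D where "D = (\<integral>x. p x * ln (p x) \<partial>PiM ?L M)"
  define D' where "D' = (\<integral>x. m x * ln (m x) \<partial>PiM J M)"
  have int_mlnm: "integrable (PiM J M) (\<lambda>x. m x * ln (m x))"
    using m abs_mult_ln_le by (intro J.integrable_bounded[where C = "1 + B * B"]) auto
  have int_plnp: "integrable (PiM ?L M) (\<lambda>x. p x * ln (p x))"
    using p abs_mult_ln_le by (intro L.integrable_bounded[where C = "1 + B * B"]) auto
  have int_plnp': "integrable (M i) (\<lambda>s. p (x(i := s)) * ln (p (x(i := s))))"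
    if [measurable]: "x \<in> space (PiM J M)" for x
    using p_upd[OF that] abs_mult_ln_le by (intro M.integrable_bounded[where C = "1 + B * B"]) auto
  have int_E': "integrable (PiM J M) (\<lambda>x. \<integral>s. p (x(i := s)) * ln (p (x(i := s))) \<partial>M i)"
  proof (rule J.integrable_bounded[where C = "1 + B * B"])
    show "\<bar>\<integral>s. p (x(i := s)) * ln (p (x(i := s))) \<partial>M i\<bar> \<le> 1 + B * B"
      if [measurable]: "x \<in> space (PiM J M)" for x
      using p_upd[OF that] abs_mult_ln_le by (intro M.abs_integral_le) auto
  qed measurable
  then have int_E: "integrable (PiM J M) ?E"
    using int_mlnm by (intro Bochner_Integration.integrable_diff)
  have E: "(\<integral>x. ?E x \<partial>PiM J M) = D - D'"
    unfolding D_def D'_def product_integral_insert[OF insert.hyps(1,2) int_plnp]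
    using int_E' int_mlnm by (intro Bochner_Integration.integral_diff)
  have D'_nonneg: "0 \<le> D'"
  proof -
    have "(\<integral>x. m x - 1 \<partial>PiM J M) \<le> D'"
      unfolding D'_def using m mult_ln_ge[of _ 0] int_mlnm
      by (intro integral_mono) (auto intro!: Bochner_Integration.integrable_diff int_m)
    also have "(\<integral>x. m x - 1 \<partial>PiM J M) = 0"
      using int_m m1 by (simp add: J.prob_space)
    finally show ?thesis .
  qed

  \<comment> \<open>Where \<open>m x = 0\<close> there is no conditional law; the default 1 keeps
    \<open>q x\<close> a probability density for every \<open>x\<close>, and the weight
    \<open>m x\<close> later removes the choice. At such \<open>x\<close> the density
    \<open>p\<close> vanishes only for almost every \<open>s\<close>, hence the almost-everywhere
    form of \<open>mq\<close>.\<close>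
  define q where "q x s = (if m x = 0 then 1 else ennreal (p (x(i := s)) / m x))" for x s
  define e where "e x = excess (M i) (q x)" for x
  have q_meas [measurable (raw)]: "(\<lambda>w. q (f w) (g w)) \<in> borel_measurable N"
    if [measurable]: "f \<in> measurable N (PiM J M)" "g \<in> measurable N (M i)" for f g and N :: "'c measure"
    unfolding q_def by measurable
  have e_meas [measurable]: "e \<in> borel_measurable (PiM J M)"
    unfolding e_def excess_def by measurable
  have q1: "(\<integral>\<^sup>+ s. q x s \<partial>M i) = 1" if [measurable]: "x \<in> space (PiM J M)" for x
  proof (cases "m x = 0")
    case False
    have "(\<integral>\<^sup>+ s. ennreal (p (x(i := s)) / m x) \<partial>M i) = ennreal (\<integral>s. p (x(i := s)) / m x \<partial>M i)"
      using p_upd[OF that] m[OF that] int_p[OF that] by (intro nn_integral_eq_integral) auto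
    then show ?thesis using False by (simp add: q_def m_def[symmetric])
  qed (simp add: q_def M.emeasure_space_1)
  have p_AE_0: "AE s in M i. p (x(i := s)) = 0" if "x \<in> space (PiM J M)" "m x = 0" for x
    using that p_upd[OF that(1)] int_p[OF that(1)] unfolding m_def
    by (subst (asm) integral_nonneg_eq_0_iff_AE) auto
  have mq: "AE s in M i. ennreal (m x) * q x s = ennreal (p (x(i := s)))"
    if x: "x \<in> space (PiM J M)" for x
  proof (cases "m x = 0")
    case True
    show ?thesis using p_AE_0[OF x True] by eventually_elim (simp add: True)
  next
    case False
    then show ?thesis
      using p_upd[OF x] m[OF x] by (intro AE_I2) (simp add: q_def flip: ennreal_mult)
  qed
  \<comment> \<open>\<open>linear_Pinsker\<close> for the conditional density, multiplied by
    \<open>m x\<close>. In this product form the estimate also covers \<open>m x = 0\<close>, where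
    both sides vanish.\<close>
  have me: "0 \<le> a * m x + ?E x / (8 * a)"
      "ennreal (m x) * e x \<le> ennreal (a * m x + ?E x / (8 * a))" if x: "x \<in> space (PiM J M)" for x
  proof -
    have "ennreal (m x) * e x \<le> ennreal (a * m x + ?E x / (8 * a)) \<and> 0 \<le> a * m x + ?E x / (8 * a)"
    proof (cases "m x = 0")
      case True
      have "AE s in M i. p (x(i := s)) * ln (p (x(i := s))) = 0"
        using p_AE_0[OF x True] by eventually_elim simp
      then have "(\<integral>s. p (x(i := s)) * ln (p (x(i := s))) \<partial>M i) = 0"
        by (rule integral_eq_zero_AE)
      then show ?thesis using True by simp
    next
      case False
      then have "m x > 0" using m[OF x] by simp
      let ?u = "\<lambda>s. p (x(i := s)) / m x"
      have u: "?u s \<in> {0..B / m x}" if "s \<in> space (M i)" for s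
        using p_upd[OF x that] \<open>m x > 0\<close> by (auto simp: divide_right_mono)
      have [measurable]: "?u \<in> borel_measurable (M i)" using x by measurable
      have pinsker: "(\<integral>s. max 0 (?u s - 1) \<partial>M i) \<le> a + (\<integral>s. ?u s * ln (?u s) \<partial>M i) / (8 * a)"
        using u \<open>0 < a\<close> \<open>m x > 0\<close>
        by (intro M.linear_Pinsker[where B = "B / m x"]) (auto simp: m_def[symmetric])
      have "e x = (\<integral>\<^sup>+ s. ennreal (max 0 (?u s - 1)) \<partial>M i)"
        unfolding e_def excess_def
      proof (intro nn_integral_cong)
        fix s
        show "q x s - 1 = ennreal (max 0 (?u s - 1))"
          using False ennreal_minus[of 1 "?u s"] by (simp add: q_def max_def ennreal_neg)
      qed
      also have "\<dots> = ennreal (\<integral>s. max 0 (?u s - 1) \<partial>M i)"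
        using u by (intro nn_integral_eq_integral M.integrable_bounded[where C = "B / m x + 1"]) fastforce+
      finally have e: "e x = ennreal (\<integral>s. max 0 (?u s - 1) \<partial>M i)" .
      have "m x * (\<integral>s. ?u s * ln (?u s) \<partial>M i) = (\<integral>s. m x * (?u s * ln (?u s)) \<partial>M i)"
        by simp
      also have "\<dots> = (\<integral>s. p (x(i := s)) * ln (p (x(i := s))) - ln (m x) * p (x(i := s)) \<partial>M i)"
      proof (intro Bochner_Integration.integral_cong refl)
        fix s assume "s \<in> space (M i)"
        then show "m x * (?u s * ln (?u s)) = p (x(i := s)) * ln (p (x(i := s))) - ln (m x) * p (x(i := s))"
          using p_upd[OF x] \<open>m x > 0\<close>
          by (cases "p (x(i := s)) = 0") (auto simp: ln_div algebra_simps less_le)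
      qed
      also have "\<dots> = ?E x"
        using int_p[OF x] int_plnp'[OF x] by (simp add: m_def)
      finally have E: "m x * (\<integral>s. ?u s * ln (?u s) \<partial>M i) = ?E x" .
      have "m x * (\<integral>s. max 0 (?u s - 1) \<partial>M i) \<le> m x * (a + (\<integral>s. ?u s * ln (?u s) \<partial>M i) / (8 * a))"
        using pinsker \<open>m x > 0\<close> by simp
      also have "\<dots> = a * m x + ?E x / (8 * a)"
        unfolding E[symmetric] by (simp add: algebra_simps)
      finally have *: "m x * (\<integral>s. max 0 (?u s - 1) \<partial>M i) \<le> a * m x + ?E x / (8 * a)" .
      have nonneg: "0 \<le> m x * (\<integral>s. max 0 (?u s - 1) \<partial>M i)"
        using \<open>m x > 0\<close> by (intro mult_nonneg_nonneg integral_nonneg_AE AE_I2) auto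
      have "ennreal (m x) * e x = ennreal (m x * (\<integral>s. max 0 (?u s - 1) \<partial>M i))"
        unfolding e using \<open>m x > 0\<close> by (intro ennreal_mult'[symmetric]) simp
      then show ?thesis
        by (simp only:) (intro conjI ennreal_leI order_trans[OF nonneg *] *)
    qed
    then show "0 \<le> a * m x + ?E x / (8 * a)"
      "ennreal (m x) * e x \<le> ennreal (a * m x + ?E x / (8 * a))" by auto
  qed

  \<comment> \<open>Extension of the inductive coupling by coordinate \<open>i\<close>\<close>
  have "\<exists>\<gamma>'\<in>couplings (density (PiM J M) m) (PiM J M).
    (\<integral>\<^sup>+ z. (\<Sum>j\<in>J. c j (fst z j) (snd z j)) \<partial>\<gamma>') \<le> ennreal (card J * a + D' / (8 * a))"
    unfolding D'_def
  proof (rule insert.IH)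
    show "0 < a" by (rule \<open>0 < a\<close>)
  qed (simp_all only: m_meas m m1 insert.prems(4-6) insertI2)
  then obtain \<gamma>' where \<gamma>': "\<gamma>' \<in> couplings (density (PiM J M) m) (PiM J M)"
    and cost': "(\<integral>\<^sup>+ z. (\<Sum>j\<in>J. c j (fst z j) (snd z j)) \<partial>\<gamma>') \<le> ennreal (card J * a + D' / (8 * a))"
    by blast
  have sets_\<gamma>' [measurable_cong]: "sets \<gamma>' = sets (PiM J M \<Otimes>\<^sub>M PiM J M)"
    using \<gamma>' sets_pair_measure_cong[OF sets_density refl] unfolding couplings_def by blast
  have "space \<gamma>' = space (PiM J M) \<times> space (PiM J M)"
    unfolding sets_eq_imp_space_eq[OF sets_\<gamma>'] by (rule space_pair_measure)
  then have space_\<gamma>': "fst z \<in> space (PiM J M)" "snd z \<in> space (PiM J M)" if "z \<in> space \<gamma>'" for z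
    using that by (simp_all only: mem_Times_iff)
  have fst_\<gamma>': "(\<integral>\<^sup>+ z. h (fst z) \<partial>\<gamma>') = (\<integral>\<^sup>+ x. ennreal (m x) * h x \<partial>PiM J M)"
    if [measurable]: "h \<in> borel_measurable (PiM J M)" for h
    using couplings_nn_integral(1)[OF \<gamma>', of h] by (simp add: nn_integral_density)
  have snd_\<gamma>': "(\<integral>\<^sup>+ z. h (snd z) \<partial>\<gamma>') = (\<integral>\<^sup>+ x. h x \<partial>PiM J M)"
    if [measurable]: "h \<in> borel_measurable (PiM J M)" for h
    using couplings_nn_integral(2)[OF \<gamma>', of h] by simp

  define w where "w z = coupling_weight (M i) (q (fst z))" for z :: "('i \<Rightarrow> 'a) \<times> ('i \<Rightarrow> 'a)"
  \<comment> \<open>The maximal coupling charges the diagonal and so in general has no density with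
    respect to the product of \<open>M i\<close> with itself. Adding a Boolean flag gives it a
    density on \<open>N\<close>; the map \<open>T\<close> below then reads off the two
    points.\<close>
  define N where "N = \<gamma>' \<Otimes>\<^sub>M (M i \<Otimes>\<^sub>M (M i \<Otimes>\<^sub>M count_space (UNIV :: bool set)))"
  have w_meas [measurable]: "(\<lambda>(z, s, t, b). w z s t b) \<in> borel_measurable N"
    unfolding w_def coupling_weight_def e_def[symmetric] N_def by measurable
  define T where "T = (\<lambda>(z :: ('i \<Rightarrow> 'a) \<times> ('i \<Rightarrow> 'a), s :: 'a, t, b).
    ((fst z)(i := s), (snd z)(i := if b then s else t)))"
  have T_meas [measurable]: "T \<in> measurable N (PiM ?L M \<Otimes>\<^sub>M PiM ?L M)"
    unfolding T_def N_def by measurable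
  define \<gamma> where "\<gamma> = distr (density N (\<lambda>(z, s, t, b). w z s t b)) (PiM ?L M \<Otimes>\<^sub>M PiM ?L M) T"
  have \<gamma>: "(\<integral>\<^sup>+ v. H v \<partial>\<gamma>)
      = (\<integral>\<^sup>+ z. \<integral>\<^sup>+ s. \<integral>\<^sup>+ t. \<integral>\<^sup>+ b. w z s t b * H (T (z, s, t, b)) \<partial>count_space UNIV \<partial>M i \<partial>M i \<partial>\<gamma>')"
    if [measurable]: "H \<in> borel_measurable (PiM ?L M \<Otimes>\<^sub>M PiM ?L M)" for H
  proof -
    have "(\<integral>\<^sup>+ v. H v \<partial>\<gamma>) = (\<integral>\<^sup>+ v. (case v of (z, s, t, b) \<Rightarrow> w z s t b) * H (T v) \<partial>N)"
      unfolding \<gamma>_def by (simp add: nn_integral_distr nn_integral_density)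
    also have "\<dots> = (\<integral>\<^sup>+ z. \<integral>\<^sup>+ s. \<integral>\<^sup>+ t. \<integral>\<^sup>+ b. w z s t b * H (T (z, s, t, b)) \<partial>count_space UNIV \<partial>M i \<partial>M i \<partial>\<gamma>')"
      unfolding N_def
    proof (subst nn_integral_pair4)
      show "(\<lambda>v. (case v of (z, s, t, b) \<Rightarrow> w z s t b) * H (T v))
          \<in> borel_measurable (\<gamma>' \<Otimes>\<^sub>M (M i \<Otimes>\<^sub>M (M i \<Otimes>\<^sub>M count_space UNIV)))"
        unfolding N_def[symmetric] by measurable
    qed (simp_all add: sigma_finite_measures sigma_finite_measure_count_space_finite)
    finally show ?thesis .
  qed
  have q_x: "q x \<in> borel_measurable (M i)" if "x \<in> space (PiM J M)" for x
    using that by measurable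

  \<comment> \<open>Marginals of the extended coupling\<close>
  have "\<gamma> \<in> couplings (density (PiM ?L M) p) (PiM ?L M)"
  proof (rule couplingsI)
    show "sets \<gamma> = sets (density (PiM ?L M) p \<Otimes>\<^sub>M PiM ?L M)"
      unfolding \<gamma>_def sets_distr by (intro sets_pair_measure_cong) simp_all
    fix h :: "('i \<Rightarrow> 'a) \<Rightarrow> ennreal"
    assume "h \<in> borel_measurable (density (PiM ?L M) p)"
    then have [measurable]: "h \<in> borel_measurable (PiM ?L M)" by simp
    have "(\<integral>\<^sup>+ v. h (fst v) \<partial>\<gamma>) = (\<integral>\<^sup>+ z. \<integral>\<^sup>+ s. \<integral>\<^sup>+ t. \<integral>\<^sup>+ b. w z s t b * h (fst (T (z, s, t, b)))
        \<partial>count_space UNIV \<partial>M i \<partial>M i \<partial>\<gamma>')"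
      by (rule \<gamma>) measurable
    also have "\<dots> = (\<integral>\<^sup>+ z. \<integral>\<^sup>+ s. q (fst z) s * h ((fst z)(i := s)) \<partial>M i \<partial>\<gamma>')"
    proof (rule nn_integral_cong)
      fix z assume "z \<in> space \<gamma>'"
      note z = space_\<gamma>'(1)[OF this]
      have [measurable]: "(\<lambda>s. h ((fst z)(i := s))) \<in> borel_measurable (M i)" using z by measurable
      show "(\<integral>\<^sup>+ s. \<integral>\<^sup>+ t. \<integral>\<^sup>+ b. w z s t b * h (fst (T (z, s, t, b))) \<partial>count_space UNIV \<partial>M i \<partial>M i)
          = (\<integral>\<^sup>+ s. q (fst z) s * h ((fst z)(i := s)) \<partial>M i)"
        using M.coupling_weight_fst[OF q_x[OF z] q1[OF z], of "\<lambda>s. h ((fst z)(i := s))"]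
        by (simp add: w_def T_def)
    qed
    \<comment> \<open>The integrand depends on \<open>fst z\<close> only, so the first marginal of
      \<open>\<gamma>'\<close> applies and contributes its density \<open>m x\<close>, which turns
      the conditional density \<open>q\<close> back into \<open>p\<close>.\<close>
    also have "\<dots> = (\<integral>\<^sup>+ x. ennreal (m x) * (\<integral>\<^sup>+ s. q x s * h (x(i := s)) \<partial>M i) \<partial>PiM J M)"
      by (rule fst_\<gamma>') measurable
    also have "\<dots> = (\<integral>\<^sup>+ x. \<integral>\<^sup>+ s. ennreal (p (x(i := s))) * h (x(i := s)) \<partial>M i \<partial>PiM J M)"
    proof (intro nn_integral_cong)
      fix x assume x: "x \<in> space (PiM J M)"
      have "ennreal (m x) * (\<integral>\<^sup>+ s. q x s * h (x(i := s)) \<partial>M i)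
          = (\<integral>\<^sup>+ s. ennreal (m x) * (q x s * h (x(i := s))) \<partial>M i)"
        using x by (intro nn_integral_cmult[symmetric]) measurable
      also have "\<dots> = (\<integral>\<^sup>+ s. ennreal (p (x(i := s))) * h (x(i := s)) \<partial>M i)"
        by (intro nn_integral_cong_AE) (use mq[OF x] in eventually_elim, simp flip: mult.assoc)
      finally show "ennreal (m x) * (\<integral>\<^sup>+ s. q x s * h (x(i := s)) \<partial>M i)
          = (\<integral>\<^sup>+ s. ennreal (p (x(i := s))) * h (x(i := s)) \<partial>M i)" .
    qed
    also have "\<dots> = (\<integral>\<^sup>+ x. ennreal (p x) * h x \<partial>PiM ?L M)"
      by (rule product_nn_integral_insert[OF insert.hyps(1,2), symmetric]) measurable
    finally show "(\<integral>\<^sup>+ v. h (fst v) \<partial>\<gamma>) = (\<integral>\<^sup>+ x. h x \<partial>density (PiM ?L M) p)"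
      by (simp add: nn_integral_density)
  next
    fix h :: "('i \<Rightarrow> 'a) \<Rightarrow> ennreal"
    assume [measurable]: "h \<in> borel_measurable (PiM ?L M)"
    have "(\<integral>\<^sup>+ v. h (snd v) \<partial>\<gamma>) = (\<integral>\<^sup>+ z. \<integral>\<^sup>+ s. \<integral>\<^sup>+ t. \<integral>\<^sup>+ b. w z s t b * h (snd (T (z, s, t, b)))
        \<partial>count_space UNIV \<partial>M i \<partial>M i \<partial>\<gamma>')"
      by (rule \<gamma>) measurable
    \<comment> \<open>For every \<open>z\<close> the new second coordinate has law
      \<open>M i\<close>. Thus the dependence on \<open>fst z\<close> disappears and only the second
      marginal of \<open>\<gamma>'\<close> is left.\<close>
    also have "\<dots> = (\<integral>\<^sup>+ z. \<integral>\<^sup>+ s. h ((snd z)(i := s)) \<partial>M i \<partial>\<gamma>')"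
    proof (rule nn_integral_cong)
      fix z assume "z \<in> space \<gamma>'"
      note z = space_\<gamma>'[OF this]
      have [measurable]: "(\<lambda>s. h ((snd z)(i := s))) \<in> borel_measurable (M i)" using z by measurable
      show "(\<integral>\<^sup>+ s. \<integral>\<^sup>+ t. \<integral>\<^sup>+ b. w z s t b * h (snd (T (z, s, t, b))) \<partial>count_space UNIV \<partial>M i \<partial>M i)
          = (\<integral>\<^sup>+ s. h ((snd z)(i := s)) \<partial>M i)"
        using M.coupling_weight_snd[OF q_x[OF z(1)] q1[OF z(1)], of "\<lambda>s. h ((snd z)(i := s))"]
        by (simp add: w_def T_def)
    qed
    also have "\<dots> = (\<integral>\<^sup>+ x. \<integral>\<^sup>+ s. h (x(i := s)) \<partial>M i \<partial>PiM J M)"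
      by (rule snd_\<gamma>') measurable
    also have "\<dots> = (\<integral>\<^sup>+ x. h x \<partial>PiM ?L M)"
      by (rule product_nn_integral_insert[OF insert.hyps(1,2), symmetric]) measurable
    finally show "(\<integral>\<^sup>+ v. h (snd v) \<partial>\<gamma>) = (\<integral>\<^sup>+ x. h x \<partial>PiM ?L M)" .
  qed

  \<comment> \<open>Cost of the extended coupling\<close>
  moreover have "(\<integral>\<^sup>+ z. (\<Sum>j\<in>?L. c j (fst z j) (snd z j)) \<partial>\<gamma>)
      \<le> ennreal (card ?L * a + (\<integral>x. p x * ln (p x) \<partial>PiM ?L M) / (8 * a))"
  proof -
    have c_comp: "(\<lambda>v. c j (fst v j) (snd v j)) \<in> borel_measurable (PiM K M \<Otimes>\<^sub>M PiM K M)"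
      if "j \<in> ?L" "j \<in> K" for j K
      using measurable_compose[OF _ insert.prems(4)[OF that(1)],
          of "\<lambda>v. (fst v j, snd v j)" "PiM K M \<Otimes>\<^sub>M PiM K M"] that(2) by simp
    let ?S = "\<lambda>z. \<Sum>j\<in>J. c j (fst z j) (snd z j)"
    have S_meas [measurable]: "?S \<in> borel_measurable \<gamma>'"
      using c_comp[of _ J] by (simp cong: measurable_cong_sets add: sets_\<gamma>')
    have "(\<integral>\<^sup>+ z. (\<Sum>j\<in>?L. c j (fst z j) (snd z j)) \<partial>\<gamma>)
      = (\<integral>\<^sup>+ z. \<integral>\<^sup>+ s. \<integral>\<^sup>+ t. \<integral>\<^sup>+ b. w z s t b * (c i s (if b then s else t) + ?S z)
            \<partial>count_space UNIV \<partial>M i \<partial>M i \<partial>\<gamma>')"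
    proof (subst \<gamma>)
      show "(\<lambda>z. \<Sum>j\<in>?L. c j (fst z j) (snd z j)) \<in> borel_measurable (PiM ?L M \<Otimes>\<^sub>M PiM ?L M)"
        using c_comp[of _ ?L] by (intro borel_measurable_sum) auto
      have "(\<Sum>j\<in>?L. c j (fst (T (z, s, t, b)) j) (snd (T (z, s, t, b)) j))
          = c i s (if b then s else t) + ?S z" for z s t b
        using insert.hyps by (auto simp: T_def intro!: sum.cong)
      then show "(\<integral>\<^sup>+ z. \<integral>\<^sup>+ s. \<integral>\<^sup>+ t. \<integral>\<^sup>+ b. w z s t b *
            (\<Sum>j\<in>?L. c j (fst (T (z, s, t, b)) j) (snd (T (z, s, t, b)) j))
            \<partial>count_space UNIV \<partial>M i \<partial>M i \<partial>\<gamma>')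
        = (\<integral>\<^sup>+ z. \<integral>\<^sup>+ s. \<integral>\<^sup>+ t. \<integral>\<^sup>+ b. w z s t b * (c i s (if b then s else t) + ?S z)
            \<partial>count_space UNIV \<partial>M i \<partial>M i \<partial>\<gamma>')" by simp
    qed
    \<comment> \<open>For fixed \<open>z\<close> the old cost \<open>?S z\<close> is constant in
      \<open>s\<close>, \<open>t\<close>, \<open>b\<close> and plays the part of \<open>C\<close> in
      \<open>coupling_weight_cost\<close>.\<close>
    also have "\<dots> \<le> (\<integral>\<^sup>+ z. e (fst z) + ?S z \<partial>\<gamma>')"
    proof (intro nn_integral_mono)
      fix z assume "z \<in> space \<gamma>'"
      note z = space_\<gamma>'[OF this]
      show "(\<integral>\<^sup>+ s. \<integral>\<^sup>+ t. \<integral>\<^sup>+ b. w z s t b * (c i s (if b then s else t) + ?S z)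
            \<partial>count_space UNIV \<partial>M i \<partial>M i) \<le> e (fst z) + ?S z"
        unfolding w_def e_def
        using insert.prems(5,6) by (intro M.coupling_weight_cost q_x q1 z) auto
    qed
    also have "\<dots> = (\<integral>\<^sup>+ z. e (fst z) \<partial>\<gamma>') + (\<integral>\<^sup>+ z. ?S z \<partial>\<gamma>')"
      by (rule nn_integral_add) measurable
    also have "(\<integral>\<^sup>+ z. e (fst z) \<partial>\<gamma>') = (\<integral>\<^sup>+ x. ennreal (m x) * e x \<partial>PiM J M)"
      by (rule fst_\<gamma>') measurable
    also have "\<dots> \<le> (\<integral>\<^sup>+ x. ennreal (a * m x + ?E x / (8 * a)) \<partial>PiM J M)"
      by (intro nn_integral_mono me)
    also have "\<dots> = ennreal (\<integral>x. a * m x + ?E x / (8 * a) \<partial>PiM J M)"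
      using int_m int_E me(1) by (intro nn_integral_eq_integral) auto
    also have "(\<integral>x. a * m x + ?E x / (8 * a) \<partial>PiM J M) = a + (D - D') / (8 * a)"
      using int_m int_E m1 by (simp add: E del: Bochner_Integration.integral_diff)
    also have "ennreal (a + (D - D') / (8 * a)) + (\<integral>\<^sup>+ z. ?S z \<partial>\<gamma>')
        \<le> ennreal (a + (D - D') / (8 * a)) + ennreal (card J * a + D' / (8 * a))"
      by (intro add_left_mono cost')
    also have "\<dots> = ennreal ((a + (D - D') / (8 * a)) + (card J * a + D' / (8 * a)))"
    proof (rule ennreal_plus[symmetric])
      have "0 \<le> (\<integral>x. a * m x + ?E x / (8 * a) \<partial>PiM J M)"
        using me(1) by (intro integral_nonneg_AE AE_I2) auto
      also have "\<dots> = a + (D - D') / (8 * a)"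
        using int_m int_E m1 by (simp add: E del: Bochner_Integration.integral_diff)
      finally show "0 \<le> a + (D - D') / (8 * a)" .
      show "0 \<le> card J * a + D' / (8 * a)" using D'_nonneg \<open>0 < a\<close> by simp
    qed
    \<comment> \<open>The marginal entropy \<open>D'\<close> telescopes: coordinate \<open>i\<close>
      pays for \<open>D - D'\<close>, the coordinates in \<open>J\<close> for
      \<open>D'\<close>.\<close>
    also have "(a + (D - D') / (8 * a)) + (card J * a + D' / (8 * a)) = card ?L * a + D / (8 * a)"
      using insert.hyps by (simp add: diff_divide_distrib algebra_simps)
    finally show ?thesis unfolding D_def by (simp add: add_right_mono)
  qed
  ultimately show ?case by blast
qed

section \<open>Borel sets of products of separable metric spaces\<close>

lemma separable_metric_approx:
  assumes "separable_space (mtopology_of m)"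
  shows "\<exists>C. countable C \<and> C \<subseteq> mspace m \<and> (\<forall>x\<in>mspace m. \<forall>r>0. \<exists>c\<in>C. mdist m x c < r)"
proof -
  interpret Metric_space "mspace m" "mdist m" by (rule Metric_space_mspace_mdist)
  obtain C where C: "countable C" "C \<subseteq> mspace m" "mtopology_of m closure_of C = mspace m"
    using assms by (auto simp: separable_space_def)
  have "\<exists>c\<in>C. mdist m x c < r" if "x \<in> mspace m" "0 < r" for x r
    using C(3) that by (auto simp: mtopology_of_def metric_closure_of)
  with C(1,2) show ?thesis by blast
qed

lemma separable_imp_second_countable_metric:
  assumes "separable_space (mtopology_of m)"
  shows "second_countable (mtopology_of m)"
proof -
  interpret Metric_space "mspace m" "mdist m" by (rule Metric_space_mspace_mdist)
  obtain C where C: "countable C" "C \<subseteq> mspace m"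
    "\<And>x r. x \<in> mspace m \<Longrightarrow> 0 < r \<Longrightarrow> \<exists>c\<in>C. mdist m x c < r"
    using separable_metric_approx[OF assms] by blast
  let ?B = "(\<lambda>(c, k). mball c (1 / Suc k)) ` (C \<times> UNIV)"
  show ?thesis
    unfolding second_countable_def
  proof (intro exI[of _ ?B] conjI allI impI ballI)
    show "countable ?B" using C(1) by auto
    show "openin (mtopology_of m) V" if "V \<in> ?B" for V
      using that by (auto simp: mtopology_of_def)
    fix U x assume "openin (mtopology_of m) U \<and> x \<in> U"
    then have "U \<subseteq> mspace m" "\<exists>r>0. mball x r \<subseteq> U" "x \<in> U"
      by (auto simp: mtopology_of_def openin_mtopology)
    then obtain r where r: "0 < r" "mball x r \<subseteq> U" and x: "x \<in> mspace m" by blast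
    obtain k where k: "1 / Suc k < r / 2"
      using r(1) reals_Archimedean[of "r / 2"] by (auto simp: inverse_eq_divide)
    obtain c where c: "c \<in> C" "mdist m x c < 1 / Suc k"
      using C(3)[OF x, of "1 / Suc k"] by auto
    have cM: "c \<in> mspace m" using c C(2) by auto
    have "mball c (1 / Suc k) \<subseteq> mball x r"
    proof
      fix y assume "y \<in> mball c (1 / Suc k)"
      then have y: "y \<in> mspace m" "mdist m c y < 1 / Suc k" by auto
      have "mdist m x y \<le> mdist m x c + mdist m c y" using x cM y by (intro triangle)
      then show "y \<in> mball x r" using x y c k by auto
    qed
    then show "\<exists>V\<in>?B. x \<in> V \<and> V \<subseteq> U"
      using c x cM r(2) by (intro bexI[of _ "mball c (1 / Suc k)"]) (auto simp: commute)
  qed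
qed

lemma space_borel_of [simp]: "space (borel_of X) = topspace X"
  and sets_borel_of: "sets (borel_of X) = sigma_sets (topspace X) {U. openin X U}"
proof -
  have "{U. openin X U} \<subseteq> Pow (topspace X)" by (auto dest: openin_subset)
  then show "space (borel_of X) = topspace X" "sets (borel_of X) = sigma_sets (topspace X) {U. openin X U}"
    unfolding borel_of_def by (rule space_measure_of sets_measure_of)+
qed

lemma borel_of_openin: "openin X U \<Longrightarrow> U \<in> sets (borel_of X)"
  by (simp add: sets_borel_of)

lemma continuous_map_borel_measurable:
  assumes "continuous_map X euclideanreal h" "sets (borel_of X) \<subseteq> sets M" "space M = topspace X"
  shows "h \<in> borel_measurable M"
proof (rule borel_measurableI)
  fix S :: "real set" assume "open S"
  then have "openin X {x \<in> topspace X. h x \<in> S}"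
    using assms(1) by (intro openin_continuous_map_preimage) auto
  then have "{x \<in> topspace X. h x \<in> S} \<in> sets M"
    using assms(2) by (intro subsetD[OF assms(2) borel_of_openin])
  moreover have "h -` S \<inter> space M = {x \<in> topspace X. h x \<in> S}" using assms(3) by auto
  ultimately show "h -` S \<inter> space M \<in> sets M"
    by simp
qed

lemma space_PiM_borel_of:
  assumes "\<And>i. i \<in> I \<Longrightarrow> sets (M i) = sets (borel_of (X i))"
  shows "space (PiM I M) = topspace (product_topology X I)"
  using sets_eq_imp_space_eq[OF assms] by (auto simp: space_PiM intro: PiE_cong)

text \<open>An open set of the product is a union of open boxes; with countable bases and finitely
  many factors, countably many boxes suffice. This makes continuous functions and Borel parts
  measurable for the product measure.\<close>

lemma sets_borel_of_product_topology_subset: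
  assumes "finite I" "\<And>i. i \<in> I \<Longrightarrow> second_countable (X i)"
    and M: "\<And>i. i \<in> I \<Longrightarrow> sets (M i) = sets (borel_of (X i))"
  shows "sets (borel_of (product_topology X I)) \<subseteq> sets (PiM I M)"
proof -
  have "\<forall>i\<in>I. \<exists>B. countable B \<and> (\<forall>V\<in>B. openin (X i) V) \<and>
      (\<forall>U x. openin (X i) U \<and> x \<in> U \<longrightarrow> (\<exists>V\<in>B. x \<in> V \<and> V \<subseteq> U))"
    using assms(2) unfolding second_countable_def by blast
  then obtain B where B: "\<And>i. i \<in> I \<Longrightarrow> countable (B i)"
    "\<And>i V. i \<in> I \<Longrightarrow> V \<in> B i \<Longrightarrow> openin (X i) V"
    "\<And>i U x. i \<in> I \<Longrightarrow> openin (X i) U \<Longrightarrow> x \<in> U \<Longrightarrow> \<exists>V\<in>B i. x \<in> V \<and> V \<subseteq> U"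
    by metis
  have "U \<in> sets (PiM I M)" if U: "openin (product_topology X I) U" for U
  proof -
    let ?\<V> = "{V \<in> Pi\<^sub>E I B. Pi\<^sub>E I V \<subseteq> U}"
    have "countable ?\<V>"
      using countable_PiE[OF \<open>finite I\<close> B(1)] by (rule countable_subset[rotated]) auto
    moreover have "Pi\<^sub>E I V \<in> sets (PiM I M)" if "V \<in> ?\<V>" for V
      using that B(2) M by (intro sets_PiM_I_finite \<open>finite I\<close>) (auto simp: borel_of_openin PiE_iff)
    ultimately have "(\<Union>V\<in>?\<V>. Pi\<^sub>E I V) \<in> sets (PiM I M)" by (intro sets.countable_UN') auto
    moreover have "(\<Union>V\<in>?\<V>. Pi\<^sub>E I V) = U"
    proof (intro equalityI subsetI)
      fix x assume "x \<in> U"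
      then obtain W where W: "\<And>i. i \<in> I \<Longrightarrow> openin (X i) (W i)" "x \<in> Pi\<^sub>E I W" "Pi\<^sub>E I W \<subseteq> U"
        using U[unfolded openin_product_topology_alt, rule_format, OF \<open>x \<in> U\<close>] by auto
      have "\<forall>i\<in>I. \<exists>V\<in>B i. x i \<in> V \<and> V \<subseteq> W i"
        using W(1,2) B(3) by (auto simp: PiE_iff)
      then obtain V where V: "\<And>i. i \<in> I \<Longrightarrow> V i \<in> B i \<and> x i \<in> V i \<and> V i \<subseteq> W i" by metis
      have "x \<in> Pi\<^sub>E I (restrict V I)" using V W(2) by (auto simp: PiE_iff)
      moreover have "Pi\<^sub>E I (restrict V I) \<subseteq> U"
        using V by (intro order_trans[OF PiE_mono W(3)]) auto
      ultimately show "x \<in> (\<Union>V\<in>?\<V>. Pi\<^sub>E I V)"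
        using V by (intro UN_I[of "restrict V I"]) auto
    qed auto
    ultimately show ?thesis by simp
  qed
  moreover have "topspace (product_topology X I) \<in> sets (PiM I M)"
    using space_PiM_borel_of[OF M, of I] sets.top[of "PiM I M"] by simp
  ultimately show ?thesis
    unfolding sets_borel_of by (intro sets.sigma_sets_subset') auto
qed

text \<open>By the triangle inequality and density, the distance of \<open>s\<close> and
  \<open>t\<close> is the infimum of \<open>d(c, s) + d(c, t)\<close> over a countable dense set of
  points \<open>c\<close>. Joint measurability thus reduces to continuous functions of one
  variable.\<close>

lemma mdist_borel_measurable_pair:
  assumes "separable_space (mtopology_of m)" and M: "sets M = sets (borel_of (mtopology_of m))"
  shows "(\<lambda>(s, t). ennreal (mdist m s t)) \<in> borel_measurable (M \<Otimes>\<^sub>M M)"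
proof -
  interpret Metric_space "mspace m" "mdist m" by (rule Metric_space_mspace_mdist)
  have space: "space M = mspace m" using sets_eq_imp_space_eq[OF M] by simp
  obtain C where C: "countable C" "C \<subseteq> mspace m"
    "\<And>x r. x \<in> mspace m \<Longrightarrow> 0 < r \<Longrightarrow> \<exists>c\<in>C. mdist m x c < r"
    using separable_metric_approx[OF assms(1)] by blast
  have dist_c [measurable]: "mdist m c \<in> borel_measurable M" if "c \<in> mspace m" for c
  proof (rule continuous_map_borel_measurable)
    show "continuous_map (mtopology_of m) euclideanreal (mdist m c)"
      using that by (intro continuous_map_mdist[where f = "\<lambda>_. c"]) auto
  qed (use M space in auto)
  have "(\<lambda>v. INF c\<in>C. ennreal (mdist m c (fst v)) + ennreal (mdist m c (snd v)))
      \<in> borel_measurable (M \<Otimes>\<^sub>M M)"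
    using C(1,2) dist_c by (intro borel_measurable_INF) auto
  also have "?this \<longleftrightarrow> ?thesis"
  proof (rule measurable_cong)
    fix v assume "v \<in> space (M \<Otimes>\<^sub>M M)"
    then obtain s t where v: "v = (s, t)" and st: "s \<in> mspace m" "t \<in> mspace m"
      by (auto simp: space_pair_measure space)
    show "(INF c\<in>C. ennreal (mdist m c (fst v)) + ennreal (mdist m c (snd v)))
        = (case v of (s, t) \<Rightarrow> ennreal (mdist m s t))"
    proof (intro antisym)
      show "(case v of (s, t) \<Rightarrow> ennreal (mdist m s t))
          \<le> (INF c\<in>C. ennreal (mdist m c (fst v)) + ennreal (mdist m c (snd v)))"
      proof (rule INF_greatest)
        fix c assume "c \<in> C"
        then have "mdist m s t \<le> mdist m c s + mdist m c t"
          using C(2) st triangle[of s c t] by (auto simp: commute)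
        then show "(case v of (s, t) \<Rightarrow> ennreal (mdist m s t))
            \<le> ennreal (mdist m c (fst v)) + ennreal (mdist m c (snd v))"
          by (simp add: v ennreal_leI flip: ennreal_plus)
      qed
      show "(INF c\<in>C. ennreal (mdist m c (fst v)) + ennreal (mdist m c (snd v)))
          \<le> (case v of (s, t) \<Rightarrow> ennreal (mdist m s t))"
      proof (rule ennreal_le_epsilon)
        fix e :: real assume "0 < e"
        then obtain c where c: "c \<in> C" "mdist m s c < e / 2" using C(3)[OF st(1), of "e / 2"] by auto
        then have "mdist m c t \<le> mdist m s c + mdist m s t"
          using C(2) st triangle[of c s t] by (auto simp: commute)
        then have le: "mdist m c s + mdist m c t \<le> mdist m s t + e"
          using c C(2) st by (auto simp: commute)
        have "(INF c\<in>C. ennreal (mdist m c (fst v)) + ennreal (mdist m c (snd v)))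
            \<le> ennreal (mdist m c s) + ennreal (mdist m c t)"
          by (rule INF_lower2[OF c(1)]) (simp add: v)
        also have "\<dots> \<le> ennreal (mdist m s t) + ennreal e"
          using le \<open>0 < e\<close> by (simp add: ennreal_leI flip: ennreal_plus)
        finally show "(INF c\<in>C. ennreal (mdist m c (fst v)) + ennreal (mdist m c (snd v)))
            \<le> (case v of (s, t) \<Rightarrow> ennreal (mdist m s t)) + ennreal e" by (simp add: v)
      qed
    qed
  qed
  finally show ?thesis .
qed

section \<open>Gibbs measures\<close>

text \<open>A bounded density has \<open>r * ln r\<close> bounded, also where \<open>r\<close>
  vanishes, so the integrability test in \<open>KL\<close> succeeds and the value is finite.\<close>

lemma (in prob_space) KL_density_eq:
  fixes r :: "'a \<Rightarrow> real"
  assumes [measurable]: "r \<in> borel_measurable M" and r: "\<And>x. x \<in> space M \<Longrightarrow> r x \<in> {0..B}"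
  shows "KL (density M r) M = ereal (\<integral>x. r x * ln (r x) \<partial>M)"
proof -
  have nonneg: "AE x in M. 0 \<le> r x" using r by auto
  have "absolutely_continuous M (density M r)"
    by (intro absolutely_continuousI_density) measurable
  moreover have "integrable (density M r) (entropy_density (exp 1) M (density M r))"
  proof -
    have "AE x in M. ennreal (r x) = RN_deriv M (density M r) x"
      by (intro RN_deriv_unique) auto
    then have ae: "AE x in M. r x * ln (r x) = r x * entropy_density (exp 1) M (density M r) x"
      using nonneg
    proof eventually_elim
      case (elim x)
      then show ?case by (simp add: entropy_density_def log_def flip: elim(1))
    qed
    have "integrable M (\<lambda>x. r x * ln (r x))"
      using r abs_mult_ln_le by (intro integrable_bounded[where C = "1 + B * B"]) auto
    also have "?this \<longleftrightarrow> integrable M (\<lambda>x. r x * entropy_density (exp 1) M (density M r) x)"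
      using ae by (intro integrable_cong_AE) auto
    finally show ?thesis
      using nonneg by (subst integrable_density) auto
  qed
  moreover have "KL_divergence (exp 1) M (density M r) = (\<integral>x. r x * ln (r x) \<partial>M)"
    using nonneg by (subst KL_density) (auto simp: log_def)
  ultimately show ?thesis by (simp add: KL_def)
qed

context prob_space
begin

context
  fixes f :: "'a \<Rightarrow> real" and C :: real
  assumes f [measurable]: "f \<in> borel_measurable M" and f_le: "\<And>x. x \<in> space M \<Longrightarrow> \<bar>f x\<bar> \<le> C"
begin

lemma integrable_exp_bounded: "integrable M (\<lambda>x. exp (f x))"
proof (rule integrable_bounded[where C = "exp C"])
  show "\<bar>exp (f x)\<bar> \<le> exp C" if "x \<in> space M" for x using f_le[OF that] by auto
qed measurable

lemma expectation_exp_bounds: "expectation (\<lambda>x. exp (f x)) \<in> {exp (- C)..exp C}"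
proof -
  have "exp (- C) \<le> exp (f x)" "exp (f x) \<le> exp C" if "x \<in> space M" for x
    using f_le[OF that] by auto
  then show ?thesis
    using integrable_exp_bounded by (auto intro!: integral_ge_const integral_le_const)
qed

lemma expectation_exp_pos: "0 < expectation (\<lambda>x. exp (f x))"
  using expectation_exp_bounds exp_gt_zero[of "- C"] by (simp del: exp_gt_zero)

lemma prob_space_gibbs: "prob_space (gibbs M f)"
proof (rule prob_spaceI)
  let ?Z = "expectation (\<lambda>x. exp (f x))"
  have "(\<integral>\<^sup>+ x. ennreal (exp (f x) / ?Z) \<partial>M) = ennreal (\<integral>x. exp (f x) / ?Z \<partial>M)"
    using expectation_exp_pos integrable_exp_bounded by (intro nn_integral_eq_integral) auto
  then show "emeasure (gibbs M f) (space (gibbs M f)) = 1"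
    using expectation_exp_pos
    by (simp add: gibbs_def emeasure_density cong: nn_integral_cong)
qed

lemma integral_gibbs:
  assumes [measurable]: "h \<in> borel_measurable M"
  shows "(\<integral>x. h x \<partial>gibbs M f) = (\<integral>x. exp (f x) / expectation (\<lambda>x. exp (f x)) * h x \<partial>M)"
  using expectation_exp_pos unfolding gibbs_def by (subst integral_density) auto

end

text \<open>The density \<open>r\<close> is the quotient of the two Gibbs densities, cut down to
  \<open>P\<close> and divided by the mass of \<open>P\<close>; boundedness of \<open>f\<close> and
  \<open>g\<close> bounds it. Its logarithm is explicit, so mass times divergence becomes an
  integral over \<open>P\<close> against the Gibbs measure of \<open>f\<close>, a form that can be
  summed over the parts of a partition.\<close>

lemma uniform_gibbs_density:
  assumes [measurable]: "f \<in> borel_measurable M" "g \<in> borel_measurable M" "P \<in> sets M"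
    and f_le: "\<And>x. x \<in> space M \<Longrightarrow> \<bar>f x\<bar> \<le> C" and g_le: "\<And>x. x \<in> space M \<Longrightarrow> \<bar>g x\<bar> \<le> C"
    and pos: "0 < measure (gibbs M f) P"
  defines "\<mu>P \<equiv> measure (gibbs M f) P"
    and "Zf \<equiv> \<integral>x. exp (f x) \<partial>M" and "Zg \<equiv> \<integral>x. exp (g x) \<partial>M"
  shows "\<exists>r B. r \<in> borel_measurable M \<and> (\<forall>x\<in>space M. r x \<in> {0..B}) \<and>
    uniform_measure (gibbs M f) P = density (gibbs M g) (\<lambda>x. ennreal (r x)) \<and>
    (\<integral>x. r x \<partial>gibbs M g) = 1 \<and>
    \<mu>P * (\<integral>x. r x * ln (r x) \<partial>gibbs M g)
      = (\<integral>x. indicator P x * (f x - ln Zf - (g x - ln Zg) - ln \<mu>P) \<partial>gibbs M f)"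
proof -
  have Zf: "0 < Zf" and Zg: "0 < Zg"
    unfolding Zf_def Zg_def using f_le g_le by (auto intro!: expectation_exp_pos)
  have \<mu>P: "0 < \<mu>P" using pos by (simp add: \<mu>P_def)
  interpret F: prob_space "gibbs M f" by (rule prob_space_gibbs[OF _ f_le]) auto
  interpret G: prob_space "gibbs M g" by (rule prob_space_gibbs[OF _ g_le]) auto
  define r where "r x = indicator P x * (exp (f x) / Zf / (exp (g x) / Zg) / \<mu>P)" for x
  have [measurable]: "r \<in> borel_measurable M" unfolding r_def by measurable
  define B where "B = exp (2 * C) * Zg / (Zf * \<mu>P)"
  have r_eq: "r x = indicator P x * (exp (f x - g x) * Zg / (Zf * \<mu>P))" for x
    by (simp add: r_def exp_diff)
  have r: "r x \<in> {0..B}" if "x \<in> space M" for x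
  proof -
    have "exp (f x - g x) \<le> exp (2 * C)" using f_le[OF that] g_le[OF that] by simp
    then have "exp (f x - g x) * Zg / (Zf * \<mu>P) \<le> B"
      unfolding B_def using Zf Zg \<mu>P by (intro divide_right_mono mult_right_mono) auto
    moreover have "0 \<le> B" unfolding B_def using Zf Zg \<mu>P by simp
    ultimately show ?thesis
      unfolding r_eq using Zf Zg \<mu>P by (auto simp: indicator_def)
  qed
  \<comment> \<open>Change of reference measure: the density of \<open>gibbs M g\<close> cancels the
    denominator in \<open>r\<close>. With \<open>y = 1\<close> this yields the total mass, with
    \<open>y = ln (r x)\<close> the divergence; off \<open>P\<close> both sides are zero.\<close>
  have mult: "exp (g x) / Zg * (r x * y) = indicator P x * (exp (f x) / Zf * y) / \<mu>P" for x y
    using Zg by (simp add: r_def)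
  have "uniform_measure (gibbs M f) P = density (gibbs M g) (\<lambda>x. ennreal (r x))"
  proof -
    have "uniform_measure (gibbs M f) P
        = density M (\<lambda>x. ennreal (exp (f x) / Zf) * (indicator P x / ennreal \<mu>P))"
      unfolding uniform_measure_def F.emeasure_eq_measure \<mu>P_def[symmetric]
      unfolding gibbs_def Zf_def[symmetric]
      by (subst density_density_eq) auto
    also have "\<dots> = density M (\<lambda>x. ennreal (exp (g x) / Zg) * ennreal (r x))"
    proof (intro density_cong AE_I2)
      fix x assume "x \<in> space M"
      have "ennreal (exp (g x) / Zg) * ennreal (r x) = ennreal (exp (g x) / Zg * r x)"
        using Zg by (intro ennreal_mult'[symmetric]) auto
      also have "exp (g x) / Zg * r x = exp (f x) / Zf * (indicator P x / \<mu>P)"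
        using mult[of x 1] by simp
      also have "ennreal \<dots> = ennreal (exp (f x) / Zf) * (indicator P x / ennreal \<mu>P)"
        using Zf \<mu>P ennreal_mult[of "exp (f x) / Zf" "1 / \<mu>P"] divide_ennreal[of 1 \<mu>P]
        by (simp add: indicator_def)
      finally show "ennreal (exp (f x) / Zf) * (indicator P x / ennreal \<mu>P)
          = ennreal (exp (g x) / Zg) * ennreal (r x)" by simp
    qed auto
    also have "\<dots> = density (gibbs M g) (\<lambda>x. ennreal (r x))"
      unfolding gibbs_def Zg_def[symmetric] by (subst density_density_eq) auto
    finally show ?thesis .
  qed
  moreover have "(\<integral>x. r x \<partial>gibbs M g) = 1"
  proof -
    have "(\<integral>x. r x \<partial>gibbs M g) = (\<integral>x. exp (g x) / Zg * (r x * 1) \<partial>M)"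
      using integral_gibbs[of g C r] g_le by (simp add: Zg_def)
    also have "\<dots> = (\<integral>x. exp (f x) / Zf * indicator P x \<partial>M) / \<mu>P"
      unfolding mult by (simp add: mult.commute)
    also have "(\<integral>x. exp (f x) / Zf * indicator P x \<partial>M) = (\<integral>x. indicator P x \<partial>gibbs M f)"
      using integral_gibbs[of f C "indicator P"] f_le by (simp add: Zf_def)
    also have "\<dots> = \<mu>P" by (simp add: \<mu>P_def gibbs_def)
    finally show ?thesis using \<mu>P by simp
  qed
  moreover have "\<mu>P * (\<integral>x. r x * ln (r x) \<partial>gibbs M g)
      = (\<integral>x. indicator P x * (f x - ln Zf - (g x - ln Zg) - ln \<mu>P) \<partial>gibbs M f)"
  proof -
    have "(\<integral>x. r x * ln (r x) \<partial>gibbs M g) = (\<integral>x. exp (g x) / Zg * (r x * ln (r x)) \<partial>M)"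
      using integral_gibbs[of g C "\<lambda>x. r x * ln (r x)"] g_le by (simp add: Zg_def)
    also have "\<dots> = (\<integral>x. exp (f x) / Zf * (indicator P x * (f x - ln Zf - (g x - ln Zg) - ln \<mu>P)) / \<mu>P \<partial>M)"
    proof (intro Bochner_Integration.integral_cong refl)
      fix x
      have "ln (exp (f x - g x) * Zg / (Zf * \<mu>P)) = f x - ln Zf - (g x - ln Zg) - ln \<mu>P"
        using Zf Zg \<mu>P by (simp add: ln_mult ln_div)
      then show "exp (g x) / Zg * (r x * ln (r x))
          = exp (f x) / Zf * (indicator P x * (f x - ln Zf - (g x - ln Zg) - ln \<mu>P)) / \<mu>P"
        unfolding mult by (simp add: r_eq indicator_def)
    qed
    also have "\<dots> = (\<integral>x. indicator P x * (f x - ln Zf - (g x - ln Zg) - ln \<mu>P) \<partial>gibbs M f) / \<mu>P"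
      using integral_gibbs[of f C "\<lambda>x. indicator P x * (f x - ln Zf - (g x - ln Zg) - ln \<mu>P)"] f_le
      by (simp add: Zf_def)
    finally show ?thesis using \<mu>P by simp
  qed
  moreover have "\<forall>x\<in>space M. r x \<in> {0..B}" using r by (rule ballI)
  ultimately have "r \<in> borel_measurable M \<and> (\<forall>x\<in>space M. r x \<in> {0..B}) \<and>
      uniform_measure (gibbs M f) P = density (gibbs M g) (\<lambda>x. ennreal (r x)) \<and>
      (\<integral>x. r x \<partial>gibbs M g) = 1 \<and>
      \<mu>P * (\<integral>x. r x * ln (r x) \<partial>gibbs M g)
        = (\<integral>x. indicator P x * (f x - ln Zf - (g x - ln Zg) - ln \<mu>P) \<partial>gibbs M f)"
    using \<open>r \<in> borel_measurable M\<close> by (intro conjI)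
  then show ?thesis by (rule exI[of _ B, THEN exI[of _ r]])
qed

end

text \<open>The exponential of the sum and its normaliser both factor, and agreement on boxes
  determines the product measure. This makes the measures of separable functions admissible as base
  measure in \<open>Marton_coupling\<close>.\<close>

lemma (in product_prob_space) gibbs_PiM:
  fixes h :: "'i \<Rightarrow> 'a \<Rightarrow> real"
  assumes "finite L" and h_meas [measurable]: "\<And>i. h i \<in> borel_measurable (M i)"
    and h_le: "\<And>i t. t \<in> space (M i) \<Longrightarrow> \<bar>h i t\<bar> \<le> C"
  shows "gibbs (PiM L M) (\<lambda>x. \<Sum>i\<in>L. h i (x i)) = PiM L (\<lambda>i. gibbs (M i) (h i))"
proof -
  have prob: "prob_space (gibbs (M i) (h i))" for i
    using h_le by (intro M.prob_space_gibbs) auto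
  interpret gibbs: product_prob_space "\<lambda>i. gibbs (M i) (h i)" L
    using prob by (intro product_prob_spaceI)
  define Z where "Z i = (\<integral>t. exp (h i t) \<partial>M i)" for i
  have Z: "0 < Z i" for i
    unfolding Z_def using h_le by (intro M.expectation_exp_pos) auto
  have prod_Z: "(\<integral>x. exp (\<Sum>i\<in>L. h i (x i)) \<partial>PiM L M) = (\<Prod>i\<in>L. Z i)"
    unfolding Z_def exp_sum[OF \<open>finite L\<close>] using h_le
    by (intro product_integral_prod \<open>finite L\<close> M.integrable_exp_bounded) auto
  show ?thesis
  proof (rule gibbs.PiM_eqI[OF \<open>finite L\<close>])
    show "sets (gibbs (PiM L M) (\<lambda>x. \<Sum>i\<in>L. h i (x i))) = sets (PiM L (\<lambda>i. gibbs (M i) (h i)))"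
      by (simp add: gibbs_def cong: sets_PiM_cong)
    fix A assume "\<And>i. i \<in> L \<Longrightarrow> A i \<in> sets (gibbs (M i) (h i))"
    then have A: "A i \<in> sets (M i)" if "i \<in> L" for i using that by (simp add: gibbs_def)
    let ?d = "\<lambda>i t. ennreal (exp (h i t) / Z i) * indicator (A i) t"
    have "emeasure (gibbs (PiM L M) (\<lambda>x. \<Sum>i\<in>L. h i (x i))) (Pi\<^sub>E L A)
        = (\<integral>\<^sup>+ x. ennreal (exp (\<Sum>i\<in>L. h i (x i)) / (\<Prod>i\<in>L. Z i)) * indicator (Pi\<^sub>E L A) x \<partial>PiM L M)"
      unfolding gibbs_def prod_Z using A
      by (intro emeasure_density sets_PiM_I_finite \<open>finite L\<close>) auto
    also have "\<dots> = (\<integral>\<^sup>+ x. (\<Prod>i\<in>L. ?d i (x i)) \<partial>PiM L M)"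
    proof (rule nn_integral_cong)
      fix x assume x: "x \<in> space (PiM L M)"
      have "indicator (Pi\<^sub>E L A) x = (\<Prod>i\<in>L. indicator (A i) (x i) :: ennreal)"
      proof (cases "x \<in> Pi\<^sub>E L A")
        case False
        then obtain i where "i \<in> L" "x i \<notin> A i" using x by (auto simp: space_PiM PiE_iff)
        then have "(\<Prod>i\<in>L. indicator (A i) (x i) :: ennreal) = 0"
          using \<open>finite L\<close> by (intro prod_zero bexI[of _ i]) auto
        then show ?thesis using False by simp
      qed (auto simp: PiE_iff intro!: prod.neutral[symmetric])
      moreover have "ennreal (exp (\<Sum>i\<in>L. h i (x i)) / (\<Prod>i\<in>L. Z i)) = (\<Prod>i\<in>L. ennreal (exp (h i (x i)) / Z i))"
        using Z by (subst prod_ennreal) (auto simp: exp_sum[OF \<open>finite L\<close>] prod_dividef less_imp_le)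
      ultimately show "ennreal (exp (\<Sum>i\<in>L. h i (x i)) / (\<Prod>i\<in>L. Z i)) * indicator (Pi\<^sub>E L A) x
          = (\<Prod>i\<in>L. ?d i (x i))" by (simp add: prod.distrib)
    qed
    also have "\<dots> = (\<Prod>i\<in>L. \<integral>\<^sup>+ t. ?d i t \<partial>M i)"
      using A by (intro product_nn_integral_prod \<open>finite L\<close>) auto
    also have "\<dots> = (\<Prod>i\<in>L. emeasure (gibbs (M i) (h i)) (A i))"
      using A by (intro prod.cong refl) (simp add: gibbs_def emeasure_density Z_def)
    finally show "emeasure (gibbs (PiM L M) (\<lambda>x. \<Sum>i\<in>L. h i (x i))) (Pi\<^sub>E L A)
        = (\<Prod>i\<in>L. emeasure (gibbs (M i) (h i)) (A i))" .
  qed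
qed

text \<open>\<open>entropy_tensorization\<close> for \<open>F = exp f\<close>, divided by the
  normaliser. The integrand is the log density of the Gibbs measure minus the log densities of its
  one-coordinate conditional laws.\<close>

lemma (in product_prob_space) gibbs_mean_field_le_0:
  fixes f :: "('i \<Rightarrow> 'a) \<Rightarrow> real"
  assumes "finite L" and f [measurable]: "f \<in> borel_measurable (PiM L M)"
    and f_le: "\<And>x. x \<in> space (PiM L M) \<Longrightarrow> \<bar>f x\<bar> \<le> C"
  shows "(\<integral>x. f x - ln (\<integral>x. exp (f x) \<partial>PiM L M) - (\<Sum>i\<in>L. f x - ln (\<integral>t. exp (f (x(i := t))) \<partial>M i))
      \<partial>gibbs (PiM L M) f) \<le> 0"
proof -
  interpret L: prob_space "PiM L M" by (rule prob_space_PiM) (rule M.prob_space_axioms)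
  let ?Z = "\<integral>x. exp (f x) \<partial>PiM L M"
  let ?W = "\<lambda>i x. ln (\<integral>t. exp (f (x(i := t))) \<partial>M i)"
  have Z: "0 < ?Z" using f_le by (intro L.expectation_exp_pos) auto
  have W_meas: "?W i \<in> borel_measurable (PiM L M)" if [measurable]: "i \<in> L" for i
    by measurable
  have W: "\<bar>?W i x\<bar> \<le> C" if x: "x \<in> space (PiM L M)" and i: "i \<in> L" for i x
  proof -
    have [measurable]: "(\<lambda>t. f (x(i := t))) \<in> borel_measurable (M i)" using x i by measurable
    have "\<bar>f (x(i := t))\<bar> \<le> C" if "t \<in> space (M i)" for t
      using fun_upd_in_space_PiM[of x L M t i, OF x that] i by (intro f_le) (simp add: insert_absorb)
    then have "exp (- C) \<le> (\<integral>t. exp (f (x(i := t))) \<partial>M i)" "(\<integral>t. exp (f (x(i := t))) \<partial>M i) \<le> exp C"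
      using M.expectation_exp_bounds[of "\<lambda>t. f (x(i := t))" i C] by auto
    then have "- C \<le> ?W i x" "?W i x \<le> C"
      using ln_mono[of "exp (- C)"] ln_mono[of _ "exp C"] less_le_trans[OF exp_gt_zero[of "- C"]] 
      by (metis exp_gt_zero ln_exp)+
    then show ?thesis by linarith
  qed
  have C: "0 \<le> C" using f_le L.not_empty by (meson abs_ge_zero ex_in_conv order_trans)
  have exp_le: "exp (f x) \<le> exp C" if "x \<in> space (PiM L M)" for x using f_le[OF that] by simp
  have int1: "integrable (PiM L M) (\<lambda>x. exp (f x))" by (rule L.integrable_exp_bounded[OF f f_le])
  have int2: "integrable (PiM L M) (\<lambda>x. exp (f x) * f x)"
    using exp_le f_le C
    by (intro L.integrable_bounded[where C = "exp C * C"]) (auto simp: abs_mult intro!: mult_mono)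
  have int3: "integrable (PiM L M) (\<lambda>x. exp (f x) * (f x - ?W i x))" if "i \<in> L" for i
  proof (rule L.integrable_bounded[where C = "exp C * (C + C)"])
    show "(\<lambda>x. exp (f x) * (f x - ?W i x)) \<in> borel_measurable (PiM L M)"
      using W_meas[OF that] by measurable
    show "\<bar>exp (f x) * (f x - ?W i x)\<bar> \<le> exp C * (C + C)" if x: "x \<in> space (PiM L M)" for x
      unfolding abs_mult using exp_le[OF x] f_le[OF x] W[OF x \<open>i \<in> L\<close>] by (intro mult_mono) auto
  qed
  let ?V = "\<lambda>x. f x - ln ?Z - (\<Sum>i\<in>L. f x - ?W i x)"
  have V_meas: "?V \<in> borel_measurable (PiM L M)"
    using W_meas by (intro borel_measurable_diff borel_measurable_sum f) auto
  have "(\<integral>x. ?V x \<partial>gibbs (PiM L M) f) = (\<integral>x. exp (f x) / ?Z * ?V x \<partial>PiM L M)"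
    using f_le V_meas by (intro L.integral_gibbs f)
  also have "\<dots> = (\<integral>x. (exp (f x) * f x - ln ?Z * exp (f x) - (\<Sum>i\<in>L. exp (f x) * (f x - ?W i x))) / ?Z \<partial>PiM L M)"
  proof (intro Bochner_Integration.integral_cong refl)
    fix x
    show "exp (f x) / ?Z * ?V x = (exp (f x) * f x - ln ?Z * exp (f x) - (\<Sum>i\<in>L. exp (f x) * (f x - ?W i x))) / ?Z"
      unfolding sum_distrib_left[symmetric]
      by (simp only: right_diff_distrib diff_divide_distrib times_divide_eq_left times_divide_eq_right mult.commute)
  qed
  also have "\<dots> = ((\<integral>x. exp (f x) * f x \<partial>PiM L M) - ln ?Z * ?Z
      - (\<Sum>i\<in>L. \<integral>x. exp (f x) * (f x - ?W i x) \<partial>PiM L M)) / ?Z"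
    using int1 int2 int3 by simp
  also have "\<dots> \<le> 0"
  proof -
    have "(\<integral>x. exp (f x) * ln (exp (f x)) \<partial>PiM L M) - ?Z * ln ?Z
        \<le> (\<Sum>i\<in>L. \<integral>x. exp (f x) * (ln (exp (f x)) - ?W i x) \<partial>PiM L M)"
    proof (rule entropy_tensorization[OF \<open>finite L\<close>])
      show "exp (f x) \<in> {exp (- C)..exp C}" if "x \<in> space (PiM L M)" for x
        using f_le[OF that] by auto
    qed auto
    then show ?thesis using Z by (simp add: divide_le_0_iff mult.commute)
  qed
  finally show ?thesis .
qed

lemma (in prob_space) entropy_nonneg:
  fixes r :: "'a \<Rightarrow> real"
  assumes [measurable]: "r \<in> borel_measurable M" and r: "\<And>x. x \<in> space M \<Longrightarrow> r x \<in> {0..B}"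
    and r1: "expectation r = 1"
  shows "0 \<le> expectation (\<lambda>x. r x * ln (r x))"
proof -
  have int_r: "integrable M r" using r by (intro integrable_bounded[where C = B]) auto
  have "expectation (\<lambda>x. r x - 1) \<le> expectation (\<lambda>x. r x * ln (r x))"
  proof (rule integral_mono)
    show "integrable M (\<lambda>x. r x * ln (r x))"
      using r abs_mult_ln_le by (intro integrable_bounded[where C = "1 + B * B"]) auto
    show "r x - 1 \<le> r x * ln (r x)" if "x \<in> space M" for x
      using mult_ln_ge[of "r x" 0] r[OF that] by simp
  qed (use int_r in simp)
  then show ?thesis using int_r r1 by (simp add: prob_space)
qed

text \<open>The divergence is delivered as a real \<open>D\<close>, and the transport bound for
  every \<open>a\<close>, because a single \<open>a\<close> must later serve all parts at once.
  Dividing the summed cost of \<open>Marton_coupling\<close> by \<open>card L\<close> gives the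
  averaged metric.\<close>

lemma (in product_prob_space) uniform_gibbs_vs_product:
  fixes f :: "('i \<Rightarrow> 'a) \<Rightarrow> real" and h :: "'i \<Rightarrow> 'a \<Rightarrow> real" and d :: "'i \<Rightarrow> 'a \<Rightarrow> 'a \<Rightarrow> real"
  assumes "finite L" "L \<noteq> {}" and f: "f \<in> borel_measurable (PiM L M)"
    and f_le: "\<And>x. x \<in> space (PiM L M) \<Longrightarrow> \<bar>f x\<bar> \<le> C"
    and h [measurable]: "\<And>i. h i \<in> borel_measurable (M i)"
    and h_le: "\<And>i t. t \<in> space (M i) \<Longrightarrow> \<bar>h i t\<bar> \<le> C'"
    and g_le: "\<And>x. x \<in> space (PiM L M) \<Longrightarrow> \<bar>\<Sum>i\<in>L. h i (x i)\<bar> \<le> C"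
    and d_meas: "\<And>i. i \<in> L \<Longrightarrow> (\<lambda>(s, t). ennreal (d i s t)) \<in> borel_measurable (M i \<Otimes>\<^sub>M M i)"
    and d_le: "\<And>i s t. i \<in> L \<Longrightarrow> s \<in> space (M i) \<Longrightarrow> t \<in> space (M i) \<Longrightarrow> d i s t \<in> {0..1}"
    and d_refl: "\<And>i s. i \<in> L \<Longrightarrow> s \<in> space (M i) \<Longrightarrow> d i s s = 0"
    and P: "P \<in> sets (PiM L M)" and pos: "0 < measure (gibbs (PiM L M) f) P"
  defines "\<mu> \<equiv> gibbs (PiM L M) f"
    and "g \<equiv> \<lambda>x. \<Sum>i\<in>L. h i (x i)"
  shows "\<exists>D\<ge>0. KL (uniform_measure \<mu> P) (gibbs (PiM L M) g) = ereal D \<and>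
    (\<forall>a::real. 0 < a \<longrightarrow> transport_dist (\<lambda>x y. (\<Sum>i\<in>L. d i (x i) (y i)) / real (card L))
        (uniform_measure \<mu> P) (gibbs (PiM L M) g) \<le> ennreal (a + D / (8 * a * card L))) \<and>
    measure \<mu> P * D = (\<integral>x. indicator P x * (f x - ln (\<integral>x. exp (f x) \<partial>PiM L M)
        - (g x - ln (\<integral>x. exp (g x) \<partial>PiM L M)) - ln (measure \<mu> P)) \<partial>\<mu>)"
proof -
  interpret L: prob_space "PiM L M" by (rule prob_space_PiM) (rule M.prob_space_axioms)
  have prob_xi: "prob_space (gibbs (M i) (h i))" for i
    using h_le by (intro M.prob_space_gibbs) auto
  interpret xi: product_prob_space "\<lambda>i. gibbs (M i) (h i)" L
    using prob_xi by (intro product_prob_spaceI)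
  have sets_xi: "sets (gibbs (M i) (h i)) = sets (M i)" for i by (simp add: gibbs_def)
  have space_xi: "space (gibbs (M i) (h i)) = space (M i)" for i by (simp add: gibbs_def)
  have g [measurable]: "g \<in> borel_measurable (PiM L M)" unfolding g_def by measurable
  let ?xi = "gibbs (PiM L M) g"
  interpret G: prob_space ?xi using g_le by (intro L.prob_space_gibbs g) (auto simp: g_def)
  have xi_eq: "?xi = PiM L (\<lambda>i. gibbs (M i) (h i))"
    unfolding g_def using h_le by (intro gibbs_PiM \<open>finite L\<close> h)
  obtain r B where r_meas: "r \<in> borel_measurable (PiM L M)"
    and r: "\<forall>x\<in>space (PiM L M). r x \<in> {0..B}"
    and \<nu>: "uniform_measure \<mu> P = density ?xi (\<lambda>x. ennreal (r x))"
    and r1: "(\<integral>x. r x \<partial>?xi) = 1"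
    and ent: "measure \<mu> P * (\<integral>x. r x * ln (r x) \<partial>?xi) = (\<integral>x. indicator P x * (f x - ln (\<integral>x. exp (f x) \<partial>PiM L M)
        - (g x - ln (\<integral>x. exp (g x) \<partial>PiM L M)) - ln (measure \<mu> P)) \<partial>\<mu>)"
    using L.uniform_gibbs_density[OF f g P f_le _ pos] g_le unfolding g_def \<mu>_def by blast
  have r_meas': "r \<in> borel_measurable ?xi" using r_meas by (simp add: gibbs_def)
  have r': "r x \<in> {0..B}" if "x \<in> space ?xi" for x using r that by (simp add: gibbs_def)
  define D where "D = (\<integral>x. r x * ln (r x) \<partial>?xi)"
  have "0 \<le> D" unfolding D_def by (rule G.entropy_nonneg[OF r_meas' r' r1])
  moreover have "KL (uniform_measure \<mu> P) ?xi = ereal D"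
    unfolding D_def \<nu> by (rule G.KL_density_eq[OF r_meas' r'])
  moreover have "transport_dist (\<lambda>x y. (\<Sum>i\<in>L. d i (x i) (y i)) / real (card L))
        (uniform_measure \<mu> P) ?xi \<le> ennreal (a + D / (8 * a * card L))" if "0 < a" for a :: real
  proof -
    have "\<exists>\<gamma>\<in>couplings (density (PiM L (\<lambda>i. gibbs (M i) (h i))) r) (PiM L (\<lambda>i. gibbs (M i) (h i))).
      (\<integral>\<^sup>+ z. (\<Sum>i\<in>L. ennreal (d i (fst z i) (snd z i))) \<partial>\<gamma>)
        \<le> ennreal (card L * a + (\<integral>x. r x * ln (r x) \<partial>PiM L (\<lambda>i. gibbs (M i) (h i))) / (8 * a))"
    proof (rule xi.Marton_coupling[where B = B])
      show "(\<lambda>(s, t). ennreal (d i s t)) \<in> borel_measurable (gibbs (M i) (h i) \<Otimes>\<^sub>M gibbs (M i) (h i))"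
        if "i \<in> L" for i
        using d_meas[OF that] sets_pair_measure_cong[OF sets_xi sets_xi, of i i]
        by (simp cong: measurable_cong_sets)
      show "ennreal (d i s t) \<le> 1"
        if "i \<in> L" "s \<in> space (gibbs (M i) (h i))" "t \<in> space (gibbs (M i) (h i))" for i s t
        using d_le[of i s t] that by (simp add: space_xi)
      show "ennreal (d i s s) = 0" if "i \<in> L" "s \<in> space (gibbs (M i) (h i))" for i s
        using d_refl[of i s] that by (simp add: space_xi)
    qed (use \<open>finite L\<close> \<open>0 < a\<close> r_meas' r' r1 in \<open>simp_all add: xi_eq\<close>)
    then obtain \<gamma> where \<gamma>: "\<gamma> \<in> couplings (uniform_measure \<mu> P) ?xi"
      and cost: "(\<integral>\<^sup>+ z. (\<Sum>i\<in>L. ennreal (d i (fst z i) (snd z i))) \<partial>\<gamma>) \<le> ennreal (card L * a + D / (8 * a))"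
      unfolding xi_eq[symmetric] \<nu> D_def by blast
    have card: "0 < card L" using \<open>finite L\<close> \<open>L \<noteq> {}\<close> by (simp add: card_gt_0_iff)
    have sets_\<gamma>: "sets \<gamma> = sets (PiM L M \<Otimes>\<^sub>M PiM L M)"
      using \<gamma> unfolding couplings_def
      by (auto simp: \<mu>_def gibbs_def intro!: sets_pair_measure_cong)
    have meas: "(\<lambda>z. \<Sum>i\<in>L. ennreal (d i (fst z i) (snd z i))) \<in> borel_measurable \<gamma>"
    proof -
      have "(\<lambda>z. ennreal (d i (fst z i) (snd z i))) \<in> borel_measurable (PiM L M \<Otimes>\<^sub>M PiM L M)" if "i \<in> L" for i
        using measurable_compose[OF _ d_meas[OF that], of "\<lambda>z. (fst z i, snd z i)"] that by simp
      then have "(\<lambda>z. \<Sum>i\<in>L. ennreal (d i (fst z i) (snd z i))) \<in> borel_measurable (PiM L M \<Otimes>\<^sub>M PiM L M)"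
        by (intro borel_measurable_sum)
      then show ?thesis using measurable_cong_sets[OF sets_\<gamma> refl] by blast
    qed
    have space_\<gamma>: "space \<gamma> = space (PiM L M) \<times> space (PiM L M)"
      unfolding sets_eq_imp_space_eq[OF sets_\<gamma>] by (rule space_pair_measure)
    have "transport_dist (\<lambda>x y. (\<Sum>i\<in>L. d i (x i) (y i)) / real (card L)) (uniform_measure \<mu> P) ?xi
        \<le> (\<integral>\<^sup>+ z. ennreal ((\<Sum>i\<in>L. d i (fst z i) (snd z i)) / real (card L)) \<partial>\<gamma>)"
      unfolding transport_dist_def by (rule INF_lower[OF \<gamma>])
    also have "\<dots> = (\<integral>\<^sup>+ z. ennreal (1 / card L) * (\<Sum>i\<in>L. ennreal (d i (fst z i) (snd z i))) \<partial>\<gamma>)"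
    proof (rule nn_integral_cong)
      fix z assume "z \<in> space \<gamma>"
      then have z: "fst z \<in> space (PiM L M)" "snd z \<in> space (PiM L M)"
        unfolding space_\<gamma> by (simp_all only: mem_Times_iff)
      have nonneg: "0 \<le> d i (fst z i) (snd z i)" if "i \<in> L" for i
        using d_le[OF that, of "fst z i" "snd z i"] z that by (auto simp: space_PiM PiE_iff)
      show "ennreal ((\<Sum>i\<in>L. d i (fst z i) (snd z i)) / real (card L))
          = ennreal (1 / card L) * (\<Sum>i\<in>L. ennreal (d i (fst z i) (snd z i)))"
        using nonneg by (subst sum_ennreal) (auto simp flip: ennreal_mult')
    qed
    also have "\<dots> = ennreal (1 / card L) * (\<integral>\<^sup>+ z. (\<Sum>i\<in>L. ennreal (d i (fst z i) (snd z i))) \<partial>\<gamma>)"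
      by (rule nn_integral_cmult[OF meas])
    also have "\<dots> \<le> ennreal (1 / card L) * ennreal (card L * a + D / (8 * a))"
      by (rule mult_left_mono[OF cost]) simp
    also have "\<dots> = ennreal (1 / card L * (card L * a + D / (8 * a)))"
      by (rule ennreal_mult'[symmetric]) simp
    also have "1 / card L * (card L * a + D / (8 * a)) = a + D / (8 * a * card L)"
      using card \<open>0 < a\<close> by (simp add: field_simps)
    finally show ?thesis .
  qed
  ultimately show ?thesis using ent unfolding D_def by blast
qed

section \<open>Partitions of small gradient oscillation\<close>

lemma finite_cover_measurable_partition:
  assumes "finite C" "\<And>c. c \<in> C \<Longrightarrow> A c \<in> sets M" "S \<in> sets M" "S \<subseteq> (\<Union>c\<in>C. A c)"
  shows "\<exists>\<P>. partition_on S \<P> \<and> finite \<P> \<and> card \<P> \<le> card C \<and>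
    (\<forall>P\<in>\<P>. P \<in> sets M \<and> (\<exists>c\<in>C. P \<subseteq> A c))"
  using assms
proof (induction C arbitrary: S rule: finite_induct)
  case empty
  then show ?case by (intro exI[of _ "{}"]) (auto simp: partition_on_def)
next
  case (insert c C)
  have "\<exists>\<P>. partition_on (S - A c) \<P> \<and> finite \<P> \<and> card \<P> \<le> card C \<and>
    (\<forall>P\<in>\<P>. P \<in> sets M \<and> (\<exists>c\<in>C. P \<subseteq> A c))"
  proof (rule insert.IH)
    show "S - A c \<in> sets M" using insert.prems by (intro sets.Diff) auto
    show "S - A c \<subseteq> (\<Union>c\<in>C. A c)" using insert.prems(3) by auto
  qed (use insert.prems in auto)
  then obtain \<P> where \<P>: "partition_on (S - A c) \<P>" "finite \<P>" "card \<P> \<le> card C"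
    "\<And>P. P \<in> \<P> \<Longrightarrow> P \<in> sets M" "\<And>P. P \<in> \<P> \<Longrightarrow> \<exists>c\<in>C. P \<subseteq> A c" by blast
  \<comment> \<open>\<open>partition_on\<close> forbids an empty part, so the new piece is added
    only if it is nonempty.\<close>
  let ?\<Q> = "\<P> \<union> ({S \<inter> A c} - {{}})"
  have "partition_on S ?\<Q>"
  proof (rule partition_onI)
    have "\<Union>\<P> = S - A c" using \<P>(1) by (simp add: partition_on_def)
    then show "\<Union>?\<Q> = S" by auto
    show "{} \<notin> ?\<Q>" using \<P>(1) by (simp add: partition_on_def)
    have disj: "disjnt P (S \<inter> A c)" if "P \<in> \<P>" for P
      using \<open>\<Union>\<P> = S - A c\<close> that unfolding disjnt_def by blast
    show "disjnt P Q" if "P \<in> ?\<Q>" "Q \<in> ?\<Q>" "P \<noteq> Q" for P Q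
    proof (cases "P \<in> \<P> \<and> Q \<in> \<P>")
      case True
      then show ?thesis using \<P>(1) \<open>P \<noteq> Q\<close> by (simp add: partition_on_def disjoint_def disjnt_def)
    next
      case False
      then have "P = S \<inter> A c \<and> Q \<in> \<P> \<or> Q = S \<inter> A c \<and> P \<in> \<P>" using that by auto
      then show ?thesis using disj disjnt_sym by auto
    qed
  qed
  moreover have "card ?\<Q> \<le> card (insert c C)"
  proof -
    have "card ?\<Q> \<le> card \<P> + card ({S \<inter> A c} - {{}})" by (rule card_Un_le)
    also have "card ({S \<inter> A c} - {{}}) \<le> card {S \<inter> A c}" by (rule card_mono) auto
    finally show ?thesis using \<P>(3) insert.hyps by simp
  qed
  moreover have "P \<in> sets M \<and> (\<exists>c\<in>insert c C. P \<subseteq> A c)" if "P \<in> ?\<Q>" for P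
  proof (cases "P \<in> \<P>")
    case True
    then show ?thesis using \<P>(4,5) by blast
  next
    case False
    then have "P = S \<inter> A c" using that by blast
    moreover have "S \<inter> A c \<in> sets M" using insert.prems by (intro sets.Int) auto
    ultimately show ?thesis by auto
  qed
  moreover have "finite ?\<Q>" using \<P>(2) by simp
  ultimately show ?case by (intro exI[of _ ?\<Q>] conjI ballI) simp_all
qed

text \<open>The infimum is attained: a finite value \<open>k\<close> lies strictly below
  \<open>Suc k\<close>, which exhibits a cover by at most \<open>k\<close> sets.\<close>

lemma cov_leD:
  assumes "ereal_of_enat (cov r m F) \<le> ereal c"
  shows "\<exists>C. finite C \<and> C \<subseteq> Pow (mspace m) \<and> F \<subseteq> \<Union>C \<and> (\<forall>S\<in>C. diam m S < ennreal r) \<and> real (card C) \<le> c"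
proof -
  obtain k where k: "cov r m F = enat k"
    using assms by (cases "cov r m F") auto
  then have "cov r m F < enat (Suc k)" by simp
  then obtain C where C: "finite C" "C \<subseteq> Pow (mspace m)" "F \<subseteq> \<Union>C" "\<forall>S\<in>C. diam m S < ennreal r"
    and "enat (card C) < enat (Suc k)"
    unfolding cov_def INF_less_iff by blast
  then have "real (card C) \<le> c" using assms k by simp
  with C show ?thesis by blast
qed

lemma diam_funspace_bound:
  assumes S: "S \<subseteq> mspace (funspace Y (euclidean_metric :: real metric))"
    and diam: "diam (funspace Y euclidean_metric) S \<le> ennreal D" and "0 \<le> D"
    and uv: "u \<in> S" "v \<in> S" "y \<in> Y"
  shows "\<bar>u y - v y\<bar> \<le> D"
proof -
  let ?m = "funspace Y (euclidean_metric :: real metric)"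
  have "ennreal (mdist ?m u v) \<le> diam ?m S"
    unfolding diam_def using uv by (intro SUP_upper2[of u] SUP_upper2[of v]) auto
  then have le: "mdist ?m u v \<le> D"
    using diam \<open>0 \<le> D\<close> by (meson ennreal_le_iff order_trans)
  have "u \<in> mspace ?m" "v \<in> mspace ?m" "Y \<noteq> {}" using S uv by blast+
  from funspace_mdist_le[OF this, of D] le have "\<forall>x\<in>Y. dist (u x) (v x) \<le> D" by simp
  then show ?thesis using uv(3) by (simp add: dist_real_def)
qed

text \<open>Preimages of closed balls are closed, so a bound valid on \<open>E\<close> extends to
  the closure; this is done for one argument at a time.\<close>

lemma closure_oscillation_le:
  fixes g :: "'a \<Rightarrow> real"
  assumes g: "continuous_map X euclideanreal g"
    and osc: "\<And>x x'. x \<in> E \<Longrightarrow> x' \<in> E \<Longrightarrow> \<bar>g x - g x'\<bar> \<le> D" and "E \<subseteq> topspace X"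
    and x: "x \<in> X closure_of E" "x' \<in> X closure_of E"
  shows "\<bar>g x - g x'\<bar> \<le> D"
proof -
  have closed: "closedin X {x \<in> topspace X. g x \<in> cball a D}" for a
    using closedin_continuous_map_preimage[OF g, of "cball a D"] by simp
  have 1: "\<bar>g a - g x\<bar> \<le> D" if "a \<in> E" "x \<in> X closure_of E" for a x
  proof -
    have "X closure_of E \<subseteq> {x \<in> topspace X. g x \<in> cball (g a) D}"
      using osc[OF that(1)] \<open>E \<subseteq> topspace X\<close> closed
      by (intro closure_of_minimal) (auto simp: dist_real_def)
    then show ?thesis using that(2) by (auto simp: dist_real_def)
  qed
  have "X closure_of E \<subseteq> {y \<in> topspace X. g y \<in> cball (g x') D}"
    using 1[OF _ x(2)] \<open>E \<subseteq> topspace X\<close> closed[of "g x'"]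
    by (intro closure_of_minimal) (auto simp: dist_real_def abs_minus_commute)
  then show ?thesis using x(1) by (auto simp: dist_real_def abs_minus_commute)
qed

text \<open>Finitely many strict bounds leave a positive gap \<open>r - D\<close>. That gap later
  pays for choosing only an almost minimal base point and still yields a strict inequality.\<close>

lemma exists_uniform_diam_bound:
  assumes "finite C" "\<forall>S\<in>C. diam m S < ennreal r" "0 < r"
  shows "\<exists>D. 0 \<le> D \<and> D < r \<and> (\<forall>S\<in>C. diam m S \<le> ennreal D)"
  using assms
proof (induction C rule: finite_induct)
  case (insert S C)
  then obtain D where D: "0 \<le> D" "D < r" "\<forall>S\<in>C. diam m S \<le> ennreal D" by auto
  have S: "diam m S < ennreal r" using insert.prems by simp
  then obtain d where d: "diam m S = ennreal d" "0 \<le> d"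
    by (cases "diam m S") auto
  then have "d < r" using S by (simp add: ennreal_less_iff)
  then show ?case
    using D d by (intro exI[of _ "max D d"]) (auto simp: le_max_iff_disj ennreal_leI intro: order_trans)
qed auto

lemma continuous_map_fun_upd:
  assumes "i \<in> I"
  shows "t \<in> topspace (X i) \<Longrightarrow> continuous_map (product_topology X I) (product_topology X I) (\<lambda>x. x(i := t))"
    and "z \<in> topspace (product_topology X I) \<Longrightarrow> continuous_map (X i) (product_topology X I) (\<lambda>t. z(i := t))"
proof -
  show "continuous_map (product_topology X I) (product_topology X I) (\<lambda>x. x(i := t))" if "t \<in> topspace (X i)"
    unfolding continuous_map_componentwise
  proof (intro conjI ballI)
    show "(\<lambda>x. x(i := t)) ` topspace (product_topology X I) \<subseteq> extensional I"
      using assms by (auto simp: PiE_iff extensional_def)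
    show "continuous_map (product_topology X I) (X k) (\<lambda>x. (x(i := t)) k)" if "k \<in> I" for k
      using \<open>t \<in> topspace (X i)\<close> that by (cases "k = i") auto
  qed
  show "continuous_map (X i) (product_topology X I) (\<lambda>t. z(i := t))" if "z \<in> topspace (product_topology X I)"
    unfolding continuous_map_componentwise
  proof (intro conjI ballI)
    show "(\<lambda>t. z(i := t)) ` topspace (X i) \<subseteq> extensional I"
      using that assms by (auto simp: PiE_iff extensional_def)
    show "continuous_map (X i) (X k) (\<lambda>t. (z(i := t)) k)" if "k \<in> I" for k
      using \<open>z \<in> topspace (product_topology X I)\<close> that by (cases "k = i") auto
  qed
qed

text \<open>Taking closures of the parts of the cover makes them Borel without enlarging their diameter,
  since the discrete gradient depends continuously on its base point.\<close>

lemma gradient_partition: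
  assumes star: "\<And>i. i \<in> {1..n} \<Longrightarrow> star i \<in> mspace (K i)"
    and f: "continuous_map (prod_top n K) euclideanreal f" and "0 < r"
    and cov: "ereal_of_enat (cov r (bounded_funs n K)
       ((\<lambda>x. restrict (discrete_grad n star f x) (prod_pts n K)) ` prod_pts n K)) \<le> ereal c"
  shows "\<exists>\<P> D. partition_on (prod_pts n K) \<P> \<and> finite \<P> \<and> real (card \<P>) \<le> c \<and> D < r \<and>
    (\<forall>P\<in>\<P>. P \<in> sets (borel_of (prod_top n K)) \<and>
      (\<forall>x\<in>P. \<forall>x'\<in>P. \<forall>y\<in>prod_pts n K. \<bar>discrete_grad n star f x y - discrete_grad n star f x' y\<bar> \<le> D))"
proof -
  have top: "topspace (prod_top n K) = prod_pts n K" by (simp add: prod_top_def)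
  obtain C where C: "finite C" "C \<subseteq> Pow (mspace (bounded_funs n K))"
    "(\<lambda>x. restrict (discrete_grad n star f x) (prod_pts n K)) ` prod_pts n K \<subseteq> \<Union>C"
    "\<forall>S\<in>C. diam (bounded_funs n K) S < ennreal r" "real (card C) \<le> c"
    using cov_leD[OF cov] by blast
  obtain D where D: "0 \<le> D" "D < r" "\<forall>S\<in>C. diam (bounded_funs n K) S \<le> ennreal D"
    using exists_uniform_diam_bound[OF C(1,4) \<open>0 < r\<close>] by blast
  \<comment> \<open>Elements of \<open>bounded_funs\<close> are extensional, hence
    \<open>restrict\<close>. The sets \<open>S\<close> are arbitrary, so \<open>E S\<close> need not
    be Borel; its closure \<open>A S\<close> replaces it.\<close>
  define E where "E S = {x \<in> prod_pts n K. restrict (discrete_grad n star f x) (prod_pts n K) \<in> S}" for S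
  define A where "A S = prod_top n K closure_of (E S)" for S
  have E_sub: "E S \<subseteq> topspace (prod_top n K)" for S unfolding E_def top by blast
  have upd: "continuous_map (prod_top n K) euclideanreal (\<lambda>x. f (x(i := t)))"
    if "i \<in> {1..n}" "t \<in> mspace (K i)" for i t
    using continuous_map_compose[OF continuous_map_fun_upd(1)[of i "{1..n}" t "\<lambda>i. mtopology_of (K i)"]] f that
    by (simp add: prod_top_def o_def)
  have cont: "continuous_map (prod_top n K) euclideanreal (\<lambda>x. discrete_grad n star f x y)"
    if "y \<in> prod_pts n K" for y
    unfolding discrete_grad_def partial_diff_def
    using that star by (intro continuous_map_sum continuous_map_diff upd) (auto simp: PiE_iff)
  have osc: "\<bar>discrete_grad n star f x y - discrete_grad n star f x' y\<bar> \<le> D"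
    if S: "S \<in> C" and x: "x \<in> A S" "x' \<in> A S" and y: "y \<in> prod_pts n K" for S x x' y
  proof (rule closure_oscillation_le[OF cont[OF y] _ E_sub x[unfolded A_def]])
    fix x x' assume xx: "x \<in> E S" "x' \<in> E S"
    have "\<bar>restrict (discrete_grad n star f x) (prod_pts n K) y
        - restrict (discrete_grad n star f x') (prod_pts n K) y\<bar> \<le> D"
    proof (rule diam_funspace_bound[where Y = "prod_pts n K" and S = S
        and u = "restrict (discrete_grad n star f x) (prod_pts n K)"
        and v = "restrict (discrete_grad n star f x') (prod_pts n K)"])
      show "S \<subseteq> mspace (bounded_funs n K)" using C(2) S by blast
    qed (use xx D S y in \<open>auto simp: E_def\<close>)
    then show "\<bar>discrete_grad n star f x y - discrete_grad n star f x' y\<bar> \<le> D"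
      using y by simp
  qed
  have A_borel: "A S \<in> sets (borel_of (prod_top n K))" for S
  proof -
    have "topspace (prod_top n K) - A S \<in> sets (borel_of (prod_top n K))"
      unfolding A_def by (intro borel_of_openin openin_diff) auto
    then have "space (borel_of (prod_top n K)) - (topspace (prod_top n K) - A S) \<in> sets (borel_of (prod_top n K))"
      by (rule sets.compl_sets)
    moreover have "A S \<subseteq> topspace (prod_top n K)" unfolding A_def by (rule closure_of_subset_topspace)
    ultimately show ?thesis by (simp add: double_diff)
  qed
  have "\<exists>\<P>. partition_on (prod_pts n K) \<P> \<and> finite \<P> \<and> card \<P> \<le> card C \<and>
    (\<forall>P\<in>\<P>. P \<in> sets (borel_of (prod_top n K)) \<and> (\<exists>S\<in>C. P \<subseteq> A S))"
  proof (rule finite_cover_measurable_partition[OF C(1) A_borel])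
    show "prod_pts n K \<in> sets (borel_of (prod_top n K))"
      using sets.top[of "borel_of (prod_top n K)"] by (simp add: top)
    show "prod_pts n K \<subseteq> (\<Union>S\<in>C. A S)"
    proof
      fix x assume x: "x \<in> prod_pts n K"
      then obtain S where "S \<in> C" "x \<in> E S" using C(3) unfolding E_def by blast
      then show "x \<in> (\<Union>S\<in>C. A S)" using closure_of_subset[OF E_sub] unfolding A_def by blast
    qed
  qed
  then obtain \<P> where \<P>: "partition_on (prod_pts n K) \<P>" "finite \<P>" "card \<P> \<le> card C"
    "\<forall>P\<in>\<P>. P \<in> sets (borel_of (prod_top n K)) \<and> (\<exists>S\<in>C. P \<subseteq> A S)" by blast
  have osc_P: "\<bar>discrete_grad n star f x y - discrete_grad n star f x' y\<bar> \<le> D"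
    if "P \<in> \<P>" "x \<in> P" "x' \<in> P" "y \<in> prod_pts n K" for P x x' y
  proof -
    have "\<exists>S\<in>C. P \<subseteq> A S" using \<P>(4) that(1) by simp
    then obtain S where S: "S \<in> C" "P \<subseteq> A S" by (rule bexE)
    show ?thesis by (rule osc[OF S(1) subsetD[OF S(2) that(2)] subsetD[OF S(2) that(3)] that(4)])
  qed
  show ?thesis
  proof (intro exI[of _ \<P>] exI[of _ D] conjI ballI)
    show "real (card \<P>) \<le> c" using \<P>(3) C(5) by linarith
    show "P \<in> sets (borel_of (prod_top n K))" if "P \<in> \<P>" for P by (rule bspec[OF \<P>(4) that, THEN conjunct1])
    show "\<bar>discrete_grad n star f x y - discrete_grad n star f x' y\<bar> \<le> D"
      if "P \<in> \<P>" "x \<in> P" "x' \<in> P" "y \<in> prod_pts n K" for P x x' y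
      by (rule osc_P[OF that])
  qed (rule \<P>(1) \<P>(2) D(2))+
qed

section \<open>Mixtures of product Gibbs measures\<close>

text \<open>\<open>mult_ln_ge\<close> with slope \<open>- ln N\<close>, the tangent at the uniform
  weight \<open>1 / N\<close>. \<open>Q\<close> may have fewer than \<open>N\<close> elements: it
  will consist of the parts of positive mass, while \<open>N\<close> counts all parts.\<close>

lemma sum_entropy_le:
  fixes p :: "'a \<Rightarrow> real"
  assumes "finite Q" "\<And>x. x \<in> Q \<Longrightarrow> 0 < p x" "sum p Q = 1" "card Q \<le> N"
  shows "- (\<Sum>x\<in>Q. p x * ln (p x)) \<le> ln N"
proof -
  have "Q \<noteq> {}" using assms(3) by auto
  then have "0 < card Q" using assms(1) by (simp add: card_gt_0_iff)
  then have N: "0 < N" using assms(4) by linarith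
  have "(\<Sum>x\<in>Q. p x * (- ln N) + p x - exp (- ln N)) \<le> (\<Sum>x\<in>Q. p x * ln (p x))"
    using assms(2) by (intro sum_mono mult_ln_ge) (simp add: less_imp_le)
  also have "(\<Sum>x\<in>Q. p x * (- ln N) + p x - exp (- ln N)) = - ln N + 1 - card Q / N"
  proof -
    have "(\<Sum>x\<in>Q. p x * (- ln N) + p x - exp (- ln N)) = sum p Q * (- ln N) + sum p Q - card Q * exp (- ln N)"
      by (simp add: sum.distrib sum_subtractf sum_distrib_right sum_negf)
    then show ?thesis using N by (simp add: assms(3) exp_minus divide_inverse)
  qed
  finally have "- ln N + 1 - card Q / N \<le> (\<Sum>x\<in>Q. p x * ln (p x))" .
  moreover have "card Q / N \<le> 1" using assms(4) N by simp
  ultimately show ?thesis by linarith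
qed

text \<open>The measure-theoretic core, with topology reduced to measurable parts and the
  oscillation bound \<open>D0\<close>. \<open>R\<close> stands for \<delta> n.\<close>

theorem (in product_prob_space) gibbs_mixture_of_products:
  fixes f :: "('i \<Rightarrow> 'a) \<Rightarrow> real" and d :: "'i \<Rightarrow> 'a \<Rightarrow> 'a \<Rightarrow> real" and star :: "'i \<Rightarrow> 'a"
  assumes "finite L" "L \<noteq> {}" and f [measurable]: "f \<in> borel_measurable (PiM L M)"
    and f_le: "\<And>x. x \<in> space (PiM L M) \<Longrightarrow> \<bar>f x\<bar> \<le> B"
    and star: "\<And>i. i \<in> L \<Longrightarrow> star i \<in> space (M i)"
    and d_meas: "\<And>i. i \<in> L \<Longrightarrow> (\<lambda>(s, t). ennreal (d i s t)) \<in> borel_measurable (M i \<Otimes>\<^sub>M M i)"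
    and d_le: "\<And>i s t. i \<in> L \<Longrightarrow> s \<in> space (M i) \<Longrightarrow> t \<in> space (M i) \<Longrightarrow> d i s t \<in> {0..1}"
    and d_refl: "\<And>i s. i \<in> L \<Longrightarrow> s \<in> space (M i) \<Longrightarrow> d i s s = 0"
    and \<P>: "partition_on (space (PiM L M)) \<P>" "finite \<P>" "\<And>P. P \<in> \<P> \<Longrightarrow> P \<in> sets (PiM L M)"
    and osc: "\<And>P x x' y. P \<in> \<P> \<Longrightarrow> x \<in> P \<Longrightarrow> x' \<in> P \<Longrightarrow> y \<in> space (PiM L M) \<Longrightarrow>
      \<bar>(\<Sum>i\<in>L. f (x(i := y i)) - f (x(i := star i))) - (\<Sum>i\<in>L. f (x'(i := y i)) - f (x'(i := star i)))\<bar> \<le> D0"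
    and "D0 < R"
  defines "\<mu> \<equiv> gibbs (PiM L M) f"
    and "\<xi> \<equiv> \<lambda>x. gibbs (PiM L M) (\<lambda>y. \<Sum>i\<in>L. f (x(i := y i)) - f (x(i := star i)))"
  shows "\<exists>z D. (\<forall>P\<in>\<P>. z P \<in> P) \<and> (\<Sum>P | P \<in> \<P> \<and> 0 < measure \<mu> P. measure \<mu> P) = 1 \<and>
    (\<Sum>P | P \<in> \<P> \<and> 0 < measure \<mu> P. measure \<mu> P * D P) < ln (card \<P>) + R \<and>
    (\<forall>P\<in>\<P>. 0 < measure \<mu> P \<longrightarrow> 0 \<le> D P \<and> KL (uniform_measure \<mu> P) (\<xi> (z P)) = ereal (D P) \<and>
      (\<forall>a::real. 0 < a \<longrightarrow> transport_dist (\<lambda>x y. (\<Sum>i\<in>L. d i (x i) (y i)) / real (card L))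
        (uniform_measure \<mu> P) (\<xi> (z P)) \<le> ennreal (a + D P / (8 * a * card L))))"
proof -
  interpret L: prob_space "PiM L M" by (rule prob_space_PiM) (rule M.prob_space_axioms)
  interpret \<mu>: prob_space \<mu> unfolding \<mu>_def by (rule L.prob_space_gibbs[OF f f_le])
  have sets_\<mu> [measurable_cong]: "sets \<mu> = sets (PiM L M)" by (simp add: \<mu>_def gibbs_def)
  have space_\<mu>: "space \<mu> = space (PiM L M)" by (simp add: \<mu>_def gibbs_def)
  let ?S = "space (PiM L M)"
  have P_sub: "x \<in> ?S" if "P \<in> \<P>" "x \<in> P" for x P using \<P>(1) that by (auto simp: partition_on_def)
  have B: "0 \<le> B" using f_le L.not_empty by (meson abs_ge_zero ex_in_conv order_trans)
  have upd: "x(i := t) \<in> ?S" if "x \<in> ?S" "t \<in> space (M i)" "i \<in> L" for x i t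
    using fun_upd_in_space_PiM[OF that(1,2)] that(3) by (simp add: insert_absorb)
  have comp: "x i \<in> space (M i)" if "x \<in> ?S" "i \<in> L" for x i using that by (auto simp: space_PiM)
  \<comment> \<open>The lemmas on product Gibbs measures quantify over all indices, so the
    components are set to zero outside \<open>L\<close>.\<close>
  define h where "h x i t = (if i \<in> L then f (x(i := t)) - f (x(i := star i)) else 0)" for x i t
  define G where "G x y = (\<Sum>i\<in>L. f (x(i := y i)) - f (x(i := star i)))" for x y
  have G_h: "G x = (\<lambda>y. \<Sum>i\<in>L. h x i (y i))" for x
    unfolding G_def h_def by (intro ext sum.cong) auto
  have f_sec: "(\<lambda>t. f (x(i := t))) \<in> borel_measurable (M i)" if "x \<in> ?S" "i \<in> L" for x i
    using that by measurable
  have h_meas: "h x i \<in> borel_measurable (M i)" if "x \<in> ?S" for x i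
    unfolding h_def using f_sec[OF that] by (cases "i \<in> L") auto
  have h_le: "\<bar>h x i t\<bar> \<le> 2 * B" if "x \<in> ?S" "t \<in> space (M i)" for x i t
  proof (cases "i \<in> L")
    case True
    then show ?thesis
      using f_le[OF upd[OF that True]] f_le[OF upd[OF that(1) star[OF True] True]] by (simp add: h_def)
  qed (use B in \<open>simp add: h_def\<close>)
  \<comment> \<open>One bound for both exponents: \<open>G x\<close> is a sum of
    \<open>card L\<close> terms of size at most \<open>2 * B\<close>, and \<open>B \<le> C\<close>
    since \<open>L\<close> is nonempty.\<close>
  define C where "C = card L * (2 * B)"
  have card: "1 \<le> real (card L)" using \<open>finite L\<close> \<open>L \<noteq> {}\<close> by (simp add: Suc_leI card_gt_0_iff)
  have "B \<le> C" unfolding C_def using mult_right_mono[OF card, of "2 * B"] B by simp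
  then have f_le_C: "\<bar>f x\<bar> \<le> C" if "x \<in> ?S" for x using f_le[OF that] by linarith
  have G_le: "\<bar>G x y\<bar> \<le> C" if "x \<in> ?S" "y \<in> ?S" for x y
  proof -
    have "\<bar>G x y\<bar> \<le> (\<Sum>i\<in>L. \<bar>h x i (y i)\<bar>)" unfolding G_h by (rule sum_abs)
    also have "\<dots> \<le> C"
      unfolding C_def using h_le[OF that(1) comp[OF that(2)]] by (intro sum_bounded_above)
    finally show ?thesis .
  qed
  have G_meas: "G x \<in> borel_measurable (PiM L M)" if "x \<in> ?S" for x
    unfolding G_h using h_meas[OF that]
    by (intro borel_measurable_sum measurable_compose[OF measurable_component_singleton])
  define lnZ where "lnZ x = ln (\<integral>y. exp (G x y) \<partial>PiM L M)" for x
  \<comment> \<open>The slack for an infimum that need not be attained. \<open>D0 + \<eta>\<close>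
    is the midpoint of \<open>D0\<close> and \<open>R\<close>, hence still strictly below
    \<open>R\<close>.\<close>
  define \<eta> where "\<eta> = (R - D0) / 2"
  have "0 < \<eta>" using \<open>D0 < R\<close> by (simp add: \<eta>_def)
  have lnZ_ge: "- C \<le> lnZ x" if "x \<in> ?S" for x
  proof -
    have "exp (- C) \<le> (\<integral>y. exp (G x y) \<partial>PiM L M)"
      using L.expectation_exp_bounds[OF G_meas[OF that] G_le[OF that]] by simp
    then have "ln (exp (- C)) \<le> lnZ x" unfolding lnZ_def by (intro ln_mono) auto
    then show ?thesis by simp
  qed
  have lnZ_le: "lnZ x \<le> C" if "x \<in> ?S" for x
  proof -
    have "0 < (\<integral>y. exp (G x y) \<partial>PiM L M)" "(\<integral>y. exp (G x y) \<partial>PiM L M) \<le> exp C"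
      using L.expectation_exp_pos[OF G_meas[OF that] G_le[OF that]]
        L.expectation_exp_bounds[OF G_meas[OF that] G_le[OF that]] by auto
    then have "lnZ x \<le> ln (exp C)" unfolding lnZ_def by (intro ln_mono) auto
    then show ?thesis by simp
  qed
  have "\<exists>z\<in>P. \<forall>x\<in>P. lnZ z \<le> lnZ x + \<eta>" if P: "P \<in> \<P>" for P
  proof -
    have ne: "lnZ ` P \<noteq> {}" using \<P>(1) P by (auto simp: partition_on_def)
    have bdd: "bdd_below (lnZ ` P)" using lnZ_ge P_sub[OF P] by (intro bdd_belowI2[of _ "- C"]) auto
    have "Inf (lnZ ` P) < Inf (lnZ ` P) + \<eta>" using \<open>0 < \<eta>\<close> by simp
    from cInf_lessD[OF ne this] obtain z where z: "z \<in> P" "lnZ z < Inf (lnZ ` P) + \<eta>" by blast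
    have "lnZ z \<le> lnZ x + \<eta>" if "x \<in> P" for x
      using cInf_lower[OF imageI[OF that, of lnZ] bdd] z(2) by linarith
    then show ?thesis using z(1) by blast
  qed
  then obtain z where z: "\<And>P. P \<in> \<P> \<Longrightarrow> z P \<in> P" "\<And>P x. P \<in> \<P> \<Longrightarrow> x \<in> P \<Longrightarrow> lnZ (z P) \<le> lnZ x + \<eta>"
    by metis
  define Z where "Z = (\<integral>x. exp (f x) \<partial>PiM L M)"
  let ?Q = "{P. P \<in> \<P> \<and> 0 < measure \<mu> P}"
  have "\<forall>P\<in>?Q. \<exists>D\<ge>0. KL (uniform_measure \<mu> P) (\<xi> (z P)) = ereal D \<and>
      (\<forall>a::real. 0 < a \<longrightarrow> transport_dist (\<lambda>x y. (\<Sum>i\<in>L. d i (x i) (y i)) / real (card L))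
        (uniform_measure \<mu> P) (\<xi> (z P)) \<le> ennreal (a + D / (8 * a * card L))) \<and>
      measure \<mu> P * D = (\<integral>x. indicator P x * (f x - ln Z - (G (z P) x - lnZ (z P)) - ln (measure \<mu> P)) \<partial>\<mu>)"
  proof
    fix P assume P: "P \<in> ?Q"
    then have zP: "z P \<in> ?S" using P_sub z(1) by blast
    have \<xi>: "\<xi> (z P) = gibbs (PiM L M) (\<lambda>y. \<Sum>i\<in>L. h (z P) i (y i))"
      unfolding \<xi>_def G_def[symmetric] G_h ..
    show "\<exists>D\<ge>0. KL (uniform_measure \<mu> P) (\<xi> (z P)) = ereal D \<and>
      (\<forall>a::real. 0 < a \<longrightarrow> transport_dist (\<lambda>x y. (\<Sum>i\<in>L. d i (x i) (y i)) / real (card L))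
        (uniform_measure \<mu> P) (\<xi> (z P)) \<le> ennreal (a + D / (8 * a * card L))) \<and>
      measure \<mu> P * D = (\<integral>x. indicator P x * (f x - ln Z - (G (z P) x - lnZ (z P)) - ln (measure \<mu> P)) \<partial>\<mu>)"
      unfolding \<xi> lnZ_def G_h Z_def \<mu>_def
    proof (rule uniform_gibbs_vs_product[OF assms(1,2) f f_le_C h_meas[OF zP] h_le[OF zP] _ d_meas d_le d_refl])
      show "\<bar>\<Sum>i\<in>L. h (z P) i (x i)\<bar> \<le> C" if "x \<in> ?S" for x
        using G_le[OF zP that] unfolding G_h .
      show "P \<in> sets (PiM L M)" using P \<P>(3) by simp
      show "0 < measure (gibbs (PiM L M) f) P" using P unfolding \<mu>_def by simp
    qed
  qed
  from bchoice[OF this] obtain D where D': "\<forall>P\<in>?Q. 0 \<le> D P \<and> KL (uniform_measure \<mu> P) (\<xi> (z P)) = ereal (D P) \<and>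
      (\<forall>a::real. 0 < a \<longrightarrow> transport_dist (\<lambda>x y. (\<Sum>i\<in>L. d i (x i) (y i)) / real (card L))
        (uniform_measure \<mu> P) (\<xi> (z P)) \<le> ennreal (a + D P / (8 * a * card L))) \<and>
      measure \<mu> P * D P = (\<integral>x. indicator P x * (f x - ln Z - (G (z P) x - lnZ (z P)) - ln (measure \<mu> P)) \<partial>\<mu>)"
    by (rule exE)
  note D = bspec[OF D', THEN conjunct1] bspec[OF D', THEN conjunct2, THEN conjunct1]
    bspec[OF D', THEN conjunct2, THEN conjunct2, THEN conjunct1, rule_format]
    bspec[OF D', THEN conjunct2, THEN conjunct2, THEN conjunct2]

  \<comment> \<open>The integrand with each point as its own base point\<close>
  define W where "W i x = ln (\<integral>t. exp (f (x(i := t))) \<partial>M i)" for i x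
  define V where "V x = f x - ln Z - (\<Sum>i\<in>L. f x - W i x)" for x
  \<comment> \<open>The normaliser of \<open>G x\<close> is a product of one-coordinate integrals,
    so \<open>lnZ x\<close> is the sum of \<open>W i x - f (x(i := star i))\<close>. The reference
    terms cancel against those of \<open>G x x\<close>, where moreover
    \<open>x(i := x i) = x\<close>.\<close>
  have V_eq: "V x = f x - ln Z - (G x x - lnZ x)" if x: "x \<in> ?S" for x
  proof -
    have h_exp: "(\<integral>t. exp (h x i t) \<partial>M i) = exp (- f (x(i := star i))) * exp (W i x)" if i: "i \<in> L" for i
    proof -
      have "0 < (\<integral>t. exp (f (x(i := t))) \<partial>M i)"
        using f_le[OF upd[OF x _ i]] by (intro M.expectation_exp_pos f_sec x i)
      then have "exp (W i x) = (\<integral>t. exp (f (x(i := t))) \<partial>M i)" by (simp add: W_def)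
      moreover have "exp (h x i t) = exp (- f (x(i := star i))) * exp (f (x(i := t)))" for t
        using i by (simp add: h_def flip: exp_add)
      ultimately show ?thesis by simp
    qed
    have "(\<integral>y. exp (G x y) \<partial>PiM L M) = (\<integral>y. (\<Prod>i\<in>L. exp (h x i (y i))) \<partial>PiM L M)"
      unfolding G_h exp_sum[OF \<open>finite L\<close>] ..
    also have "\<dots> = (\<Prod>i\<in>L. \<integral>t. exp (h x i t) \<partial>M i)"
      by (intro product_integral_prod \<open>finite L\<close> M.integrable_exp_bounded[OF h_meas[OF x] h_le[OF x]])
    also have "\<dots> = (\<Prod>i\<in>L. exp (W i x - f (x(i := star i))))"
      by (intro prod.cong refl) (simp add: h_exp flip: exp_add)
    also have "\<dots> = exp (\<Sum>i\<in>L. W i x - f (x(i := star i)))"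
      by (rule exp_sum[OF \<open>finite L\<close>, symmetric])
    finally have "lnZ x = (\<Sum>i\<in>L. W i x - f (x(i := star i)))" by (simp add: lnZ_def)
    then have "G x x - lnZ x = (\<Sum>i\<in>L. f x - W i x)"
      unfolding G_def by (simp add: sum_subtractf)
    then show ?thesis by (simp add: V_def)
  qed
  have W_meas: "W i \<in> borel_measurable (PiM L M)" if [measurable]: "i \<in> L" for i
    unfolding W_def by measurable
  have V_meas [measurable]: "V \<in> borel_measurable (PiM L M)"
    unfolding V_def using W_meas by (intro borel_measurable_diff borel_measurable_sum f) auto
  have V_le: "\<bar>V x\<bar> \<le> 3 * C + \<bar>ln Z\<bar>" if "x \<in> ?S" for x
    unfolding V_eq[OF that] using f_le_C[OF that] G_le[OF that that] lnZ_ge[OF that] lnZ_le[OF that]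
    by linarith
  have V_le_0: "(\<integral>x. V x \<partial>\<mu>) \<le> 0"
    unfolding V_def W_def Z_def \<mu>_def by (rule gibbs_mean_field_le_0[OF \<open>finite L\<close> f f_le])

  \<comment> \<open>Summation over the parts of positive mass\<close>
  have P_meas: "P \<in> sets \<mu>" if "P \<in> \<P>" for P using \<P>(3)[OF that] sets_\<mu> by simp
  have int_ind: "integrable \<mu> (\<lambda>x. indicator P x * v x)"
    if "P \<in> \<P>" "integrable \<mu> v" for P and v :: "_ \<Rightarrow> real"
    using integrable_real_mult_indicator[OF P_meas[OF that(1)] that(2)] by (simp add: mult.commute)
  have sum_ind: "(\<Sum>P\<in>\<P>. indicator P x) = (1 :: real)" if x: "x \<in> ?S" for x
  proof -
    obtain P0 where P0: "P0 \<in> \<P>" "x \<in> P0"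
      using partition_onD1[OF \<P>(1)] x by blast
    have "(\<Sum>P\<in>\<P>. indicator P x) = (\<Sum>P\<in>\<P>. if P = P0 then 1 else (0 :: real))"
    proof (intro sum.cong refl)
      fix P assume P: "P \<in> \<P>"
      show "indicator P x = (if P = P0 then 1 else (0 :: real))"
      proof (cases "P = P0")
        case False
        then have "x \<notin> P" using disjointD[OF partition_onD2[OF \<P>(1)] P P0(1)] P0(2) by blast
        then show ?thesis using False by simp
      qed (use P0(2) in simp)
    qed
    then show ?thesis using \<open>finite \<P>\<close> P0(1) by simp
  qed
  \<comment> \<open>Parts of mass zero contribute nothing, and the indicators of all parts sum to
    one.\<close>
  have sum_Q: "(\<Sum>P\<in>?Q. \<integral>x. indicator P x * v x \<partial>\<mu>) = (\<integral>x. v x \<partial>\<mu>)"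
    if v: "integrable \<mu> v" for v :: "_ \<Rightarrow> real"
  proof -
    have "(\<Sum>P\<in>?Q. \<integral>x. indicator P x * v x \<partial>\<mu>) = (\<Sum>P\<in>\<P>. \<integral>x. indicator P x * v x \<partial>\<mu>)"
    proof (rule sum.mono_neutral_left)
      show "\<forall>P\<in>\<P> - ?Q. (\<integral>x. indicator P x * v x \<partial>\<mu>) = 0"
      proof
        fix P assume P: "P \<in> \<P> - ?Q"
        then have "measure \<mu> P = 0" using measure_nonneg[of \<mu> P] by auto
        then have "P \<in> null_sets \<mu>" using P P_meas by (simp add: null_sets_def \<mu>.emeasure_eq_measure)
        then have "AE x in \<mu>. indicator P x * v x = 0" by (rule AE_mp[OF AE_not_in]) simp
        then show "(\<integral>x. indicator P x * v x \<partial>\<mu>) = 0" by (rule integral_eq_zero_AE)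
      qed
    qed (use \<open>finite \<P>\<close> in auto)
    also have "\<dots> = (\<integral>x. (\<Sum>P\<in>\<P>. indicator P x * v x) \<partial>\<mu>)"
      using int_ind v by (intro Bochner_Integration.integral_sum[symmetric])
    also have "\<dots> = (\<integral>x. v x \<partial>\<mu>)"
      by (intro Bochner_Integration.integral_cong refl)
        (simp add: sum_ind space_\<mu> flip: sum_distrib_right)
    finally show ?thesis .
  qed
  have mass: "(\<Sum>P\<in>?Q. measure \<mu> P) = 1"
    using sum_Q[of "\<lambda>_. 1"] P_meas by (simp add: \<mu>.prob_space)
  have int_V: "integrable \<mu> V"
    using V_le by (intro \<mu>.integrable_bounded[where C = "3 * C + \<bar>ln Z\<bar>"]) (auto simp: space_\<mu>)
  have est: "measure \<mu> P * D P \<le> (\<integral>x. indicator P x * V x \<partial>\<mu>)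
      + measure \<mu> P * (D0 + \<eta>) - measure \<mu> P * ln (measure \<mu> P)" if Q: "P \<in> ?Q" for P
  proof -
    \<comment> \<open>On \<open>P\<close>, \<open>?u x - V x\<close> equals
      \<open>G x x - G (z P) x\<close> plus \<open>lnZ (z P) - lnZ x\<close> minus
      \<open>ln (measure \<mu> P)\<close>. The first is at most \<open>D0\<close> by oscillation,
      the second at most \<open>\<eta>\<close> by the choice of \<open>z P\<close>.\<close>
    let ?c = "D0 + \<eta> - ln (measure \<mu> P)"
    have P: "P \<in> \<P>" using Q by simp
    have zP: "z P \<in> ?S" using P_sub[OF P z(1)[OF P]] .
    have G_meas' [measurable]: "G (z P) \<in> borel_measurable (PiM L M)" by (rule G_meas[OF zP])
    let ?u = "\<lambda>x. f x - ln Z - (G (z P) x - lnZ (z P)) - ln (measure \<mu> P)"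
    have int_u: "integrable \<mu> ?u"
    proof (rule \<mu>.integrable_bounded[where C = "2 * C + \<bar>ln Z\<bar> + \<bar>lnZ (z P)\<bar> + \<bar>ln (measure \<mu> P)\<bar>"])
      show "\<bar>?u x\<bar> \<le> 2 * C + \<bar>ln Z\<bar> + \<bar>lnZ (z P)\<bar> + \<bar>ln (measure \<mu> P)\<bar>" if "x \<in> space \<mu>" for x
        using f_le_C[of x] G_le[OF zP, of x] that unfolding space_\<mu> by linarith
    qed measurable
    have "measure \<mu> P * D P = (\<integral>x. indicator P x * ?u x \<partial>\<mu>)" by (rule D(4)[OF Q])
    also have "\<dots> \<le> (\<integral>x. indicator P x * (V x + ?c) \<partial>\<mu>)"
    proof (rule integral_mono)
      show "integrable \<mu> (\<lambda>x. indicator P x * ?u x)" by (rule int_ind[OF P int_u])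
      show "integrable \<mu> (\<lambda>x. indicator P x * (V x + ?c))" using int_V by (intro int_ind P) simp
      show "indicator P x * ?u x \<le> indicator P x * (V x + ?c)" if "x \<in> space \<mu>" for x
      proof (cases "x \<in> P")
        case True
        have x: "x \<in> ?S" using that by (simp add: space_\<mu>)
        have "\<bar>G x x - G (z P) x\<bar> \<le> D0" unfolding G_def by (rule osc[OF P True z(1)[OF P] x])
        then show ?thesis using z(2)[OF P True] True V_eq[OF x] by simp
      qed simp
    qed
    also have "\<dots> = (\<integral>x. indicator P x * V x + indicator P x * ?c \<partial>\<mu>)" by (simp add: distrib_left)
    also have "\<dots> = (\<integral>x. indicator P x * V x \<partial>\<mu>) + (\<integral>x. indicator P x * ?c \<partial>\<mu>)"
      using int_ind[OF P int_V] int_ind[OF P, of "\<lambda>_. ?c"] by (intro Bochner_Integration.integral_add) auto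
    also have "(\<integral>x. indicator P x * ?c \<partial>\<mu>) = measure \<mu> P * ?c"
      using P_meas[OF P] by simp
    finally show ?thesis by (simp add: algebra_simps)
  qed
  have "(\<Sum>P\<in>?Q. measure \<mu> P * D P) \<le> (\<Sum>P\<in>?Q. (\<integral>x. indicator P x * V x \<partial>\<mu>)
      + measure \<mu> P * (D0 + \<eta>) - measure \<mu> P * ln (measure \<mu> P))"
    by (rule sum_mono) (rule est)
  also have "\<dots> = (\<Sum>P\<in>?Q. \<integral>x. indicator P x * V x \<partial>\<mu>) + (\<Sum>P\<in>?Q. measure \<mu> P) * (D0 + \<eta>)
      + - (\<Sum>P\<in>?Q. measure \<mu> P * ln (measure \<mu> P))"
    by (simp add: sum.distrib sum_subtractf sum_distrib_right)
  also have "\<dots> \<le> 0 + 1 * (D0 + \<eta>) + ln (card \<P>)"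
  proof (intro add_mono)
    show "(\<Sum>P\<in>?Q. \<integral>x. indicator P x * V x \<partial>\<mu>) \<le> 0" using sum_Q[OF int_V] V_le_0 by simp
    show "(\<Sum>P\<in>?Q. measure \<mu> P) * (D0 + \<eta>) \<le> 1 * (D0 + \<eta>)" unfolding mass ..
    show "- (\<Sum>P\<in>?Q. measure \<mu> P * ln (measure \<mu> P)) \<le> ln (card \<P>)"
      using \<open>finite \<P>\<close> mass by (intro sum_entropy_le card_mono) auto
  qed
  also have "\<dots> < ln (card \<P>) + R" using \<open>D0 < R\<close> by (simp add: \<eta>_def field_simps)
  finally have total: "(\<Sum>P\<in>?Q. measure \<mu> P * D P) < ln (card \<P>) + R" .
  show ?thesis
  proof (intro exI[of _ z] exI[of _ D] conjI ballI impI allI)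
    fix P assume P: "P \<in> \<P>"
    show "z P \<in> P" by (rule z(1)[OF P])
    assume "0 < measure \<mu> P"
    with P have Q: "P \<in> ?Q" by simp
    show "0 \<le> D P" "KL (uniform_measure \<mu> P) (\<xi> (z P)) = ereal (D P)" by (rule D(1,2)[OF Q])+
    show "transport_dist (\<lambda>x y. (\<Sum>i\<in>L. d i (x i) (y i)) / real (card L))
        (uniform_measure \<mu> P) (\<xi> (z P)) \<le> ennreal (a + D P / (8 * a * card L))" if "0 < a" for a :: real
      by (rule D(3)[OF Q that])
  qed (rule mass total)+
qed

theorem mainTheorem2:
  fixes n :: nat
    and K :: "nat \<Rightarrow> 'a metric"
    and lam :: "nat \<Rightarrow> 'a measure"
    and star :: "nat \<Rightarrow> 'a"
    and f :: "(nat \<Rightarrow> 'a) \<Rightarrow> real"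
    and \<mu> :: "(nat \<Rightarrow> 'a) measure"
    and \<epsilon> \<delta> :: real
  assumes "n \<ge> 1"
    and "\<And>i. i \<in> {1..n} \<Longrightarrow> mspace (K i) \<noteq> {}"
    and "\<And>i. i \<in> {1..n} \<Longrightarrow> mcomplete_of (K i)"
    and "\<And>i. i \<in> {1..n} \<Longrightarrow> separable_space (mtopology_of (K i))"
    and "\<And>i. i \<in> {1..n} \<Longrightarrow> diam (K i) (mspace (K i)) \<le> 1"
    and "\<And>i. i \<in> {1..n} \<Longrightarrow> prob_space (lam i)"
    and "\<And>i. i \<in> {1..n} \<Longrightarrow> sets (lam i) = sets (borel_of (mtopology_of (K i)))"
    and "\<And>i. i \<in> {1..n} \<Longrightarrow> star i \<in> mspace (K i)"
    and "continuous_map (prod_top n K) euclideanreal f"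
    and "bounded (f ` prod_pts n K)"
    and \<mu>_eq: "\<mu> = gibbs (PiM {1..n} lam) f"
    and "\<delta> > 0"
    and "ereal_of_enat
           (cov (\<delta> * real n) (bounded_funs n K)
             ((\<lambda>x. restrict (discrete_grad n star f x) (prod_pts n K)) ` prod_pts n K))
         \<le> ereal (exp (\<epsilon> * real n))"
  shows "\<exists>(\<P> :: (nat \<Rightarrow> 'a) set set) (g :: (nat \<Rightarrow> 'a) set \<Rightarrow> (nat \<Rightarrow> 'a) \<Rightarrow> real).
           partition_on (prod_pts n K) \<P> \<and> finite \<P> \<and> real (card \<P>) \<le> exp (\<epsilon> * real n) \<and>
           (\<forall>P\<in>\<P>. P \<in> sets (borel_of (prod_top n K))) \<and>
           (\<forall>P\<in>\<P>. additively_separable n K (g P)) \<and>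
           (\<Sum>P | P \<in> \<P> \<and> measure \<mu> P > 0.
              ereal (measure \<mu> P) * KL (uniform_measure \<mu> P) (gibbs (PiM {1..n} lam) (g P)))
             < ereal ((\<epsilon> + \<delta>) * real n) \<and>
           (\<Sum>P | P \<in> \<P> \<and> measure \<mu> P > 0.
              ennreal (measure \<mu> P) *
              transport_dist (avg_dist n K) (uniform_measure \<mu> P) (gibbs (PiM {1..n} lam) (g P)))
             < ennreal (sqrt ((\<epsilon> + \<delta>) / 2))"
proof -
  let ?L = "{1..n}"
  \<comment> \<open>\<open>product_prob_space\<close> asks for a probability measure at every index;
    outside \<open>1..n\<close> the measure \<open>lam 1\<close> fills in, without changing the
    product.\<close>
  define lam' where "lam' i = (if i \<in> ?L then lam i else lam 1)" for i
  have prob_lam': "prob_space (lam' i)" for i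
    unfolding lam'_def using assms(1,6) by auto
  interpret product_prob_space lam' ?L using prob_lam' by (intro product_prob_spaceI)
  have \<Lambda>: "PiM ?L lam = PiM ?L lam'" by (intro PiM_cong) (simp_all add: lam'_def)
  have sets_lam': "sets (lam' i) = sets (borel_of (mtopology_of (K i)))" if "i \<in> ?L" for i
    unfolding lam'_def using assms(7)[OF that] that by (simp only: if_True)
  have space_lam': "space (lam' i) = mspace (K i)" if "i \<in> ?L" for i
    using sets_eq_imp_space_eq[OF sets_lam'[OF that]] by simp
  have space_\<Lambda>: "space (PiM ?L lam') = prod_pts n K"
    using space_PiM_borel_of[of ?L lam' "\<lambda>i. mtopology_of (K i)", OF sets_lam']
    by (simp only: topspace_product_topology topspace_mtopology_of)
  have top: "topspace (prod_top n K) = prod_pts n K" by (simp add: prod_top_def)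
  have borel: "sets (borel_of (prod_top n K)) \<subseteq> sets (PiM ?L lam')"
    unfolding prod_top_def
    by (intro sets_borel_of_product_topology_subset sets_lam' separable_imp_second_countable_metric assms(4)) simp
  have f_meas: "f \<in> borel_measurable (PiM ?L lam')"
    by (rule continuous_map_borel_measurable[OF assms(9) borel]) (simp only: space_\<Lambda> top)
  obtain B where B: "\<And>x. x \<in> prod_pts n K \<Longrightarrow> \<bar>f x\<bar> \<le> B"
    using assms(10) by (auto simp: bounded_iff)
  have r: "0 < \<delta> * real n" using assms(1,12) by simp
  obtain \<P> D0 where \<P>: "partition_on (prod_pts n K) \<P>" "finite \<P>" "real (card \<P>) \<le> exp (\<epsilon> * real n)"
    "D0 < \<delta> * real n" and \<P>': "\<forall>P\<in>\<P>. P \<in> sets (borel_of (prod_top n K)) \<and>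
      (\<forall>x\<in>P. \<forall>x'\<in>P. \<forall>y\<in>prod_pts n K. \<bar>discrete_grad n star f x y - discrete_grad n star f x' y\<bar> \<le> D0)"
    using gradient_partition[OF assms(8,9) r assms(13)] by blast
  have P_borel: "P \<in> sets (borel_of (prod_top n K))" if "P \<in> \<P>" for P
    by (rule bspec[OF \<P>' that, THEN conjunct1])
  have grad: "discrete_grad n star f x = (\<lambda>y. \<Sum>i\<in>?L. f (x(i := y i)) - f (x(i := star i)))" for x
    unfolding discrete_grad_def partial_diff_def ..
  have mdist_le: "mdist (K i) s t \<in> {0..1}" if i: "i \<in> ?L" and st: "s \<in> mspace (K i)" "t \<in> mspace (K i)" for i s t
  proof -
    have "ennreal (mdist (K i) s t) \<le> diam (K i) (mspace (K i))"
      unfolding diam_def using st by (intro SUP_upper2[of s] SUP_upper2[of t]) auto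
    also have "\<dots> \<le> 1" by (rule assms(5)[OF i])
    finally show ?thesis by simp
  qed
  have "\<exists>z D. (\<forall>P\<in>\<P>. z P \<in> P) \<and> (\<Sum>P | P \<in> \<P> \<and> 0 < measure \<mu> P. measure \<mu> P) = 1 \<and>
    (\<Sum>P | P \<in> \<P> \<and> 0 < measure \<mu> P. measure \<mu> P * D P) < ln (card \<P>) + \<delta> * real n \<and>
    (\<forall>P\<in>\<P>. 0 < measure \<mu> P \<longrightarrow> 0 \<le> D P \<and>
      KL (uniform_measure \<mu> P) (gibbs (PiM ?L lam) (discrete_grad n star f (z P))) = ereal (D P) \<and>
      (\<forall>a::real. 0 < a \<longrightarrow> transport_dist (\<lambda>x y. (\<Sum>i\<in>?L. mdist (K i) (x i) (y i)) / real (card ?L))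
        (uniform_measure \<mu> P) (gibbs (PiM ?L lam) (discrete_grad n star f (z P)))
          \<le> ennreal (a + D P / (8 * a * card ?L))))"
    unfolding \<mu>_eq \<Lambda> grad
  proof (rule gibbs_mixture_of_products[where L = ?L and B = B])
    show "?L \<noteq> {}" using assms(1) by simp
    show "star i \<in> space (lam' i)" if "i \<in> ?L" for i
      using assms(8)[OF that] by (simp only: space_lam'[OF that])
    show "(\<lambda>(s, t). ennreal (mdist (K i) s t)) \<in> borel_measurable (lam' i \<Otimes>\<^sub>M lam' i)" if "i \<in> ?L" for i
      by (rule mdist_borel_measurable_pair[OF assms(4)[OF that] sets_lam'[OF that]])
    show "mdist (K i) s t \<in> {0..1}" if "i \<in> ?L" "s \<in> space (lam' i)" "t \<in> space (lam' i)" for i s t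
      using that mdist_le[of i s t] by (simp only: space_lam')
    show "mdist (K i) s s = 0" if "i \<in> ?L" "s \<in> space (lam' i)" for i s
      using that by (simp add: space_lam')
    show "partition_on (space (PiM ?L lam')) \<P>" unfolding space_\<Lambda> by (rule \<P>(1))
    show "P \<in> sets (PiM ?L lam')" if "P \<in> \<P>" for P using P_borel[OF that] borel by (rule subsetD[rotated])
    show "\<bar>(\<Sum>i\<in>?L. f (x(i := y i)) - f (x(i := star i))) - (\<Sum>i\<in>?L. f (x'(i := y i)) - f (x'(i := star i)))\<bar> \<le> D0"
      if "P \<in> \<P>" "x \<in> P" "x' \<in> P" "y \<in> space (PiM ?L lam')" for P x x' y
      using bspec[OF bspec[OF bspec[OF bspec[OF \<P>' that(1), THEN conjunct2] that(2)] that(3)], of y] that(4)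
      unfolding grad space_\<Lambda> .
    show "\<bar>f x\<bar> \<le> B" if "x \<in> space (PiM ?L lam')" for x using that unfolding space_\<Lambda> by (rule B)
  qed (rule f_meas \<P>(2) \<P>(4) finite_atLeastAtMost)+
  then obtain z D where z: "\<forall>P\<in>\<P>. z P \<in> P"
    and mass: "(\<Sum>P | P \<in> \<P> \<and> 0 < measure \<mu> P. measure \<mu> P) = 1"
    and total: "(\<Sum>P | P \<in> \<P> \<and> 0 < measure \<mu> P. measure \<mu> P * D P) < ln (card \<P>) + \<delta> * real n"
    and D: "\<forall>P\<in>\<P>. 0 < measure \<mu> P \<longrightarrow> 0 \<le> D P \<and>
      KL (uniform_measure \<mu> P) (gibbs (PiM ?L lam) (discrete_grad n star f (z P))) = ereal (D P) \<and>
      (\<forall>a::real. 0 < a \<longrightarrow> transport_dist (\<lambda>x y. (\<Sum>i\<in>?L. mdist (K i) (x i) (y i)) / real (card ?L))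
        (uniform_measure \<mu> P) (gibbs (PiM ?L lam) (discrete_grad n star f (z P)))
          \<le> ennreal (a + D P / (8 * a * card ?L)))"
    by (elim exE conjE)
  define Q where "Q = {P. P \<in> \<P> \<and> 0 < measure \<mu> P}"
  define g where "g P = discrete_grad n star f (z P)" for P
  have DQ: "0 \<le> D P" "KL (uniform_measure \<mu> P) (gibbs (PiM ?L lam) (g P)) = ereal (D P)"
    "\<And>a::real. 0 < a \<Longrightarrow> transport_dist (avg_dist n K) (uniform_measure \<mu> P) (gibbs (PiM ?L lam) (g P))
      \<le> ennreal (a + D P / (8 * a * n))" if "P \<in> Q" for P
  proof -
    have P: "P \<in> \<P>" "0 < measure \<mu> P" using that by (simp_all add: Q_def)
    note * = mp[OF bspec[OF D P(1)] P(2)]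
    show "0 \<le> D P" by (rule *[THEN conjunct1])
    show "KL (uniform_measure \<mu> P) (gibbs (PiM ?L lam) (g P)) = ereal (D P)"
      unfolding g_def by (rule *[THEN conjunct2, THEN conjunct1])
    have avg: "avg_dist n K = (\<lambda>x y. (\<Sum>i\<in>?L. mdist (K i) (x i) (y i)) / real (card ?L))"
      by (intro ext) (simp add: avg_dist_def)
    show "transport_dist (avg_dist n K) (uniform_measure \<mu> P) (gibbs (PiM ?L lam) (g P))
      \<le> ennreal (a + D P / (8 * a * n))" if "0 < a" for a :: real
      using *[THEN conjunct2, THEN conjunct2, rule_format, OF that] unfolding g_def avg by simp
  qed
  have pos: "0 < measure \<mu> P" if "P \<in> Q" for P using that by (simp add: Q_def)
  \<comment> \<open>The reference point shows that the space, hence the partition, is nonempty, so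
    logarithms can be taken in the bound on \<open>card \<P>\<close>.\<close>
  have "restrict star ?L \<in> prod_pts n K" using assms(8) by (simp only: restrict_PiE_iff) blast
  then have "\<P> \<noteq> {}" using partition_onD1[OF \<P>(1)] by blast
  then have "0 < card \<P>" using \<P>(2) by (simp add: card_gt_0_iff)
  then have "ln (card \<P>) \<le> \<epsilon> * real n" using \<P>(3) ln_mono[of "real (card \<P>)" "exp (\<epsilon> * real n)"] by simp
  then have total': "(\<Sum>P\<in>Q. measure \<mu> P * D P) < (\<epsilon> + \<delta>) * real n"
    using total unfolding Q_def by (simp add: distrib_right)
  have "0 \<le> (\<Sum>P\<in>Q. measure \<mu> P * D P)"
    using pos DQ(1) by (intro sum_nonneg) (simp add: less_imp_le)
  \<comment> \<open>A nonnegative average of divergences lies strictly below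
    \<open>(\<epsilon> + \<delta>) * n\<close>; the positivity obtained is what makes
    \<open>a\<close> below positive.\<close>
  then have \<epsilon>\<delta>: "0 < \<epsilon> + \<delta>" using total' assms(1) by (smt (verit) mult_nonpos_nonneg of_nat_0_le_iff)
  have KL_sum: "(\<Sum>P\<in>Q. ereal (measure \<mu> P) * KL (uniform_measure \<mu> P) (gibbs (PiM ?L lam) (g P)))
      < ereal ((\<epsilon> + \<delta>) * real n)"
  proof -
    have "(\<Sum>P\<in>Q. ereal (measure \<mu> P) * KL (uniform_measure \<mu> P) (gibbs (PiM ?L lam) (g P)))
       = (\<Sum>P\<in>Q. ereal (measure \<mu> P * D P))"
      by (rule sum.cong[OF refl]) (simp only: DQ(2) times_ereal.simps)
    then show ?thesis using total' by simp
  qed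
  have transport_sum: "(\<Sum>P\<in>Q. ennreal (measure \<mu> P) *
        transport_dist (avg_dist n K) (uniform_measure \<mu> P) (gibbs (PiM ?L lam) (g P)))
      < ennreal (sqrt ((\<epsilon> + \<delta>) / 2))"
  proof -
    \<comment> \<open>The minimiser of \<open>a + (\<epsilon> + \<delta>) / (8 * a)\<close>. There
      both terms equal \<open>a\<close>, and \<open>2 * a\<close> is the target value; the strict
      bound on the averaged divergence makes the second term strictly smaller than
      \<open>a\<close>.\<close>
    define a where "a = sqrt ((\<epsilon> + \<delta>) / 2) / 2"
    have a: "0 < a" using \<epsilon>\<delta> by (simp add: a_def)
    have a2: "8 * a * a = \<epsilon> + \<delta>" using \<epsilon>\<delta> by (simp add: a_def)
    have "(\<Sum>P\<in>Q. ennreal (measure \<mu> P) *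
        transport_dist (avg_dist n K) (uniform_measure \<mu> P) (gibbs (PiM ?L lam) (g P)))
      \<le> (\<Sum>P\<in>Q. ennreal (measure \<mu> P * (a + D P / (8 * a * n))))"
    proof (rule sum_mono)
      fix P assume P: "P \<in> Q"
      show "ennreal (measure \<mu> P) *
          transport_dist (avg_dist n K) (uniform_measure \<mu> P) (gibbs (PiM ?L lam) (g P))
        \<le> ennreal (measure \<mu> P * (a + D P / (8 * a * n)))"
        unfolding ennreal_mult'[OF measure_nonneg] by (intro mult_left_mono DQ(3)[OF P a]) simp
    qed
    also have "\<dots> = ennreal (\<Sum>P\<in>Q. measure \<mu> P * (a + D P / (8 * a * n)))"
      using DQ(1) a by (intro sum_ennreal) simp
    also have "(\<Sum>P\<in>Q. measure \<mu> P * (a + D P / (8 * a * n)))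
        = (\<Sum>P\<in>Q. measure \<mu> P) * a + (\<Sum>P\<in>Q. measure \<mu> P * D P) / (8 * a * n)"
      by (simp add: distrib_left sum.distrib sum_distrib_right sum_divide_distrib)
    also have "\<dots> = a + (\<Sum>P\<in>Q. measure \<mu> P * D P) / (8 * a * n)"
      using mass unfolding Q_def by simp
    also have "ennreal \<dots> < ennreal (sqrt ((\<epsilon> + \<delta>) / 2))"
    proof (rule ennreal_lessI)
      have "(\<Sum>P\<in>Q. measure \<mu> P * D P) / (8 * a * n) < (\<epsilon> + \<delta>) * n / (8 * a * n)"
        using total' a assms(1) by (intro divide_strict_right_mono) auto
      also have "\<dots> = a" unfolding a2[symmetric] using a assms(1) by simp
      finally have less: "(\<Sum>P\<in>Q. measure \<mu> P * D P) / (8 * a * n) < a" .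
      have "sqrt ((\<epsilon> + \<delta>) / 2) = a + a" by (simp add: a_def)
      then show "a + (\<Sum>P\<in>Q. measure \<mu> P * D P) / (8 * a * n) < sqrt ((\<epsilon> + \<delta>) / 2)"
        using less by (simp only: add_strict_left_mono)
    qed (use \<epsilon>\<delta> in simp)
    finally show ?thesis .
  qed
  have sep: "additively_separable n K (g P)" if P: "P \<in> \<P>" for P
  proof -
    have zP: "z P \<in> prod_pts n K" using bspec[OF z P] partition_onD1[OF \<P>(1)] P by blast
    show ?thesis
      unfolding additively_separable_def
    \<comment> \<open>With the base point \<open>z P\<close> fixed, the \<open>i\<close>-th summand
      of the gradient depends on coordinate \<open>i\<close> alone, so the partial differences are
      themselves the components.\<close>
    proof (intro exI[of _ "\<lambda>i. partial_diff star f i (z P)"] conjI ballI)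
      fix i assume i: "i \<in> ?L"
      have "continuous_map (mtopology_of (K i)) (prod_top n K) (\<lambda>t. (z P)(i := t))"
        unfolding prod_top_def using zP i by (intro continuous_map_fun_upd) auto
      from continuous_map_compose[OF this assms(9)]
      show "continuous_map (mtopology_of (K i)) euclideanreal (partial_diff star f i (z P))"
        unfolding partial_diff_def o_def by (intro continuous_map_diff) auto
      have upd: "(z P)(i := t) \<in> prod_pts n K" if "t \<in> mspace (K i)" for t
        using zP i that by (auto simp: PiE_iff extensional_def)
      have "norm (partial_diff star f i (z P) t) \<le> 2 * B" if "t \<in> mspace (K i)" for t
        using B[OF upd[OF that]] B[OF upd[OF assms(8)[OF i]]] by (simp add: partial_diff_def)
      then show "bounded (partial_diff star f i (z P) ` mspace (K i))"
        by (auto simp: bounded_iff)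
    qed (simp only: g_def discrete_grad_def)
  qed
  show ?thesis
    unfolding Q_def[symmetric]
    by (intro exI[of _ \<P>] exI[of _ g] conjI ballI P_borel sep \<P>(1,2,3))
      (use KL_sum transport_sum in \<open>simp_all only: Q_def\<close>)
qed

end
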